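(* (i) Let $\lambda\in P_+^e$ and let $V$ be any integrable $\mathbf U^e$-module generated by a non-zero element $v\in V_\lambda^+$. Then $V$ is a quotient of $W(\lambda)$. (ii) Let $\lambda\in P_+^e$, let $V$ be a finite-dimensional quotient $\mathbf U$-module of $W(\lambda)$, and assume that $\dim V_\lambda=1$ (weight space for $\mathfrak h$). Then $V$ is a quotient of $W(\boldsymbol\pi)$ for some $n$-tuple $\boldsymbol\pi$ of polynomials with constant term $1$. (iii) Let $V$ be a finite-dimensional $\mathbf U$-module generated by a vector $v\in V_\lambda^+$ and such that $\dim V_\lambda=1$ (where $\lambda\in\mathfrak h^*$, and weight spaces are for $\mathfrak h$). Then $V$ is a quotient of $W(\boldsymbol\pi)$ for some $n$-tuple $\boldsymbol\pi$ of polynomials with constant term $1$.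
   Context: Let $\mathfrak g$ be a finite-dimensional complex simple Lie algebra of rank $n$, $\mathfrak h$ a Cartan subalgebra, $I=\{1,\dots,n\}$, $\alpha_i$ ($i\in I$) simple roots, $R^+$ the positive roots, $\theta$ the highest root. For $\alpha\in R^+$ fix nonzero root vectors $x_\alpha^\pm\in\mathfrak g_{\pm\alpha}$ and $h_\alpha\in\mathfrak h$ with $[x_\alpha^+,x_\alpha^-]=h_\alpha$, $[h_\alpha,x_\alpha^\pm]=\pm2x_\alpha^\pm$; write $x_i^\pm=x_{\alpha_i}^\pm$, $h_i=h_{\alpha_i}$. $L(\mathfrak g)=\mathfrak g\otimes\mathbb C[t,t^{-1}]$, $L^e(\mathfrak g)=L(\mathfrak g)\oplus\mathbb Cd$ with $[d,x\otimes t^r]=r\,x\otimes t^r$. $\mathbf U=U(L(\mathfrak g))$, $\mathbf U^e=U(L^e(\mathfrak g))$, $\mathfrak h^e=\mathfrak h\oplus\mathbb Cd$. Write $x^\pm_{\beta,m}=x_\beta^\pm\otimes t^m$, $h_{\beta,m}=h_\beta\otimes t^m$, $x^\pm_{i,m}=x^\pm_{\alpha_i,m}$. $P_+^e$ is the set of $\lambda\in(\mathfrak h^e)^*$ with $\lambda(h_i)\in\mathbb Z_{\ge0}$ for all $i$ and $\lambda(d)\in\mathbb Z$; the restriction of such $\lambda$ to $\mathfrak h$ is also denoted $\lambda$. A $\mathbf U^e$-module $V$ is integrable if it is the direct sum of its $\mathfrak h^e$-weight spaces $V_\mu$ and the elements $x_i^\pm\otimes1$ ($i\in I$), $x_\theta^\mp\otimes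 t^{\pm1}$ act locally nilpotently. $V_\lambda^+=\{v\in V_\lambda: x^+_{\beta,m}.v=0\ \forall\beta\in R^+,m\in\mathbb Z\}$; for $\mathbf U$-modules the same definition is used with $\mathfrak h$-weight spaces. $\mathbf U(0)\subset\mathbf U$ is the (commutative) subalgebra generated by all $h_{\alpha,m}$, $\alpha\in R^+$, $m\ne0$. $\Lambda_i^\pm(u)=\sum_{m\ge0}\Lambda_{i,\pm m}u^m=\exp\left(-\sum_{k\ge1}\frac{h_{\alpha_i,\pm k}}{k}u^k\right)$, $\tilde X_i^-(u)=\sum_{m\in\mathbb Z}x^-_{i,m}u^{m+1}$, $X^-_{i,0}(u)=\sum_{m\ge0}x^-_{i,m}u^{m+1}$; $f_m$ denotes the coefficient of $u^m$ in $f$. $W(\lambda)=\mathbf U^e/\tilde I^e_\lambda$ ($\lambda\in P_+^e$), where $\tilde I_\lambda^e$ is the left ideal generated by: $x^+_{i,m}$ ($m\in\mathbb Z$); $d-\lambda(d)$; $h-\lambda(h)$ ($h\in\mathfrak h$); $\Lambda_{i,m}$ ($|m|>\lambda(h_i)$); $\Lambda_{i,\lambda(h_i)}\Lambda_{i,-m}-\Lambda_{i,\lambda(h_i)-m}$ ($1\le m\le\lambda(h_i)$); $(\tilde X_i^-(u)\Lambda_i^+(u))_m f$ ($m\in\mathbb Z$, $f\in\mathbf U(0)$), understood as $\sum_{k=0}^{\lambda(h_i)}x^-_{i,m-1-k}\Lambda_{i,k}f$; $(X^-_{i,0}(u)^r\Lambda_i^+(u))_mf$ ($r\ge1$, $|m|>\lambda(h_i)$,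 $f\in\mathbf U(0)$); $i\in I$ throughout. As a $\mathbf U$-module $W(\lambda)=\mathbf U/\tilde I_\lambda$, with $\tilde I_\lambda$ generated by the same elements except $d-\lambda(d)$; since $\tilde I_\lambda\mathbf U(0)\subset\tilde I_\lambda$, it is a right $\mathbf U(0)$-module. For an $n$-tuple $\boldsymbol\pi=(\pi_1,\dots,\pi_n)$ of polynomials in $\mathbb C[u]$ with constant term $1$, put $\pi_i^+=\pi_i$ and let $\pi_i^-(u)$ be $u^{\deg\pi_i}\pi_i(u^{-1})$ divided by its constant term. $\mathbb C_{\boldsymbol\pi}$ is the quotient of $\mathbf U(0)$ by the maximal ideal generated by the coefficients of $\Lambda_i^\pm(u)-\pi_i^\pm(u)$, $i\in I$; $\lambda_{\boldsymbol\pi}(h_i)=\deg\pi_i$ (with any integer value $\lambda_{\boldsymbol\pi}(d)$); and $W(\boldsymbol\pi)=W(\lambda_{\boldsymbol\pi})\otimes_{\mathbf U(0)}\mathbb C_{\boldsymbol\pi}$, a left $\mathbf U$-module. *)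

theory Defs
  imports
    Complex_Main
    "HOL-Library.FuncSet"
    "HOL-Library.Poly_Mapping"
    "HOL-Library.Set_Algebras"
    "HOL-Computational_Algebra.Polynomial"
    "HOL-Computational_Algebra.Formal_Power_Series"
begin

section \<open>Complex vector spaces and complex Lie algebras\<close>

class complex_vector = ab_group_add +
  fixes scaleC :: "complex \<Rightarrow> 'a \<Rightarrow> 'a"  (infixr \<open>*\<^sub>C\<close> 75)
  assumes scaleC_add_right: "a *\<^sub>C (x + y) = a *\<^sub>C x + a *\<^sub>C y"
    and scaleC_add_left: "(a + b) *\<^sub>C x = a *\<^sub>C x + b *\<^sub>C x"
    and scaleC_scaleC: "a *\<^sub>C b *\<^sub>C x = (a * b) *\<^sub>C x"
    and scaleC_one: "1 *\<^sub>C x = x"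

global_interpretation complex_vector: vector_space "scaleC :: complex \<Rightarrow> 'a \<Rightarrow> 'a::complex_vector"
  by unfold_locales (simp_all add: scaleC_add_right scaleC_add_left scaleC_scaleC scaleC_one)

class complex_lie_algebra = complex_vector +
  fixes lie_bracket :: "'a \<Rightarrow> 'a \<Rightarrow> 'a"
  assumes lie_add_left: "lie_bracket (x + y) z = lie_bracket x z + lie_bracket y z"
    and lie_add_right: "lie_bracket x (y + z) = lie_bracket x y + lie_bracket x z"
    and lie_scaleC_left: "lie_bracket (c *\<^sub>C x) y = c *\<^sub>C lie_bracket x y"
    and lie_scaleC_right: "lie_bracket x (c *\<^sub>C y) = c *\<^sub>C lie_bracket x y"
    and lie_self: "lie_bracket x x = 0"
    and lie_jacobi:
      "lie_bracket x (lie_bracket y z) + lie_bracket y (lie_bracket z x)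
        + lie_bracket z (lie_bracket x y) = 0"

instantiation complex :: complex_vector
begin
definition scaleC_complex :: "complex \<Rightarrow> complex \<Rightarrow> complex" where "scaleC_complex = (*)"
instance by standard (simp_all add: scaleC_complex_def algebra_simps)
end

instantiation poly_mapping :: (type, complex_vector) complex_vector
begin
definition scaleC_poly_mapping :: "complex \<Rightarrow> ('a \<Rightarrow>\<^sub>0 'b) \<Rightarrow> ('a \<Rightarrow>\<^sub>0 'b)"
  where "scaleC_poly_mapping c = Poly_Mapping.map (scaleC c)"

lemma lookup_scaleC [simp]:
  "Poly_Mapping.lookup (c *\<^sub>C p) k = c *\<^sub>C Poly_Mapping.lookup p k"
  by (simp add: scaleC_poly_mapping_def Poly_Mapping.map.rep_eq when_def)

instance
  by standard (auto intro!: poly_mapping_eqI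
      simp: lookup_add scaleC_add_right scaleC_add_left scaleC_scaleC scaleC_one)
end

lemma complex_vector_eq_neg_self: "x = - x \<Longrightarrow> x = (0 :: 'a::complex_vector)"
proof -
  assume "x = - x"
  then have "x + x = 0" by (metis add.right_inverse)
  then have "(2 :: complex) *\<^sub>C x = 0"
    using scaleC_add_left[of 1 1 x] by (simp add: scaleC_one)
  then show ?thesis by simp
qed

lemma lie_zero_left [simp]: "lie_bracket 0 (x :: 'a::complex_lie_algebra) = 0"
  using lie_add_left[of 0 0 x] by simp

lemma lie_zero_right [simp]: "lie_bracket (x :: 'a::complex_lie_algebra) 0 = 0"
  using lie_add_right[of x 0 0] by simp

lemma lie_skew: "lie_bracket y (x :: 'a::complex_lie_algebra) = - lie_bracket x y"
proof -
  have "lie_bracket x x + lie_bracket y x + (lie_bracket x y + lie_bracket y y) = 0"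
    using lie_self[of "x + y"] by (simp only: lie_add_left lie_add_right)
  then have "lie_bracket x y + lie_bracket y x = 0"
    by (simp add: lie_self add.commute)
  then show ?thesis by (simp add: add_eq_0_iff)
qed


section \<open>The loop algebra and its extension by the derivation\<close>

lemma poly_mapping_add_induct:
  fixes p :: "'a \<Rightarrow>\<^sub>0 'b::comm_monoid_add"
  assumes "P 0" and "\<And>k x. P (Poly_Mapping.single k x)" and "\<And>p q. P p \<Longrightarrow> P q \<Longrightarrow> P (p + q)"
  shows "P p"
proof -
  have sum: "P (\<Sum>k\<in>K. Poly_Mapping.single k (Poly_Mapping.lookup p k))" if "finite K" for K
    using that by induction (auto intro: assms)
  have "p = (\<Sum>k\<in>Poly_Mapping.keys p. Poly_Mapping.single k (Poly_Mapping.lookup p k))"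
    by (rule poly_mapping_eqI)
      (auto simp: lookup_sum lookup_single when_def in_keys_iff sum.delta)
  then show ?thesis using sum[OF finite_keys] by metis
qed

text \<open>
  Finitely supported functions \<open>p : M \<rightarrow> \<gg>\<close> on a commutative monoid \<open>M\<close> form the Lie algebra
  \<open>\<gg> \<otimes> \<complex>[M]\<close>; \<open>single r x\<close> is \<open>x \<otimes> t\<^sup>r\<close>.  For \<open>M = \<int>\<close> this is \<open>\<gg> \<otimes> \<complex>[t, t\<^sup>-\<^sup>1]\<close>.
\<close>

instantiation poly_mapping :: (comm_monoid_add, complex_lie_algebra) complex_lie_algebra
begin

definition lie_bracket_poly_mapping :: "('a \<Rightarrow>\<^sub>0 'b) \<Rightarrow> ('a \<Rightarrow>\<^sub>0 'b) \<Rightarrow> ('a \<Rightarrow>\<^sub>0 'b)"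
  where "lie_bracket_poly_mapping p q =
    (\<Sum>r\<in>Poly_Mapping.keys p. \<Sum>s\<in>Poly_Mapping.keys q.
      Poly_Mapping.single (r + s)
        (lie_bracket (Poly_Mapping.lookup p r) (Poly_Mapping.lookup q s)))"

lemma lie_poly_mapping_superset:
  fixes p q :: "'a \<Rightarrow>\<^sub>0 'b"
  assumes "finite A" "finite B" "Poly_Mapping.keys p \<subseteq> A" "Poly_Mapping.keys q \<subseteq> B"
  shows "lie_bracket p q = (\<Sum>r\<in>A. \<Sum>s\<in>B.
      Poly_Mapping.single (r + s)
        (lie_bracket (Poly_Mapping.lookup p r) (Poly_Mapping.lookup q s)))"
proof -
  have "lie_bracket p q = (\<Sum>r\<in>Poly_Mapping.keys p. \<Sum>s\<in>B.
      Poly_Mapping.single (r + s)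
        (lie_bracket (Poly_Mapping.lookup p r) (Poly_Mapping.lookup q s)))"
    unfolding lie_bracket_poly_mapping_def
    by (rule sum.cong, simp, rule sum.mono_neutral_left) (use assms in \<open>auto simp: in_keys_iff\<close>)
  also have "\<dots> = (\<Sum>r\<in>A. \<Sum>s\<in>B.
      Poly_Mapping.single (r + s)
        (lie_bracket (Poly_Mapping.lookup p r) (Poly_Mapping.lookup q s)))"
    by (rule sum.mono_neutral_left) (use assms in \<open>auto simp: in_keys_iff\<close>)
  finally show ?thesis .
qed

lemma lie_single_single:
  "lie_bracket (Poly_Mapping.single r x) (Poly_Mapping.single s y :: 'a \<Rightarrow>\<^sub>0 'b)
    = Poly_Mapping.single (r + s) (lie_bracket x y)"
  by (subst lie_poly_mapping_superset[of "{r}" "{s}"]) auto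

lemma single_scaleC: "Poly_Mapping.single k (c *\<^sub>C x) = c *\<^sub>C (Poly_Mapping.single k x :: 'a \<Rightarrow>\<^sub>0 'b)"
  by (rule poly_mapping_eqI) (auto simp: lookup_single when_def)

instance
proof
  fix p q r :: "'a \<Rightarrow>\<^sub>0 'b" and c :: complex
  define K where "K = Poly_Mapping.keys p \<union> Poly_Mapping.keys q \<union> Poly_Mapping.keys r
    \<union> Poly_Mapping.keys (p + q) \<union> Poly_Mapping.keys (q + r)
    \<union> Poly_Mapping.keys (c *\<^sub>C p) \<union> Poly_Mapping.keys (c *\<^sub>C q)"
  have K: "lie_bracket u v = (\<Sum>r\<in>K. \<Sum>s\<in>K. Poly_Mapping.single (r + s)
        (lie_bracket (Poly_Mapping.lookup u r) (Poly_Mapping.lookup v s)))"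
    if "u \<in> {p, q, r, p + q, q + r, c *\<^sub>C p, c *\<^sub>C q}" "v \<in> {p, q, r, p + q, q + r, c *\<^sub>C p, c *\<^sub>C q}"
    for u v
    by (rule lie_poly_mapping_superset) (use that in \<open>auto simp: K_def\<close>)
  show "lie_bracket (p + q) r = lie_bracket p r + lie_bracket q r"
    by (simp add: K lookup_add lie_add_left single_add sum.distrib)
  show "lie_bracket p (q + r) = lie_bracket p q + lie_bracket p r"
    by (simp add: K lookup_add lie_add_right single_add sum.distrib)
  show "lie_bracket (c *\<^sub>C p) q = c *\<^sub>C lie_bracket p q"
    by (simp add: K lie_scaleC_left single_scaleC complex_vector.scale_sum_right)
  show "lie_bracket p (c *\<^sub>C q) = c *\<^sub>C lie_bracket p q"
    by (simp add: K lie_scaleC_right single_scaleC complex_vector.scale_sum_right)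
next
  have add_l: "lie_bracket (p + q) r = lie_bracket p r + lie_bracket q r" for p q r :: "'a \<Rightarrow>\<^sub>0 'b"
  proof -
    define K where "K = Poly_Mapping.keys p \<union> Poly_Mapping.keys q \<union> Poly_Mapping.keys (p + q)"
    have K: "lie_bracket u r = (\<Sum>a\<in>K. \<Sum>s\<in>Poly_Mapping.keys r. Poly_Mapping.single (a + s)
        (lie_bracket (Poly_Mapping.lookup u a) (Poly_Mapping.lookup r s)))"
      if "u \<in> {p, q, p + q}" for u
      by (rule lie_poly_mapping_superset) (use that in \<open>auto simp: K_def\<close>)
    show ?thesis
      by (simp add: K lookup_add lie_add_left single_add sum.distrib)
  qed
  have add_r: "lie_bracket r (p + q) = lie_bracket r p + lie_bracket r q" for p q r :: "'a \<Rightarrow>\<^sub>0 'b"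
  proof -
    define K where "K = Poly_Mapping.keys p \<union> Poly_Mapping.keys q \<union> Poly_Mapping.keys (p + q)"
    have K: "lie_bracket r u = (\<Sum>a\<in>Poly_Mapping.keys r. \<Sum>s\<in>K. Poly_Mapping.single (a + s)
        (lie_bracket (Poly_Mapping.lookup r a) (Poly_Mapping.lookup u s)))"
      if "u \<in> {p, q, p + q}" for u
      by (rule lie_poly_mapping_superset) (use that in \<open>auto simp: K_def\<close>)
    show ?thesis
      by (simp add: K lookup_add lie_add_right single_add sum.distrib)
  qed
  have zl: "lie_bracket 0 p = 0" and zr: "lie_bracket p 0 = 0" for p :: "'a \<Rightarrow>\<^sub>0 'b"
    by (simp_all add: lie_bracket_poly_mapping_def)
  have skew: "lie_bracket p q + lie_bracket q p = 0" for p q :: "'a \<Rightarrow>\<^sub>0 'b"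
  proof (induction p rule: poly_mapping_add_induct)
    case (2 k x)
    show ?case
    proof (induction q rule: poly_mapping_add_induct)
      case (2 l y)
      show ?case
        by (simp add: lie_single_single add.commute[of l k] single_add[symmetric] lie_skew[of y x])
    next
      case (3 q q')
      have "lie_bracket (Poly_Mapping.single k x) (q + q') + lie_bracket (q + q') (Poly_Mapping.single k x)
        = (lie_bracket (Poly_Mapping.single k x) q + lie_bracket q (Poly_Mapping.single k x))
        + (lie_bracket (Poly_Mapping.single k x) q' + lie_bracket q' (Poly_Mapping.single k x))"
        by (simp add: add_l add_r add_ac)
      then show ?case using 3 by simp
    qed (simp add: zl zr)
  next
    case (3 p p')
    have "lie_bracket (p + p') q + lie_bracket q (p + p')
      = (lie_bracket p q + lie_bracket q p) + (lie_bracket p' q + lie_bracket q p')"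
      by (simp add: add_l add_r add_ac)
    then show ?case using 3 by simp
  qed (simp add: zl zr)
  show "lie_bracket p p = 0" for p :: "'a \<Rightarrow>\<^sub>0 'b"
    by (rule complex_vector_eq_neg_self) (use skew[of p p] in \<open>simp add: eq_neg_iff_add_eq_0\<close>)
  define J where "J p q r = lie_bracket p (lie_bracket q r) + lie_bracket q (lie_bracket r p)
      + lie_bracket r (lie_bracket p q)" for p q r :: "'a \<Rightarrow>\<^sub>0 'b"
  have J1: "J (p + p') q r = J p q r + J p' q r" for p p' q r
    unfolding J_def by (simp add: add_l add_r add_ac)
  have J2: "J p (q + q') r = J p q r + J p q' r" for p q q' r
    unfolding J_def by (simp add: add_l add_r add_ac)
  have J3: "J p q (r + r') = J p q r + J p q r'" for p q r r'
    unfolding J_def by (simp add: add_l add_r add_ac)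
  have J0: "J 0 q r = 0" "J p 0 r = 0" "J p q 0 = 0" for p q r
    unfolding J_def by (simp_all add: zl zr)
  have "J p q r = 0" for p q r
  proof (induction p rule: poly_mapping_add_induct)
    case (2 k x)
    show ?case
    proof (induction q rule: poly_mapping_add_induct)
      case (2 l y)
      show ?case
      proof (induction r rule: poly_mapping_add_induct)
        case (2 m z)
        have e: "l + (m + k) = k + (l + m)" "m + (k + l) = k + (l + m)"
          by (simp_all add: add_ac)
        show ?case
          unfolding J_def
          by (simp add: lie_single_single e single_add[symmetric] lie_jacobi)
      qed (simp_all add: J0 J3)
    qed (simp_all add: J0 J2)
  qed (simp_all add: J0 J1)
  then show "lie_bracket p (lie_bracket q r) + lie_bracket q (lie_bracket r p)
      + lie_bracket r (lie_bracket p q) = 0" for p q r :: "'a \<Rightarrow>\<^sub>0 'b"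
    unfolding J_def .
qed

end

type_synonym 'g loop = "int \<Rightarrow>\<^sub>0 'g"

abbreviation loop_elt :: "'g::zero \<Rightarrow> int \<Rightarrow> 'g loop"  (infixl \<open>\<otimes>t\<close> 80)
  where "x \<otimes>t m \<equiv> Poly_Mapping.single m x"

definition loop_deriv :: "'g::complex_vector loop \<Rightarrow> 'g loop"
  where "loop_deriv p = Poly_Mapping.mapp (\<lambda>r x. of_int r *\<^sub>C x) p"

lemma lookup_loop_deriv [simp]:
  "Poly_Mapping.lookup (loop_deriv p) r = of_int r *\<^sub>C Poly_Mapping.lookup p r"
  by (simp add: loop_deriv_def lookup_mapp when_def in_keys_iff)

lemma loop_deriv_simps [simp]:
  "loop_deriv (p + q) = loop_deriv p + loop_deriv q"
  "loop_deriv (p - q) = loop_deriv p - loop_deriv q"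
  "loop_deriv (c *\<^sub>C p) = c *\<^sub>C loop_deriv p"
  "loop_deriv (x \<otimes>t m) = of_int m *\<^sub>C (x \<otimes>t m)"
  "loop_deriv 0 = 0"
  by (rule poly_mapping_eqI,
      simp add: lookup_add lookup_minus lookup_single when_def scaleC_add_right
        complex_vector.scale_right_diff_distrib complex_vector.scale_left_commute)+

lemma loop_deriv_lie:
  fixes p q :: "'g::complex_lie_algebra loop"
  shows "loop_deriv (lie_bracket p q) = lie_bracket (loop_deriv p) q + lie_bracket p (loop_deriv q)"
proof (induction p rule: poly_mapping_add_induct)
  case (2 k x)
  show ?case
    by (induction q rule: poly_mapping_add_induct)
      (simp_all add: lie_single_single lie_add_left lie_add_right lie_scaleC_left lie_scaleC_right
        scaleC_add_left add_ac)
qed (simp_all add: lie_add_left lie_add_right add_ac)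

text \<open>\<open>ELoop f a\<close> is \<open>f + a d\<close>.\<close>

typedef (overloaded) 'g eloop = "UNIV :: ('g::zero loop \<times> complex) set" by simp

definition ELoop :: "'g::zero loop \<Rightarrow> complex \<Rightarrow> 'g eloop" where "ELoop f a = Abs_eloop (f, a)"
definition loop_part :: "'g::zero eloop \<Rightarrow> 'g loop" where "loop_part x = fst (Rep_eloop x)"
definition d_part :: "'g::zero eloop \<Rightarrow> complex" where "d_part x = snd (Rep_eloop x)"

lemma eloop_simps [simp]:
  "loop_part (ELoop f a) = f" "d_part (ELoop f a) = a"
  "ELoop (loop_part x) (d_part x) = x"
  by (simp_all add: ELoop_def loop_part_def d_part_def Abs_eloop_inverse Rep_eloop_inverse)

lemma ELoop_inject [simp]: "ELoop f a = ELoop g b \<longleftrightarrow> f = g \<and> a = b"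
  by (metis eloop_simps(1,2))

lemma eloop_eqI: "loop_part x = loop_part y \<Longrightarrow> d_part x = d_part y \<Longrightarrow> x = y"
  by (metis eloop_simps(3))

lemma eloop_cases [cases type: eloop]: obtains f a where "x = ELoop f a"
  by (metis eloop_simps(3))

instantiation eloop :: (complex_lie_algebra) complex_lie_algebra
begin

definition "0 = ELoop 0 0"
definition "x + y = ELoop (loop_part x + loop_part y) (d_part x + d_part y)"
definition "x - y = ELoop (loop_part x - loop_part y) (d_part x - d_part y)"
definition "- x = ELoop (- loop_part x) (- d_part x)"
definition "c *\<^sub>C x = ELoop (c *\<^sub>C loop_part x) (c * d_part x)"
definition "lie_bracket x y =
  ELoop (lie_bracket (loop_part x) (loop_part y)
    + d_part x *\<^sub>C loop_deriv (loop_part y) - d_part y *\<^sub>C loop_deriv (loop_part x)) 0"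

instance
proof
  fix x y z :: "'a eloop"
  show "lie_bracket x (lie_bracket y z) + lie_bracket y (lie_bracket z x)
      + lie_bracket z (lie_bracket x y) = 0"
  proof (cases x; cases y; cases z)
    fix f g h a b c
    assume [simp]: "x = ELoop f a" "y = ELoop g b" "z = ELoop h c"
    have "lie_bracket f (lie_bracket g h) = - lie_bracket g (lie_bracket h f) - lie_bracket h (lie_bracket f g)"
      using lie_jacobi[of f g h] by (simp add: eq_neg_iff_add_eq_0 algebra_simps)
    moreover have "lie_bracket p (q - r) = lie_bracket p q - lie_bracket p r" for p q r :: "'a loop"
      using lie_add_right[of p "q - r" r] by simp
    moreover have "lie_bracket (loop_deriv f) g = - lie_bracket g (loop_deriv f)"
      "lie_bracket (loop_deriv g) h = - lie_bracket h (loop_deriv g)"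
      "lie_bracket (loop_deriv h) f = - lie_bracket f (loop_deriv h)"
      by (rule lie_skew)+
    ultimately show ?thesis
      by (simp add: lie_bracket_eloop_def plus_eloop_def zero_eloop_def loop_deriv_lie
          lie_add_right lie_scaleC_right complex_vector.scale_right_diff_distrib scaleC_add_right
          scaleC_scaleC mult.commute)
  qed
qed (auto simp: zero_eloop_def plus_eloop_def minus_eloop_def uminus_eloop_def scaleC_eloop_def
      lie_bracket_eloop_def scaleC_add_right scaleC_add_left scaleC_scaleC scaleC_one
      lie_add_left lie_add_right lie_scaleC_left lie_scaleC_right lie_self
      complex_vector.scale_right_diff_distrib complex_vector.scale_left_diff_distrib algebra_simps)

end

abbreviation loop_incl :: "'g::zero loop \<Rightarrow> 'g eloop" where "loop_incl f \<equiv> ELoop f 0"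
abbreviation d_elt :: "'g::zero eloop" where "d_elt \<equiv> ELoop 0 1"


section \<open>The universal enveloping algebra\<close>

text \<open>The free monoid, written additively so that \<open>'a fmon \<Rightarrow>\<^sub>0 complex\<close> is the free associative algebra.\<close>

datatype 'a fmon = FMon (letters: "'a list")

instantiation fmon :: (type) monoid_add
begin
definition "0 = FMon []"
definition "x + y = FMon (letters x @ letters y)"
instance by standard (simp_all add: zero_fmon_def plus_fmon_def)
end

type_synonym 'a free_alg = "'a fmon \<Rightarrow>\<^sub>0 complex"

abbreviation free_gen :: "'a \<Rightarrow> 'a free_alg" where "free_gen x \<equiv> Poly_Mapping.single (FMon [x]) 1"

text \<open>
  The free algebra on the underlying set of a Lie algebra modulo the first two families of relations
  is the tensor algebra; the third family gives \<open>xy - yx = [x, y]\<close>.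
\<close>

definition env_relators :: "'a::complex_lie_algebra free_alg set"
  where "env_relators =
      {free_gen (x + y) - free_gen x - free_gen y | x y. True}
    \<union> {free_gen (c *\<^sub>C x) - c *\<^sub>C free_gen x | c x. True}
    \<union> {free_gen x * free_gen y - free_gen y * free_gen x - free_gen (lie_bracket x y) | x y. True}"

definition two_sided_ideal :: "'r::ring_1 set \<Rightarrow> bool"
  where "two_sided_ideal J \<longleftrightarrow>
    0 \<in> J \<and> (\<forall>x\<in>J. \<forall>y\<in>J. x + y \<in> J) \<and> (\<forall>r s. \<forall>x\<in>J. r * x * s \<in> J)"

definition env_ideal :: "'a::complex_lie_algebra free_alg set"
  where "env_ideal = two_sided_ideal hull env_relators"

definition env_rel :: "'a::complex_lie_algebra free_alg \<Rightarrow> 'a free_alg \<Rightarrow> bool"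
  where "env_rel p q \<longleftrightarrow> p - q \<in> env_ideal"

lemma env_ideal: "two_sided_ideal env_ideal"
  unfolding env_ideal_def by (rule hull_in) (auto simp: two_sided_ideal_def)

lemma env_ideal_0: "0 \<in> env_ideal"
  and env_ideal_add: "x \<in> env_ideal \<Longrightarrow> y \<in> env_ideal \<Longrightarrow> x + y \<in> env_ideal"
  and env_ideal_mult: "x \<in> env_ideal \<Longrightarrow> r * x * s \<in> env_ideal"
  using env_ideal by (auto simp: two_sided_ideal_def)

lemma env_ideal_uminus: "x \<in> env_ideal \<Longrightarrow> - x \<in> env_ideal"
  using env_ideal_mult[of x "-1" 1] by simp

lemma env_ideal_mult_left: "x \<in> env_ideal \<Longrightarrow> r * x \<in> env_ideal"
  using env_ideal_mult[of x r 1] by simp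

lemma env_ideal_mult_right: "x \<in> env_ideal \<Longrightarrow> x * s \<in> env_ideal"
  using env_ideal_mult[of x 1 s] by simp

lemma scaleC_free_alg: "c *\<^sub>C p = Poly_Mapping.single 0 c * (p :: 'a free_alg)"
  by (simp add: scaleC_poly_mapping_def scaleC_complex_def mult_map_scale_conv_mult)

lemma env_ideal_lookup_0:
  assumes "p \<in> env_ideal"
  shows "Poly_Mapping.lookup p 0 = 0"
proof -
  have split: "a + b = 0 \<longleftrightarrow> a = 0 \<and> b = 0" for a b :: "'a fmon"
    by (cases a; cases b) (auto simp: zero_fmon_def plus_fmon_def)
  have mult: "Poly_Mapping.lookup (p * q) 0 = Poly_Mapping.lookup p 0 * Poly_Mapping.lookup q 0"
    for p q :: "'a free_alg"
  proof (induction p rule: poly_mapping_add_induct)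
    case (2 k x)
    show ?case
      by (induction q rule: poly_mapping_add_induct)
        (auto simp: mult_single lookup_single when_def split distrib_left lookup_add)
  qed (simp_all add: distrib_right lookup_add)
  have gen: "Poly_Mapping.lookup (free_gen x) 0 = 0" for x :: 'a
    by (simp add: lookup_single zero_fmon_def)
  have "env_ideal \<subseteq> {p :: 'a free_alg. Poly_Mapping.lookup p 0 = 0}"
    unfolding env_ideal_def
  proof (rule hull_minimal)
    show "env_relators \<subseteq> {p :: 'a free_alg. Poly_Mapping.lookup p 0 = 0}"
      by (auto simp: env_relators_def lookup_minus mult gen)
    show "two_sided_ideal {p :: 'a free_alg. Poly_Mapping.lookup p 0 = 0}"
      by (simp add: two_sided_ideal_def lookup_add mult)
  qed
  then show ?thesis using assms by auto
qed

quotient_type (overloaded) 'a env = "'a::complex_lie_algebra free_alg" / env_rel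
proof (rule equivpI)
  show "reflp (env_rel :: 'a free_alg \<Rightarrow> _)" by (simp add: reflp_def env_rel_def env_ideal_0)
  show "symp (env_rel :: 'a free_alg \<Rightarrow> _)"
    by (rule sympI) (use env_ideal_uminus in \<open>fastforce simp: env_rel_def\<close>)
  show "transp (env_rel :: 'a free_alg \<Rightarrow> _)"
    by (rule transpI) (use env_ideal_add in \<open>fastforce simp: env_rel_def\<close>)
qed

instantiation env :: (complex_lie_algebra) "{ring_1, complex_vector}"
begin

lift_definition zero_env :: "'a env" is 0 .
lift_definition one_env :: "'a env" is 1 .
lift_definition plus_env :: "'a env \<Rightarrow> 'a env \<Rightarrow> 'a env" is "(+)"
  unfolding env_rel_def by (metis add_diff_add env_ideal_add)
lift_definition minus_env :: "'a env \<Rightarrow> 'a env \<Rightarrow> 'a env" is "(-)"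
proof -
  fix p p' q q' :: "'a free_alg"
  assume "env_rel p p'" "env_rel q q'"
  then have "(p - p') + - (q - q') \<in> env_ideal"
    unfolding env_rel_def by (intro env_ideal_add env_ideal_uminus)
  then show "env_rel (p - q) (p' - q')" by (simp add: env_rel_def algebra_simps)
qed
lift_definition uminus_env :: "'a env \<Rightarrow> 'a env" is "uminus"
  unfolding env_rel_def using env_ideal_uminus by fastforce
lift_definition times_env :: "'a env \<Rightarrow> 'a env \<Rightarrow> 'a env" is "(*)"
proof -
  fix p p' q q' :: "'a free_alg"
  assume "env_rel p p'" "env_rel q q'"
  then have "(p - p') * q + p' * (q - q') \<in> env_ideal"
    unfolding env_rel_def by (intro env_ideal_add env_ideal_mult_left env_ideal_mult_right)
  then show "env_rel (p * q) (p' * q')" by (simp add: env_rel_def algebra_simps)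
qed
lift_definition scaleC_env :: "complex \<Rightarrow> 'a env \<Rightarrow> 'a env" is "scaleC"
  unfolding env_rel_def
  by (simp add: complex_vector.scale_right_diff_distrib[symmetric])
    (simp add: scaleC_free_alg env_ideal_mult_left)

instance
proof
  fix a b c :: "'a env" and r s :: complex
  show "a * b * c = a * (b * c)" by transfer (simp add: mult.assoc env_rel_def env_ideal_0)
  show "a + b + c = a + (b + c)" by transfer (simp add: add.assoc env_rel_def env_ideal_0)
  show "a + b = b + a" by transfer (simp add: add.commute env_rel_def env_ideal_0)
  show "0 + a = a" "1 * a = a" "a * 1 = a" "- a + a = 0" "a - b = a + - b"
    by (transfer, simp add: env_rel_def env_ideal_0)+
  show "(a + b) * c = a * c + b * c" "a * (b + c) = a * b + a * c"
    by (transfer, simp add: env_rel_def env_ideal_0 algebra_simps)+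
  show "0 \<noteq> (1 :: 'a env)"
  proof (transfer, rule notI)
    assume "env_rel 0 (1 :: 'a free_alg)"
    then have "Poly_Mapping.lookup (0 - 1 :: 'a free_alg) 0 = 0"
      unfolding env_rel_def by (rule env_ideal_lookup_0)
    then show False by (simp add: lookup_minus)
  qed
  show "r *\<^sub>C (a + b) = r *\<^sub>C a + r *\<^sub>C b" "(r + s) *\<^sub>C a = r *\<^sub>C a + s *\<^sub>C a"
    "r *\<^sub>C s *\<^sub>C a = (r * s) *\<^sub>C a" "1 *\<^sub>C a = a"
    by (transfer, simp add: env_rel_def env_ideal_0 scaleC_add_left scaleC_add_right
        scaleC_scaleC scaleC_one)+
qed

end

lift_definition env_of :: "'a::complex_lie_algebra \<Rightarrow> 'a env" is free_gen .

lemma env_of_relators: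
  "env_of (x + y) = env_of x + env_of y"
  "env_of (c *\<^sub>C x) = c *\<^sub>C env_of x"
  "env_of (lie_bracket x y) = env_of x * env_of y - env_of y * env_of x"
proof -
  have r: "p \<in> env_relators \<Longrightarrow> p \<in> env_ideal" for p :: "'a free_alg"
    unfolding env_ideal_def by (rule hull_inc)
  show "env_of (x + y) = env_of x + env_of y"
    by transfer (unfold env_rel_def diff_diff_eq[symmetric], rule r, auto simp: env_relators_def)
  show "env_of (c *\<^sub>C x) = c *\<^sub>C env_of x"
    by transfer (unfold env_rel_def, rule r, auto simp: env_relators_def)
  have "env_of x * env_of y - env_of y * env_of x = env_of (lie_bracket x y)"
    by transfer (unfold env_rel_def, rule r, auto simp: env_relators_def)
  then show "env_of (lie_bracket x y) = env_of x * env_of y - env_of y * env_of x" ..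
qed

lemma env_scaleC_mult:
  "(c *\<^sub>C u) * v = c *\<^sub>C (u * v :: 'a::complex_lie_algebra env)"
  "u * (c *\<^sub>C v) = c *\<^sub>C (u * v :: 'a::complex_lie_algebra env)"
proof -
  have comm: "p * Poly_Mapping.single 0 c = Poly_Mapping.single 0 c * p" for c and p :: "'a free_alg"
    by (induction p rule: poly_mapping_add_induct)
      (simp_all add: mult_single distrib_left distrib_right mult.commute)
  have swap: "p * (Poly_Mapping.single 0 c * q) = Poly_Mapping.single 0 c * (p * q)"
    for c and p q :: "'a free_alg"
    by (metis comm mult.assoc)
  show "(c *\<^sub>C u) * v = c *\<^sub>C (u * v :: 'a env)"
    by transfer (simp add: scaleC_free_alg mult.assoc env_rel_def env_ideal_0)
  show "u * (c *\<^sub>C v) = c *\<^sub>C (u * v :: 'a env)"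
    by transfer (simp add: scaleC_free_alg swap env_rel_def env_ideal_0)
qed

abbreviation env_const :: "complex \<Rightarrow> 'a::complex_lie_algebra env" where "env_const c \<equiv> c *\<^sub>C 1"


section \<open>Modules\<close>

locale left_module =
  fixes act :: "'r::ring_1 \<Rightarrow> 'v::ab_group_add \<Rightarrow> 'v"
  assumes act_add_right: "act r (v + w) = act r v + act r w"
    and act_add_left: "act (r + s) v = act r v + act s v"
    and act_act: "act r (act s v) = act (r * s) v"
    and act_one: "act 1 v = v"

definition module_generated_by :: "('r \<Rightarrow> 'v \<Rightarrow> 'v) \<Rightarrow> 'v \<Rightarrow> bool"
  where "module_generated_by act v \<longleftrightarrow> (\<forall>w. \<exists>u. w = act u v)"

text \<open>Modules whose elements are cosets have an explicit carrier set.\<close>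

record ('r, 'm) mod_struct =
  mcarrier :: "'m set"
  madd :: "'m \<Rightarrow> 'm \<Rightarrow> 'm"
  mact :: "'r \<Rightarrow> 'm \<Rightarrow> 'm"

record ('r, 'm) bimod_struct = "('r, 'm) mod_struct" +
  mract :: "'m \<Rightarrow> 'r \<Rightarrow> 'm"

text \<open>The module given by \<open>act\<close> is the image of \<open>M\<close> under a module homomorphism.\<close>

definition is_quotient_of :: "('r \<Rightarrow> 'v::ab_group_add \<Rightarrow> 'v) \<Rightarrow> ('r, 'm, 'z) mod_struct_scheme \<Rightarrow> bool"
  where "is_quotient_of act M \<longleftrightarrow> (\<exists>\<phi>.
      (\<forall>x\<in>mcarrier M. \<forall>y\<in>mcarrier M. \<phi> (madd M x y) = \<phi> x + \<phi> y)
    \<and> (\<forall>r. \<forall>x\<in>mcarrier M. \<phi> (mact M r x) = act r (\<phi> x))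
    \<and> \<phi> ` mcarrier M = UNIV)"

definition left_ideal :: "'r::ring_1 set \<Rightarrow> bool"
  where "left_ideal J \<longleftrightarrow> 0 \<in> J \<and> (\<forall>x\<in>J. \<forall>y\<in>J. x + y \<in> J) \<and> (\<forall>r. \<forall>x\<in>J. r * x \<in> J)"

text \<open>
  The cyclic module \<open>R/J\<close>, with the right multiplication \<open>(a + J) s = as + J\<close>, which makes
  sense for those \<open>s\<close> with \<open>J s \<subseteq> J\<close>.
\<close>

definition cyclic_module :: "'r::ring_1 set \<Rightarrow> ('r, 'r set) bimod_struct"
  where "cyclic_module J =
    \<lparr> mcarrier = {a +o J | a. True},
      madd = (\<lambda>A B. A + B),
      mact = (\<lambda>r A. r *o A + J),
      mract = (\<lambda>A s. A * {s} + J) \<rparr>"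

definition additive_subgroup :: "'a::ab_group_add set \<Rightarrow> bool"
  where "additive_subgroup K \<longleftrightarrow> 0 \<in> K \<and> (\<forall>x\<in>K. \<forall>y\<in>K. x - y \<in> K)"

text \<open>
  \<open>M \<otimes>\<^sub>S N\<close> for a subring \<open>S\<close>: the free abelian group on \<open>M \<times> N\<close> modulo the subgroup generated
  by the biadditivity and balancing relations, with \<open>r (x \<otimes> y) = (r x) \<otimes> y\<close>.
\<close>

definition tensor_relators ::
  "'r set \<Rightarrow> ('r, 'm, 'y) bimod_struct_scheme \<Rightarrow> ('r, 'k, 'z) mod_struct_scheme \<Rightarrow> ('m \<times> 'k \<Rightarrow>\<^sub>0 int) set"
  where "tensor_relators S M N =
      {frag_of (madd M x x', y) - frag_of (x, y) - frag_of (x', y) | x x' y.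
         x \<in> mcarrier M \<and> x' \<in> mcarrier M \<and> y \<in> mcarrier N}
    \<union> {frag_of (x, madd N y y') - frag_of (x, y) - frag_of (x, y') | x y y'.
         x \<in> mcarrier M \<and> y \<in> mcarrier N \<and> y' \<in> mcarrier N}
    \<union> {frag_of (mract M x s, y) - frag_of (x, mact N s y) | x s y.
         x \<in> mcarrier M \<and> s \<in> S \<and> y \<in> mcarrier N}"

definition tensor_module ::
  "'r set \<Rightarrow> ('r, 'm, 'y) bimod_struct_scheme \<Rightarrow> ('r, 'k, 'z) mod_struct_scheme
    \<Rightarrow> ('r, ('m \<times> 'k \<Rightarrow>\<^sub>0 int) set) mod_struct"
  where "tensor_module S M N =
    (let K = additive_subgroup hull tensor_relators S M N in
    \<lparr> mcarrier = {p +o K | p. Poly_Mapping.keys p \<subseteq> mcarrier M \<times> mcarrier N},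
      madd = (\<lambda>A B. A + B),
      mact = (\<lambda>r A. frag_extend (\<lambda>(x, y). frag_of (mact M r x, y)) ` A + K) \<rparr>)"


section \<open>Finite-dimensional simple Lie algebras with a choice of root vectors\<close>

text \<open>
  A linear functional on a subspace \<open>S\<close> is represented by the function that agrees with it on
  \<open>S\<close> and is \<open>0\<close> elsewhere.
\<close>

definition dual :: "'a::complex_vector set \<Rightarrow> ('a \<Rightarrow> complex) set"
  where "dual S = {f. (\<forall>x\<in>S. \<forall>y\<in>S. f (x + y) = f x + f y)
    \<and> (\<forall>c. \<forall>x\<in>S. f (c *\<^sub>C x) = c * f x) \<and> (\<forall>x. x \<notin> S \<longrightarrow> f x = 0)}"

definition lie_ideal :: "'g::complex_lie_algebra set \<Rightarrow> bool"
  where "lie_ideal J \<longleftrightarrow> complex_vector.subspace J \<and> (\<forall>x. \<forall>y\<in>J. lie_bracket x y \<in> J)"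

definition simple_lie_algebra :: "'g::complex_lie_algebra itself \<Rightarrow> bool"
  where "simple_lie_algebra _ \<longleftrightarrow>
    (\<exists>x y :: 'g. lie_bracket x y \<noteq> 0) \<and> (\<forall>J :: 'g set. lie_ideal J \<longrightarrow> J = {0} \<or> J = UNIV)"

definition finite_dim_lie_algebra :: "'g::complex_lie_algebra itself \<Rightarrow> bool"
  where "finite_dim_lie_algebra _ \<longleftrightarrow> (\<exists>B :: 'g set. finite B \<and> complex_vector.span B = UNIV)"

text \<open>
  Cartan subalgebras of a complex semisimple Lie algebra: maximal abelian subalgebras
  consisting of ad-diagonalisable elements.
\<close>

definition cartan_subalgebra :: "'g::complex_lie_algebra set \<Rightarrow> bool"
  where "cartan_subalgebra H \<longleftrightarrow> complex_vector.subspace H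
    \<and> (\<forall>h\<in>H. \<forall>h'\<in>H. lie_bracket h h' = 0)
    \<and> (\<forall>x. (\<forall>h\<in>H. lie_bracket h x = 0) \<longrightarrow> x \<in> H)
    \<and> (\<forall>h\<in>H. complex_vector.span {x. \<exists>c. lie_bracket h x = c *\<^sub>C x} = UNIV)"

definition root_space :: "'g::complex_lie_algebra set \<Rightarrow> ('g \<Rightarrow> complex) \<Rightarrow> 'g set"
  where "root_space H \<beta> = {x. \<forall>h\<in>H. lie_bracket h x = \<beta> h *\<^sub>C x}"

definition lie_roots :: "'g::complex_lie_algebra set \<Rightarrow> ('g \<Rightarrow> complex) set"
  where "lie_roots H = {\<beta>\<in>dual H. \<beta> \<noteq> (\<lambda>_. 0) \<and> root_space H \<beta> \<noteq> {0}}"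

record 'g lie_data =
  cartan :: "'g set"
  lie_rank :: nat
  sroot :: "nat \<Rightarrow> 'g \<Rightarrow> complex"
  hiroot :: "'g \<Rightarrow> complex"
  xp :: "('g \<Rightarrow> complex) \<Rightarrow> 'g"
  xm :: "('g \<Rightarrow> complex) \<Rightarrow> 'g"
  hc :: "('g \<Rightarrow> complex) \<Rightarrow> 'g"

abbreviation idx :: "'g lie_data \<Rightarrow> nat set" where "idx D \<equiv> {1..lie_rank D}"

definition pos_roots :: "'g::complex_lie_algebra lie_data \<Rightarrow> ('g \<Rightarrow> complex) set"
  where "pos_roots D =
    {\<beta>\<in>lie_roots (cartan D). \<exists>k :: nat \<Rightarrow> nat. \<beta> = (\<lambda>x. \<Sum>i\<in>idx D. of_nat (k i) * sroot D i x)}"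

definition lie_datum :: "'g::complex_lie_algebra lie_data \<Rightarrow> bool"
  where "lie_datum D \<longleftrightarrow>
      finite_dim_lie_algebra TYPE('g) \<and> simple_lie_algebra TYPE('g)
    \<and> cartan_subalgebra (cartan D)
    \<and> lie_rank D = complex_vector.dim (cartan D)
    \<and> sroot D ` idx D \<subseteq> lie_roots (cartan D)
    \<and> (\<forall>f\<in>dual (cartan D). \<exists>!c. (\<forall>i. i \<notin> idx D \<longrightarrow> c i = 0)
          \<and> f = (\<lambda>x. \<Sum>i\<in>idx D. c i * sroot D i x))
    \<and> (\<forall>\<beta>\<in>lie_roots (cartan D). \<beta> \<in> pos_roots D \<or> (\<lambda>x. - \<beta> x) \<in> pos_roots D)
    \<and> hiroot D \<in> pos_roots D
    \<and> (\<forall>\<beta>\<in>pos_roots D. \<exists>k :: nat \<Rightarrow> nat.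
          hiroot D = (\<lambda>x. \<beta> x + (\<Sum>i\<in>idx D. of_nat (k i) * sroot D i x)))
    \<and> (\<forall>\<beta>\<in>pos_roots D.
          xp D \<beta> \<in> root_space (cartan D) \<beta> - {0}
        \<and> xm D \<beta> \<in> root_space (cartan D) (\<lambda>x. - \<beta> x) - {0}
        \<and> hc D \<beta> \<in> cartan D
        \<and> lie_bracket (xp D \<beta>) (xm D \<beta>) = hc D \<beta>
        \<and> lie_bracket (hc D \<beta>) (xp D \<beta>) = 2 *\<^sub>C xp D \<beta>
        \<and> lie_bracket (hc D \<beta>) (xm D \<beta>) = (- 2) *\<^sub>C xm D \<beta>)"

abbreviation xpi :: "'g lie_data \<Rightarrow> nat \<Rightarrow> 'g" where "xpi D i \<equiv> xp D (sroot D i)"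
abbreviation xmi :: "'g lie_data \<Rightarrow> nat \<Rightarrow> 'g" where "xmi D i \<equiv> xm D (sroot D i)"
abbreviation hci :: "'g lie_data \<Rightarrow> nat \<Rightarrow> 'g" where "hci D i \<equiv> hc D (sroot D i)"


section \<open>Weights and integrable modules\<close>

definition cartan_e :: "'g::complex_lie_algebra lie_data \<Rightarrow> 'g eloop set"
  where "cartan_e D = {ELoop (h \<otimes>t 0) a | h a. h \<in> cartan D}"

definition restrict_wt :: "('g::complex_lie_algebra eloop \<Rightarrow> complex) \<Rightarrow> 'g \<Rightarrow> complex"
  where "restrict_wt lam h = lam (loop_incl (h \<otimes>t 0))"

definition P_plus_e :: "'g::complex_lie_algebra lie_data \<Rightarrow> ('g eloop \<Rightarrow> complex) set"
  where "P_plus_e D = {lam\<in>dual (cartan_e D). (\<forall>i\<in>idx D. restrict_wt lam (hci D i) \<in> \<nat>) \<and> lam d_elt \<in> \<int>}"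

definition weight_space_e ::
  "'g::complex_lie_algebra lie_data \<Rightarrow> ('g eloop env \<Rightarrow> 'v \<Rightarrow> 'v) \<Rightarrow> ('g eloop \<Rightarrow> complex) \<Rightarrow> 'v set"
  where "weight_space_e D act \<mu> =
    {v. \<forall>h\<in>cartan_e D. act (env_of h) v = act (env_const (\<mu> h)) v}"

definition weight_space ::
  "'g::complex_lie_algebra lie_data \<Rightarrow> ('g loop env \<Rightarrow> 'v \<Rightarrow> 'v) \<Rightarrow> ('g \<Rightarrow> complex) \<Rightarrow> 'v set"
  where "weight_space D act \<mu> =
    {v. \<forall>h\<in>cartan D. act (env_of (h \<otimes>t 0)) v = act (env_const (\<mu> h)) v}"

definition hw_space_e ::
  "'g::complex_lie_algebra lie_data \<Rightarrow> ('g eloop env \<Rightarrow> 'v::zero \<Rightarrow> 'v) \<Rightarrow> ('g eloop \<Rightarrow> complex) \<Rightarrow> 'v set"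
  where "hw_space_e D act lam = {v\<in>weight_space_e D act lam.
    \<forall>\<beta>\<in>pos_roots D. \<forall>m. act (env_of (loop_incl (xp D \<beta> \<otimes>t m))) v = 0}"

definition hw_space ::
  "'g::complex_lie_algebra lie_data \<Rightarrow> ('g loop env \<Rightarrow> 'v::zero \<Rightarrow> 'v) \<Rightarrow> ('g \<Rightarrow> complex) \<Rightarrow> 'v set"
  where "hw_space D act lam = {v\<in>weight_space D act lam.
    \<forall>\<beta>\<in>pos_roots D. \<forall>m. act (env_of (xp D \<beta> \<otimes>t m)) v = 0}"

definition locally_nilpotent :: "('r::ring_1 \<Rightarrow> 'v::zero \<Rightarrow> 'v) \<Rightarrow> 'r \<Rightarrow> bool"
  where "locally_nilpotent act x \<longleftrightarrow> (\<forall>v. \<exists>N. act (x ^ N) v = 0)"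

text \<open>
  The first conjunct says that the module is the direct sum of its weight spaces: every vector has
  a unique decomposition into finitely many weight vectors.
\<close>

definition integrable_module ::
  "'g::complex_lie_algebra lie_data \<Rightarrow> ('g eloop env \<Rightarrow> 'v::ab_group_add \<Rightarrow> 'v) \<Rightarrow> bool"
  where "integrable_module D act \<longleftrightarrow>
      (\<forall>v. \<exists>!f :: ('g eloop \<Rightarrow> complex) \<Rightarrow>\<^sub>0 'v. Poly_Mapping.keys f \<subseteq> dual (cartan_e D)
          \<and> (\<forall>\<mu>. Poly_Mapping.lookup f \<mu> \<in> weight_space_e D act \<mu>)
          \<and> v = (\<Sum>\<mu>\<in>Poly_Mapping.keys f. Poly_Mapping.lookup f \<mu>))
    \<and> (\<forall>i\<in>idx D. locally_nilpotent act (env_of (loop_incl (xpi D i \<otimes>t 0)))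
          \<and> locally_nilpotent act (env_of (loop_incl (xmi D i \<otimes>t 0))))
    \<and> locally_nilpotent act (env_of (loop_incl (xm D (hiroot D) \<otimes>t 1)))
    \<and> locally_nilpotent act (env_of (loop_incl (xp D (hiroot D) \<otimes>t (-1))))"

definition scal :: "('a::complex_lie_algebra env \<Rightarrow> 'v \<Rightarrow> 'v) \<Rightarrow> complex \<Rightarrow> 'v \<Rightarrow> 'v"
  where "scal act c v = act (env_const c) v"

definition finite_dim_module :: "('a::complex_lie_algebra env \<Rightarrow> 'v::ab_group_add \<Rightarrow> 'v) \<Rightarrow> bool"
  where "finite_dim_module act \<longleftrightarrow> (\<exists>B. finite B \<and> module.span (scal act) B = UNIV)"


section \<open>The modules \<open>W(\<lambda>)\<close> and \<open>W(\<pi>)\<close>\<close>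

text \<open>
  The elements below are needed both in \<open>U(L(\<gg>))\<close> and in \<open>U(L\<^sup>e(\<gg>))\<close>; the parameter
  \<open>j\<close> is the canonical map from \<open>L(\<gg>)\<close> to the algebra in question.
\<close>

definition U0 :: "'g::complex_lie_algebra lie_data \<Rightarrow> ('g loop \<Rightarrow> 'a::complex_lie_algebra env) \<Rightarrow> 'a env set"
  where "U0 D j =
    (\<lambda>S. complex_vector.subspace S \<and> 1 \<in> S \<and> (\<forall>x\<in>S. \<forall>y\<in>S. x * y \<in> S))
      hull {j (hc D \<beta> \<otimes>t m) | \<beta> m. \<beta> \<in> pos_roots D \<and> m \<noteq> 0}"

text \<open>\<open>exp g\<close> for \<open>g\<close> with zero constant term.\<close>

definition env_fps_exp :: "'a::complex_lie_algebra env fps \<Rightarrow> 'a env fps"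
  where "env_fps_exp g = fps_compose (Abs_fps (\<lambda>k. env_const (1 / fact k))) g"

text \<open>\<open>Lambda_ser D j \<epsilon> i\<close> is \<open>\<Lambda>\<^sub>i\<^sup>\<plusminus>(u)\<close> for \<open>\<epsilon> = \<plusminus>1\<close>.\<close>

definition Lambda_ser ::
  "'g::complex_lie_algebra lie_data \<Rightarrow> ('g loop \<Rightarrow> 'a::complex_lie_algebra env) \<Rightarrow> int \<Rightarrow> nat \<Rightarrow> 'a env fps"
  where "Lambda_ser D j \<epsilon> i = env_fps_exp
    (- Abs_fps (\<lambda>k. if k = 0 then 0 else (1 / of_nat k) *\<^sub>C j (hci D i \<otimes>t (\<epsilon> * int k))))"

definition Lambda ::
  "'g::complex_lie_algebra lie_data \<Rightarrow> ('g loop \<Rightarrow> 'a::complex_lie_algebra env) \<Rightarrow> nat \<Rightarrow> int \<Rightarrow> 'a env"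
  where "Lambda D j i m = (if m \<ge> 0 then fps_nth (Lambda_ser D j 1 i) (nat m)
    else fps_nth (Lambda_ser D j (-1) i) (nat (- m)))"

definition Xminus0_ser ::
  "'g::complex_lie_algebra lie_data \<Rightarrow> ('g loop \<Rightarrow> 'a::complex_lie_algebra env) \<Rightarrow> nat \<Rightarrow> 'a env fps"
  where "Xminus0_ser D j i = Abs_fps (\<lambda>k. if k = 0 then 0 else j (xmi D i \<otimes>t (int k - 1)))"

definition wt_nat :: "'g lie_data \<Rightarrow> ('g \<Rightarrow> complex) \<Rightarrow> nat \<Rightarrow> nat"
  where "wt_nat D \<mu> i = (THE k. \<mu> (hci D i) = of_nat k)"

text \<open>
  The common generators of the two left ideals.  In the last family only \<open>m > \<mu>(h\<^sub>i)\<close> occurs,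
  since the coefficients of a power series in negative degrees vanish.
\<close>

definition weyl_relators ::
  "'g::complex_lie_algebra lie_data \<Rightarrow> ('g loop \<Rightarrow> 'a::complex_lie_algebra env) \<Rightarrow> ('g \<Rightarrow> complex) \<Rightarrow> 'a env set"
  where "weyl_relators D j \<mu> =
      {j (xpi D i \<otimes>t m) | i m. i \<in> idx D}
    \<union> {j (h \<otimes>t 0) - env_const (\<mu> h) | h. h \<in> cartan D}
    \<union> {Lambda D j i m | i m. i \<in> idx D \<and> \<bar>m\<bar> > int (wt_nat D \<mu> i)}
    \<union> {Lambda D j i (int (wt_nat D \<mu> i)) * Lambda D j i (- m) - Lambda D j i (int (wt_nat D \<mu> i) - m) | i m.
         i \<in> idx D \<and> 1 \<le> m \<and> m \<le> int (wt_nat D \<mu> i)}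
    \<union> {(\<Sum>k\<le>wt_nat D \<mu> i. j (xmi D i \<otimes>t (m - 1 - int k)) * Lambda D j i (int k)) * f | i m f.
         i \<in> idx D \<and> f \<in> U0 D j}
    \<union> {fps_nth (Xminus0_ser D j i ^ r * Lambda_ser D j 1 i) m * f | i r m f.
         i \<in> idx D \<and> 1 \<le> r \<and> m > wt_nat D \<mu> i \<and> f \<in> U0 D j}"

definition weyl_ideal_e ::
  "'g::complex_lie_algebra lie_data \<Rightarrow> ('g eloop \<Rightarrow> complex) \<Rightarrow> 'g eloop env set"
  where "weyl_ideal_e D lam = left_ideal hull
    (weyl_relators D (\<lambda>f. env_of (loop_incl f)) (restrict_wt lam) \<union> {env_of d_elt - env_const (lam d_elt)})"

definition weyl_ideal ::
  "'g::complex_lie_algebra lie_data \<Rightarrow> ('g eloop \<Rightarrow> complex) \<Rightarrow> 'g loop env set"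
  where "weyl_ideal D lam = left_ideal hull weyl_relators D env_of (restrict_wt lam)"

text \<open>\<open>W(\<lambda>)\<close> over \<open>U(L\<^sup>e(\<gg>))\<close> and over \<open>U(L(\<gg>))\<close> respectively.\<close>

definition weyl_module_e :: "'g::complex_lie_algebra lie_data \<Rightarrow> ('g eloop \<Rightarrow> complex)
    \<Rightarrow> ('g eloop env, 'g eloop env set) bimod_struct"
  where "weyl_module_e D lam = cyclic_module (weyl_ideal_e D lam)"

definition weyl_module :: "'g::complex_lie_algebra lie_data \<Rightarrow> ('g eloop \<Rightarrow> complex)
    \<Rightarrow> ('g loop env, 'g loop env set) bimod_struct"
  where "weyl_module D lam = cyclic_module (weyl_ideal D lam)"

definition minus_poly :: "complex poly \<Rightarrow> complex poly"
  where "minus_poly p = smult (inverse (coeff (reflect_poly p) 0)) (reflect_poly p)"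

definition max_ideal_pi :: "'g::complex_lie_algebra lie_data \<Rightarrow> (nat \<Rightarrow> complex poly) \<Rightarrow> 'g loop env set"
  where "max_ideal_pi D \<pi> =
    (\<lambda>J. additive_subgroup J \<and> (\<forall>s\<in>U0 D env_of. \<forall>x\<in>J. s * x \<in> J)) hull
      ({fps_nth (Lambda_ser D env_of 1 i) m - env_const (coeff (\<pi> i) m) | i m. i \<in> idx D}
     \<union> {fps_nth (Lambda_ser D env_of (-1) i) m - env_const (coeff (minus_poly (\<pi> i)) m) | i m. i \<in> idx D})"

definition C_pi :: "'g::complex_lie_algebra lie_data \<Rightarrow> (nat \<Rightarrow> complex poly)
    \<Rightarrow> ('g loop env, 'g loop env set) mod_struct"
  where "C_pi D \<pi> = \<lparr> mcarrier = {s +o max_ideal_pi D \<pi> | s. s \<in> U0 D env_of},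
    madd = (\<lambda>A B. A + B), mact = (\<lambda>s A. s *o A + max_ideal_pi D \<pi>) \<rparr>"

text \<open>
  \<open>W(\<pi>) = W(\<lambda>\<^sub>\<pi>) \<otimes> \<complex>\<^sub>\<pi>\<close>, where \<open>lam\<close> is a choice of \<open>\<lambda>\<^sub>\<pi>\<close>: its values on \<open>\<hh>\<close> are fixed
  by \<open>\<lambda>\<^sub>\<pi>(h\<^sub>i) = deg \<pi>\<^sub>i\<close>, its value at \<open>d\<close> is an arbitrary integer (which the
  module over \<open>U(L(\<gg>))\<close> does not depend on).
\<close>

definition is_lambda_pi ::
  "'g::complex_lie_algebra lie_data \<Rightarrow> (nat \<Rightarrow> complex poly) \<Rightarrow> ('g eloop \<Rightarrow> complex) \<Rightarrow> bool"
  where "is_lambda_pi D \<pi> lam \<longleftrightarrow>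
    lam \<in> P_plus_e D \<and> (\<forall>i\<in>idx D. restrict_wt lam (hci D i) = of_nat (degree (\<pi> i)))"

definition weyl_module_pi ::
  "'g::complex_lie_algebra lie_data \<Rightarrow> ('g eloop \<Rightarrow> complex) \<Rightarrow> (nat \<Rightarrow> complex poly)
    \<Rightarrow> ('g loop env, ('g loop env set \<times> 'g loop env set \<Rightarrow>\<^sub>0 int) set) mod_struct"
  where "weyl_module_pi D lam \<pi> = tensor_module (U0 D env_of) (weyl_module D lam) (C_pi D \<pi>)"

end

theory Submission
  imports Defs
begin

text \<open>
  Fix a simple root and let \<open>e m\<close>, \<open>f m\<close>, \<open>h m\<close> be the corresponding elements of the loop algebra.
  On a vector killed by all \<open>e m\<close>, Garland's identity expresses \<open>e (\<epsilon> - b) ^ s * f b ^ n\<close> as a nonzero multiple of the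
  coefficient of \<open>u\<^sup>n\<close> in \<open>X(u) ^ (n - s) \<Lambda>(u)\<close>.  If \<open>f 0\<close> is locally nilpotent, then \<open>f 0 ^ (N + 1)\<close> kills the
  highest weight vectors with \<open>h 0 = N\<close>; these are stable under all \<open>h l\<close>, and commuting with
  \<open>h l\<close> shows that every product of \<open>N + 1\<close> of the \<open>f k\<close> kills them.  Together this gives all the
  relations of \<open>W(\<lambda>)\<close>, with no further use of the structure of the simple Lie algebra.  In a
  finite-dimensional module \<open>f 0\<close> acts nilpotently on a weight vector, because the vectors
  \<open>f 0 ^ k v\<close> have distinct weights.  If the highest weight space is a line, then \<open>U(0)\<close> acts on it by
  scalars; the eigenvalues of the coefficients of \<open>\<Lambda>\<^sub>i\<^sup>+\<close> are the coefficients of \<open>\<pi>\<^sub>i\<close>, whose degree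
  is \<open>\<lambda>(h\<^sub>i)\<close> because the relation \<open>\<Lambda>\<^sub>N \<Lambda>\<^sub>-\<^sub>N = 1\<close> makes the top one invertible.
\<close>

unbundle fps_syntax

section \<open>Power series over a noncommutative ring\<close>

lemma fps_mult_commute_coeffs:
  fixes A B :: "'r::ring_1 fps"
  assumes "\<And>m n. A $ m * B $ n = B $ n * A $ m"
  shows "A * B = B * A"
proof (rule fps_ext)
  fix n
  have "(A * B) $ n = (\<Sum>i=0..n. B $ (n - i) * A $ i)"
    by (simp add: fps_mult_nth assms)
  also have "\<dots> = (\<Sum>i=0..n. B $ i * A $ (n - i))"
    by (rule sum.reindex_bij_witness[of _ "\<lambda>i. n - i" "\<lambda>i. n - i"]) auto
  finally show "(A * B) $ n = (B * A) $ n" by (simp add: fps_mult_nth)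
qed

text \<open>The operator u d/du. Unlike d/du it preserves degrees and multiplies the coefficient of
  degree n by n; the factors n - r in Garland's identity come from this.\<close>

definition euler_deriv :: "'r::ring_1 fps \<Rightarrow> 'r fps"
  where "euler_deriv A = Abs_fps (\<lambda>n. of_nat n * A $ n)"

lemma euler_deriv_nth [simp]: "euler_deriv A $ n = of_nat n * A $ n"
  by (simp add: euler_deriv_def)

lemma euler_deriv_mult: "euler_deriv (A * B) = A * euler_deriv B + euler_deriv A * B"
proof (rule fps_ext)
  fix n
  have "of_nat n * (A $ i * B $ (n - i)) = A $ i * (of_nat (n - i) * B $ (n - i)) + of_nat i * A $ i * B $ (n - i)"
    if "i \<in> {0..n}" for i
  proof -
    have "of_nat n = (of_nat (n - i) + of_nat i :: 'a)" using that by (simp flip: of_nat_add)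
    moreover have "A $ i * (of_nat (n - i) * B $ (n - i)) = of_nat (n - i) * (A $ i * B $ (n - i))"
      by (metis mult.assoc mult_of_nat_commute)
    ultimately show ?thesis by (simp add: distrib_right mult.assoc)
  qed
  then show "euler_deriv (A * B) $ n = (A * euler_deriv B + euler_deriv A * B) $ n"
    by (simp add: fps_mult_nth sum_distrib_left flip: sum.distrib)
qed

lemma euler_deriv_power:
  assumes "A * euler_deriv A = euler_deriv A * A"
  shows "euler_deriv (A ^ Suc n) = of_nat (Suc n) * (A ^ n * euler_deriv A)"
proof (induction n)
  case (Suc n)
  have "euler_deriv (A ^ Suc (Suc n)) = A ^ Suc n * euler_deriv A + euler_deriv (A ^ Suc n) * A"
    by (simp only: power_Suc2[of A "Suc n"] euler_deriv_mult)
  also have "euler_deriv (A ^ Suc n) * A = of_nat (Suc n) * (A ^ Suc n * euler_deriv A)"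
    unfolding Suc by (simp only: power_Suc2[of A n] mult.assoc assms)
  finally show ?case
    by (simp only: of_nat_Suc[of "Suc n"] distrib_right mult_1_left)
qed simp

text \<open>For \<open>Y = X\<close> this is the usual commutator of \<open>e\<close> with a power
  of \<open>f\<close> in sl_2. The general \<open>Y\<close> allows \<open>X\<close> to be a
  generating series, or \<open>H\<close> to commute with \<open>X\<close> (\<open>Y = 0\<close>). At
  \<open>r = 0\<close> the truncated exponent \<open>r - 1\<close> is harmless because of the factor
  \<open>of_nat r\<close>.\<close>

lemma commutator_power:
  fixes E X H Y :: "'r::ring_1"
  assumes EX: "E * X = X * E + H" and HX: "H * X = X * H - 2 * Y" and XY: "X * Y = Y * X"
  shows "E * X ^ Suc r = X ^ Suc r * E + of_nat (Suc r) * (X ^ r * H - of_nat r * (X ^ (r - 1) * Y))"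
proof (induction r)
  case (Suc r)
  have 1: "X ^ r * H * X = X ^ Suc r * H - 2 * (X ^ r * Y)"
  proof -
    have "X ^ r * H * X = X ^ r * (X * H - 2 * Y)" by (simp only: mult.assoc HX)
    also have "\<dots> = X ^ Suc r * H - X ^ r * (2 * Y)"
      by (simp only: right_diff_distrib mult.assoc power_Suc2)
    also have "X ^ r * (2 * Y) = 2 * (X ^ r * Y)"
      by (metis mult.assoc mult_2 mult_2_right)
    finally show ?thesis .
  qed
  have 2: "of_nat r * (X ^ (r - 1) * Y) * X = of_nat r * (X ^ r * Y)"
  proof (cases r)
    case (Suc n)
    show ?thesis unfolding Suc diff_Suc_1 by (simp only: power_Suc2 mult.assoc XY)
  qed simp
  have "E * X ^ Suc (Suc r) = (E * X ^ Suc r) * X"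
    by (simp only: power_Suc2 mult.assoc)
  also have "\<dots> = X ^ Suc r * (X * E + H)
      + of_nat (Suc r) * (X ^ Suc r * H - 2 * (X ^ r * Y) - of_nat r * (X ^ r * Y))"
    by (simp only: Suc distrib_right left_diff_distrib mult.assoc EX)
      (simp only: 1[unfolded mult.assoc] 2[unfolded mult.assoc])
  also have "\<dots> = X ^ Suc (Suc r) * E
      + of_nat (Suc (Suc r)) * (X ^ Suc r * H - of_nat (Suc r) * (X ^ (Suc r - 1) * Y))"
  proof -
    define P Q R where "P = X ^ Suc r * H" and "Q = X ^ r * Y" and "R = X ^ Suc (Suc r) * E"
    have p: "X ^ Suc r * (X * E + H) = R + P"
      unfolding P_def R_def by (simp only: distrib_left power_Suc2 mult.assoc)
    have "of_nat (Suc r) * (2 * Q) + of_nat (Suc r) * (of_nat r * Q) = of_nat (Suc (Suc r)) * (of_nat (Suc r) * Q)"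
    proof -
      have "of_nat (Suc r) * (2 * Q) + of_nat (Suc r) * (of_nat r * Q)
        = of_nat (Suc r * 2 + Suc r * r) * Q"
        by (simp only: of_nat_add of_nat_mult distrib_right mult.assoc of_nat_numeral)
      also have "Suc r * 2 + Suc r * r = Suc (Suc r) * Suc r" by simp
      finally show ?thesis by (simp only: of_nat_mult mult.assoc)
    qed
    then have "of_nat (Suc r) * (P - 2 * Q - of_nat r * Q)
        = of_nat (Suc r) * P - of_nat (Suc (Suc r)) * (of_nat (Suc r) * Q)"
      by (simp only: right_diff_distrib diff_diff_eq distrib_left)
    moreover have "of_nat (Suc (Suc r)) * P = P + of_nat (Suc r) * P"
      by (simp only: of_nat_Suc[of "Suc r"] distrib_right mult_1_left)
    ultimately show ?thesis
      unfolding p diff_Suc_1 P_def[symmetric] Q_def[symmetric] R_def[symmetric]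
      by (simp only: right_diff_distrib add.assoc add_diff_eq)
  qed
  finally show ?case .
qed (simp add: EX)

section \<open>Scalars\<close>

lemma of_nat_env: "(of_nat n :: 'a::complex_lie_algebra env) = env_const (of_nat n)"
  by (induction n) (simp_all add: scaleC_add_left scaleC_one)

lemma env_const_mult: "env_const c * u = c *\<^sub>C (u :: 'a::complex_lie_algebra env)"
  by (simp add: env_scaleC_mult)

context left_module
begin

lemma act_zero_left [simp]: "act 0 v = 0"
  using act_add_left[of 0 0 v] by simp

lemma act_zero_right [simp]: "act r 0 = 0"
  using act_add_right[of r 0 0] by simp

lemma act_minus_left: "act (- r) v = - act r v"
  using act_add_left[of r "- r" v] by (simp add: eq_neg_iff_add_eq_0 add.commute)

lemma act_minus_right: "act r (- v) = - act r v"
  using act_add_right[of r v "- v"] by (simp add: eq_neg_iff_add_eq_0 add.commute)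

lemma act_diff_left: "act (r - s) v = act r v - act s v"
  using act_add_left[of r "- s" v] by (simp add: act_minus_left)

lemma act_diff_right: "act r (v - w) = act r v - act r w"
  using act_add_right[of r v "- w"] by (simp add: act_minus_right)

lemma act_sum_left: "act (sum g S) v = (\<Sum>x\<in>S. act (g x) v)"
  by (induction S rule: infinite_finite_induct) (simp_all add: act_add_left)

end

text \<open>The module is given only as an additive group; its complex vector space structure is the
  action of the constants of the enveloping algebra.\<close>

locale env_module = left_module act
  for act :: "'a::complex_lie_algebra env \<Rightarrow> 'v::ab_group_add \<Rightarrow> 'v"
begin

sublocale vs: vector_space "scal act"
  by unfold_locales
    (simp_all add: scal_def act_add_right act_add_left act_act act_one scaleC_add_left
      env_const_mult scaleC_scaleC scaleC_one)

lemma act_scaleC: "act (c *\<^sub>C u) v = scal act c (act u v)"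
  by (simp add: scal_def act_act env_const_mult)

lemma act_scal: "act u (scal act c v) = scal act c (act u v)"
  by (simp add: scal_def act_act env_scaleC_mult)

lemma act_of_nat_mult: "act (of_nat n * u) v = scal act (of_nat n) (act u v)"
  by (simp add: of_nat_env env_const_mult act_scaleC)

section \<open>Strings of sl_2 through a highest weight vector\<close>

lemma sl2_weight:
  assumes hf: "h * f = f * h - 2 * f" and h: "act h v = scal act N v"
  shows "act (h * f ^ n) v = scal act (N - 2 * of_nat n) (act (f ^ n) v)"
proof (induction n)
  case (Suc n)
  have two: "act (2 * u) v = scal act 2 (act u v)" for u v
    using act_of_nat_mult[of 2] by simp
  have "act (h * f ^ Suc n) v = act (f * (h * f ^ n) - 2 * (f * f ^ n)) v"
    by (simp add: mult.assoc[symmetric] hf left_diff_distrib)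
  also have "\<dots> = scal act (N - 2 * of_nat n) (act (f ^ Suc n) v) - scal act 2 (act (f ^ Suc n) v)"
    unfolding act_diff_left act_act[symmetric, of f "h * f ^ n"] Suc two
    by (simp add: act_scal act_act)
  finally show ?case unfolding vs.scale_left_diff_distrib[symmetric] by simp
qed (simp add: h act_one)

text \<open>Here \<open>N\<close> is any complex number: that the weight is a natural number is
  deduced later from the vanishing of this scalar.\<close>

lemma sl2_string:
  assumes ef: "e * f = f * e + h" and hf: "h * f = f * h - 2 * f"
    and e: "act e v = 0" and h: "act h v = scal act N v"
  shows "act (e * f ^ Suc n) v = scal act (of_nat (Suc n) * (N - of_nat n)) (act (f ^ n) v)"
proof (induction n)
  case 0
  show ?case by (simp add: ef act_add_left h act_act[symmetric] e act_one)
next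
  case (Suc n)
  have "act (e * f ^ Suc (Suc n)) v = act (f * (e * f ^ Suc n) + h * f ^ Suc n) v"
    by (simp only: power_Suc[of f "Suc n"] mult.assoc[symmetric] ef distrib_right)
  also have "\<dots> = scal act (of_nat (Suc n) * (N - of_nat n)) (act (f ^ Suc n) v)
      + scal act (N - 2 * of_nat (Suc n)) (act (f ^ Suc n) v)"
    unfolding act_add_left act_act[symmetric, of f "e * f ^ Suc n"] Suc sl2_weight[OF hf h]
    by (simp add: act_scal act_act)
  also have "\<dots> = scal act (of_nat (Suc (Suc n)) * (N - of_nat (Suc n))) (act (f ^ Suc n) v)"
    unfolding vs.scale_left_distrib[symmetric] by (rule arg_cong[where f = "\<lambda>c. scal act c _"]) (simp add: algebra_simps)
  finally show ?case .
qed

text \<open>Going down from \<open>f ^ N\<close> to \<open>f ^ (N - m)\<close> by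
  \<open>sl2_string\<close>, the factors \<open>Suc n\<close> multiply to N!/(N - m)! and the
  factors \<open>N - n\<close> to m!.\<close>

lemma sl2_string_power:
  assumes ef: "e * f = f * e + h" and hf: "h * f = f * h - 2 * f"
    and e: "act e v = 0" and h: "act h v = scal act (of_nat N) v" and "m \<le> N"
  shows "act (e ^ m * f ^ N) v = scal act (fact N * fact m / fact (N - m)) (act (f ^ (N - m)) v)"
  using \<open>m \<le> N\<close>
proof (induction m)
  case (Suc m)
  then have N: "N - m = Suc (N - Suc m)" and m: "N - (N - Suc m) = Suc m" by simp_all
  have "act (e ^ Suc m * f ^ N) v = scal act (fact N * fact m / fact (N - m)) (act (e * f ^ Suc (N - Suc m)) v)"
    using Suc by (simp only: N[symmetric] power_Suc mult.assoc act_act[symmetric] act_scal Suc_leD)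
  also have "act (e * f ^ Suc (N - Suc m)) v
      = scal act (of_nat (N - m) * of_nat (Suc m)) (act (f ^ (N - Suc m)) v)"
    using Suc.prems unfolding sl2_string[OF ef hf e h]
    by (simp only: N[symmetric] of_nat_diff[symmetric] diff_le_self m)
  finally have "act (e ^ Suc m * f ^ N) v
      = scal act (fact N * fact m / fact (N - m) * (of_nat (N - m) * of_nat (Suc m))) (act (f ^ (N - Suc m)) v)"
    by (simp only: vs.scale_scale)
  also have "fact N * fact m / fact (N - m) * (of_nat (N - m) * of_nat (Suc m))
      = (fact N * fact (Suc m) / fact (N - Suc m) :: complex)"
  proof -
    have "a * b / (c * d) * (c * g) = a * (g * b) / d" if "c \<noteq> 0" for a b c d g :: complex
      using that by simp
    then show ?thesis unfolding N fact_Suc by (metis of_nat_neq_0)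
  qed
  finally show ?case .
qed (simp add: act_one)

text \<open>For the least exponent \<open>Suc n\<close> that kills \<open>v\<close>, the string
  formula gives \<open>(n + 1) (N - n) f ^ n v = 0\<close> with \<open>f ^ n v\<close> nonzero. So
  the weight determines the exponent, whatever \<open>K\<close> was.\<close>

lemma sl2_nilpotent_highest_weight:
  assumes ef: "e * f = f * e + h" and hf: "h * f = f * h - 2 * f"
    and e: "act e v = 0" and h: "act h v = scal act N v"
    and "act (f ^ K) v = 0" and "v \<noteq> 0"
  obtains n where "N = of_nat n" and "act (f ^ Suc n) v = 0"
proof -
  define M where "M = (LEAST K. act (f ^ K) v = 0)"
  have M: "act (f ^ M) v = 0" unfolding M_def by (rule LeastI) fact
  with \<open>v \<noteq> 0\<close> obtain n where n: "M = Suc n" by (cases M) (auto simp: act_one)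
  have "act (f ^ n) v \<noteq> 0"
    using not_less_Least[of n "\<lambda>K. act (f ^ K) v = 0"] n M_def by auto
  moreover have "scal act (of_nat (Suc n) * (N - of_nat n)) (act (f ^ n) v) = 0"
    using sl2_string[OF ef hf e h, of n] M by (simp add: n act_act[symmetric])
  ultimately have "N = of_nat n" by (simp del: of_nat_Suc)
  then show ?thesis using M n that by simp
qed

section \<open>Finite-dimensional modules and one-dimensional weight spaces\<close>

lemma eigenvectors_finite:
  fixes w :: "nat \<Rightarrow> 'v"
  assumes eigen: "\<And>k. act h (w k) = scal act (\<mu> k) (w k)" and "inj \<mu>"
    and B: "finite B" "vs.span B = UNIV"
  shows "\<exists>k. w k = 0"
proof (rule ccontr)
  assume "\<not> ?thesis"
  then have w: "w k \<noteq> 0" for k by auto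
  \<comment> \<open>The witness \<open>u\<close> is the product of the \<open>h - \<mu> k\<close>
    over \<open>k < n\<close>. On later \<open>w k\<close> it acts by a product of differences of
    distinct eigenvalues.\<close>
  have ex: "\<exists>u. (\<forall>k<n. act u (w k) = 0) \<and> (\<forall>k\<ge>n. \<exists>c. c \<noteq> 0 \<and> act u (w k) = scal act c (w k))" for n
  proof (induction n)
    case 0
    have "\<exists>c. c \<noteq> 0 \<and> w k = scal act c (w k)" for k
      by (rule exI[of _ 1]) simp
    then show ?case by (intro exI[of _ 1]) (simp add: act_one)
  next
    case (Suc n)
    then obtain u where u: "\<And>k. k < n \<Longrightarrow> act u (w k) = 0"
      "\<And>k. k \<ge> n \<Longrightarrow> \<exists>c. c \<noteq> 0 \<and> act u (w k) = scal act c (w k)" by blast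
    have step: "act (u * (h - env_const (\<mu> n))) (w k) = scal act (\<mu> k - \<mu> n) (act u (w k))" for k
      by (simp add: act_act[symmetric] act_diff_left eigen act_diff_right act_scal vs.scale_left_diff_distrib
          flip: scal_def)
    show ?case
    proof (intro exI[of _ "u * (h - env_const (\<mu> n))"] conjI allI impI)
      fix k assume "k < Suc n"
      then show "act (u * (h - env_const (\<mu> n))) (w k) = 0"
        unfolding step using u(1) by (cases "k = n") auto
    next
      fix k assume k: "Suc n \<le> k"
      then obtain c where c: "c \<noteq> 0" "act u (w k) = scal act c (w k)" using u(2)[of k] by auto
      have "\<mu> k - \<mu> n \<noteq> 0" using inj_eq[OF \<open>inj \<mu>\<close>, of k n] k by simp
      then show "\<exists>c. c \<noteq> 0 \<and> act (u * (h - env_const (\<mu> n))) (w k) = scal act c (w k)"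
        unfolding step c(2) by (intro exI[of _ "(\<mu> k - \<mu> n) * c"]) (simp add: c(1))
    qed
  qed
  \<comment> \<open>The element \<open>u\<close> kills the span of the earlier vectors but not
    \<open>w n\<close>. Hence all the \<open>w n\<close> are independent, too many for the finite
    spanning set \<open>B\<close>.\<close>
  have notin: "w n \<notin> vs.span (w ` {..<n})" for n
  proof -
    obtain u where u: "\<forall>k<n. act u (w k) = 0" "\<forall>k\<ge>n. \<exists>c. c \<noteq> 0 \<and> act u (w k) = scal act c (w k)"
      using ex[of n] by blast
    obtain c where c: "c \<noteq> 0" "act u (w n) = scal act c (w n)"
      using u(2) by (meson order_refl)
    have "vs.span (w ` {..<n}) \<subseteq> {x. act u x = 0}"
      by (rule vs.span_minimal) (use u(1) in \<open>auto simp: vs.subspace_def act_add_right act_scal\<close>)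
    moreover have "act u (w n) \<noteq> 0" using c w[of n] by simp
    ultimately show ?thesis by blast
  qed
  have "vs.independent (w ` {..<n}) \<and> card (w ` {..<n}) = n" for n
  proof (induction n)
    case (Suc n)
    have "w n \<notin> w ` {..<n}" using notin[of n] by (rule contrapos_nn[OF _ vs.span_base])
    then show ?case using Suc notin[of n] by (simp add: lessThan_Suc vs.independent_insert)
  qed (simp add: vs.independent_empty)
  from this[of "Suc (card B)"] show False
    using vs.independent_span_bound[OF B(1), of "w ` {..<Suc (card B)}"] B(2) by simp
qed

lemma sl2_nilpotent_finite_dim:
  assumes "h * f = f * h - 2 * f" and "act h v = scal act N v" and "finite B" "vs.span B = UNIV"
  shows "\<exists>K. act (f ^ K) v = 0"
proof (rule eigenvectors_finite[OF _ _ assms(3,4)])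
  show "act h (act (f ^ k) v) = scal act (N - 2 * of_nat k) (act (f ^ k) v)" for k
    using sl2_weight[OF assms(1,2)] by (simp add: act_act)
  show "inj (\<lambda>k. N - 2 * of_nat k)" by (auto simp: inj_def)
qed

lemma dim_1_multiple:
  assumes "vs.dim W = 1" "v \<in> W" "v \<noteq> 0" "w \<in> W"
  shows "\<exists>c. w = scal act c v"
proof -
  obtain B where B: "W \<subseteq> vs.span B" "card B = vs.dim W" using vs.basis_exists by metis
  then obtain b where "B = {b}" using assms(1) by (metis card_1_singletonE)
  then obtain c d where c: "v = scal act c b" and d: "w = scal act d b"
    using subsetD[OF B(1) assms(2)] subsetD[OF B(1) assms(4)] by (auto simp: vs.span_singleton)
  then have "c \<noteq> 0" using assms(3) by auto
  then have "w = scal act (d / c) v" by (simp add: c d)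
  then show ?thesis ..
qed

text \<open>The module generated by 0 is zero, and the zero space has no basis with one
  element.\<close>

lemma dim_1_generator_nonzero:
  assumes "vs.dim W = 1" and "module_generated_by act v"
  shows "v \<noteq> 0"
proof
  assume "v = 0"
  then have 0: "w = 0" for w :: 'v
    using assms(2) unfolding module_generated_by_def by (metis act_zero_right)
  obtain B where B: "vs.independent B" "card B = vs.dim W" using vs.basis_exists by metis
  then obtain b where "B = {b}" using assms(1) by (metis card_1_singletonE)
  then show False using B(1) 0[of b] vs.dependent_zero[of B] by auto
qed

end

section \<open>Garland's identity in the loop algebra of \<open>sl\<^sub>2\<close>\<close>

text \<open>The series \<open>\<Lambda>\<^sub>i\<^sup>\<plusminus>(u)\<close> for
  \<open>\<epsilon> = \<plusminus>1\<close>, written for an arbitrary family \<open>h\<close> so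
  that it can be studied inside sl_2 alone.\<close>

definition exp_ser :: "int \<Rightarrow> (int \<Rightarrow> 'a::complex_lie_algebra env) \<Rightarrow> 'a env fps"
  where "exp_ser \<epsilon> h = env_fps_exp (- Abs_fps (\<lambda>k. if k = 0 then 0 else (1 / of_nat k) *\<^sub>C h (\<epsilon> * int k)))"

text \<open>Minus the logarithmic derivative, with respect to u d/du, of
  \<open>exp_ser \<epsilon> h\<close>.\<close>

definition pos_ser :: "int \<Rightarrow> (int \<Rightarrow> 'a::complex_lie_algebra env) \<Rightarrow> 'a env fps"
  where "pos_ser \<epsilon> h = Abs_fps (\<lambda>k. if k = 0 then 0 else h (\<epsilon> * int k))"

text \<open>For \<open>\<epsilon> = 1\<close> and \<open>b = 0\<close> this is the series
  \<open>X\<^sup>-\<^sub>i\<^sub>,\<^sub>0(u)\<close>. The starting index \<open>b\<close> gives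
  access to the relations with arbitrary integer index, and \<open>\<epsilon> = -1\<close> to those
  for the negative half of \<open>\<Lambda>\<close>.\<close>

definition shift_ser :: "int \<Rightarrow> int \<Rightarrow> (int \<Rightarrow> 'a::complex_lie_algebra env) \<Rightarrow> 'a env fps"
  where "shift_ser \<epsilon> b f = Abs_fps (\<lambda>k. if k = 0 then 0 else f (b + \<epsilon> * (int k - 1)))"

lemma shift_ser_0 [simp]: "shift_ser \<epsilon> b f $ 0 = 0"
  by (simp add: shift_ser_def)

section \<open>Logarithmic derivatives and Newton's recursion\<close>

lemma env_fps_exp_nth:
  assumes "g $ 0 = 0" and "n \<le> N"
  shows "env_fps_exp g $ n = (\<Sum>i\<le>N. (1 / fact i) *\<^sub>C (g ^ i $ n))"
proof -
  have "env_fps_exp g $ n = (\<Sum>i\<le>n. (1 / fact i) *\<^sub>C (g ^ i $ n))"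
    by (simp add: env_fps_exp_def fps_compose_nth env_const_mult atLeast0AtMost)
  \<comment> \<open>\<open>g ^ i\<close> starts in degree \<open>i\<close> or higher. The free upper
    bound \<open>N\<close> lets coefficients of different degrees share one index range.\<close>
  also have "\<dots> = (\<Sum>i\<le>N. (1 / fact i) *\<^sub>C (g ^ i $ n))"
  proof (rule sum.mono_neutral_left)
    show "\<forall>i\<in>{..N} - {..n}. (1 / fact i) *\<^sub>C (g ^ i $ n) = 0"
    proof
      fix i assume "i \<in> {..N} - {..n}"
      then have "n < i" by simp
      then have "g ^ i $ n = 0" using startsby_zero_power_prefix[OF assms(1), of i] by blast
      then show "(1 / fact i) *\<^sub>C (g ^ i $ n) = 0" by simp
    qed
  qed (use assms(2) in auto)
  finally show ?thesis .
qed

lemma euler_deriv_env_fps_exp: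
  assumes "g $ 0 = 0" and comm: "g * euler_deriv g = euler_deriv g * g"
  shows "euler_deriv (env_fps_exp g) = euler_deriv g * env_fps_exp g"
proof (rule fps_ext)
  fix n
  have gp: "g ^ m * euler_deriv g = euler_deriv g * g ^ m" for m
    by (induction m) (simp_all add: mult.assoc, metis comm mult.assoc)
  \<comment> \<open>The bound is \<open>Suc n\<close> because the constant term of the exponential
    drops out and the remaining terms are shifted down by one.\<close>
  have "euler_deriv (env_fps_exp g) $ n = (\<Sum>i\<le>Suc n. (1 / fact i) *\<^sub>C (euler_deriv (g ^ i) $ n))"
    using assms by (simp add: env_fps_exp_nth[of g n "Suc n"] distrib_left sum_distrib_left env_scaleC_mult
      del: sum.atMost_Suc)
  also have "\<dots> = (\<Sum>i\<le>n. (1 / fact (Suc i)) *\<^sub>C (euler_deriv (g ^ Suc i) $ n))"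
    by (subst sum.atMost_Suc_shift) simp
  also have "\<dots> = (\<Sum>i\<le>n. (1 / fact i) *\<^sub>C ((euler_deriv g * g ^ i) $ n))"
  proof (rule sum.cong[OF refl])
    fix i
    have "of_nat (Suc i) * B = fps_const (of_nat (Suc i)) * B" for B :: "'a env fps"
      by (simp only: fps_of_nat)
    then have "euler_deriv (g ^ Suc i) $ n = of_nat (Suc i) *\<^sub>C ((euler_deriv g * g ^ i) $ n)"
      by (simp only: euler_deriv_power[OF comm] gp fps_mult_left_const_nth of_nat_env env_const_mult)
    then show "(1 / fact (Suc i)) *\<^sub>C (euler_deriv (g ^ Suc i) $ n) = (1 / fact i) *\<^sub>C ((euler_deriv g * g ^ i) $ n)"
      by (simp add: scaleC_scaleC fact_Suc del: of_nat_Suc power_Suc)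
  qed
  also have "\<dots> = (\<Sum>i\<le>n. \<Sum>k=0..n. euler_deriv g $ k * ((1 / fact i) *\<^sub>C (g ^ i $ (n - k))))"
    by (simp only: fps_mult_nth complex_vector.scale_sum_right env_scaleC_mult)
  also have "\<dots> = (\<Sum>k=0..n. euler_deriv g $ k * (\<Sum>i\<le>n. (1 / fact i) *\<^sub>C (g ^ i $ (n - k))))"
    by (subst sum.swap) (simp only: sum_distrib_left)
  also have "\<dots> = (euler_deriv g * env_fps_exp g) $ n"
    using assms(1) by (simp add: fps_mult_nth env_fps_exp_nth[of g _ n])
  finally show "euler_deriv (env_fps_exp g) $ n = (euler_deriv g * env_fps_exp g) $ n" .
qed

lemma exp_ser_0 [simp]: "exp_ser \<epsilon> h $ 0 = 1"
  by (simp add: exp_ser_def env_fps_exp_def scaleC_one)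

lemma euler_deriv_exp_ser:
  assumes "\<And>a b. h a * h b = h b * h a"
  shows "euler_deriv (exp_ser \<epsilon> h) = - (pos_ser \<epsilon> h * exp_ser \<epsilon> h)"
proof -
  define g where "g = - Abs_fps (\<lambda>k. if k = 0 then 0 else (1 / of_nat k) *\<^sub>C h (\<epsilon> * int k))"
  have g: "euler_deriv g = - pos_ser \<epsilon> h"
    by (rule fps_ext) (simp add: g_def pos_ser_def of_nat_env env_const_mult env_scaleC_mult scaleC_scaleC scaleC_one)
  have "g * euler_deriv g = euler_deriv g * g"
    unfolding g by (rule fps_mult_commute_coeffs) (simp add: g_def pos_ser_def env_scaleC_mult assms)
  then have "euler_deriv (env_fps_exp g) = euler_deriv g * env_fps_exp g"
    by (intro euler_deriv_env_fps_exp) (simp_all add: g_def)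
  then show ?thesis by (simp add: exp_ser_def g_def[symmetric] g)
qed

text \<open>Newton's identities, with the \<open>h\<close> as power sums and the coefficients of
  \<open>exp_ser\<close> as signed elementary symmetric functions; they are the coefficients of
  \<open>euler_deriv_exp_ser\<close>.\<close>

lemma exp_ser_Suc:
  assumes "\<And>a b. h a * h b = h b * h a"
  shows "of_nat (Suc n) * exp_ser \<epsilon> h $ Suc n
    = - (\<Sum>k\<le>n. h (\<epsilon> * int (Suc k)) * exp_ser \<epsilon> h $ (n - k))"
proof -
  have "of_nat (Suc n) * exp_ser \<epsilon> h $ Suc n = (- (pos_ser \<epsilon> h * exp_ser \<epsilon> h)) $ Suc n"
    by (simp only: euler_deriv_exp_ser[OF assms, symmetric] euler_deriv_nth)
  also have "\<dots> = - (\<Sum>k\<le>Suc n. pos_ser \<epsilon> h $ k * exp_ser \<epsilon> h $ (Suc n - k))"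
    by (simp only: fps_neg_nth fps_mult_nth atLeast0AtMost)
  also have "\<dots> = - (\<Sum>k\<le>n. h (\<epsilon> * int (Suc k)) * exp_ser \<epsilon> h $ (n - k))"
    by (subst sum.atMost_Suc_shift) (simp add: pos_ser_def)
  finally show ?thesis .
qed

text \<open>By the recursion every coefficient arises from 1 by linear combinations and left
  multiplication by some \<open>h a\<close> with \<open>a\<close> nonzero, so it lies in the
  subalgebra that these generate, as membership in \<open>U(0)\<close> demands.\<close>

lemma exp_ser_induct:
  assumes comm: "\<And>a b. h a * h b = h b * h a" and one: "P 1"
    and mult: "\<And>a u. a \<noteq> 0 \<Longrightarrow> P u \<Longrightarrow> P (h a * u)" and add: "\<And>u w. P u \<Longrightarrow> P w \<Longrightarrow> P (u + w)"
    and zero: "P 0" and scale: "\<And>c u. P u \<Longrightarrow> P (c *\<^sub>C u)" and "\<epsilon> \<noteq> 0"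
  shows "P (exp_ser \<epsilon> h $ n)"
proof (induction n rule: less_induct)
  case (less n)
  show ?case
  proof (cases n)
    case (Suc m)
    have sum: "P (sum g S)" if "\<And>k. k \<in> S \<Longrightarrow> P (g k)" for g :: "nat \<Rightarrow> 'a env" and S
      using that by (induction S rule: infinite_finite_induct) (auto intro: zero add)
    have "P (\<Sum>k\<le>m. h (\<epsilon> * int (Suc k)) * exp_ser \<epsilon> h $ (m - k))"
      using \<open>\<epsilon> \<noteq> 0\<close> Suc by (intro sum mult less) auto
    from scale[OF this, of "- (1 / of_nat (Suc m))"]
    have "P ((- (1 / of_nat (Suc m))) *\<^sub>C (\<Sum>k\<le>m. h (\<epsilon> * int (Suc k)) * exp_ser \<epsilon> h $ (m - k)))" .
    also have "(- (1 / of_nat (Suc m))) *\<^sub>C (\<Sum>k\<le>m. h (\<epsilon> * int (Suc k)) * exp_ser \<epsilon> h $ (m - k))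
        = (1 / of_nat (Suc m)) *\<^sub>C (of_nat (Suc m) * exp_ser \<epsilon> h $ Suc m)"
      by (simp only: exp_ser_Suc[OF comm]) simp
    also have "\<dots> = exp_ser \<epsilon> h $ n"
      by (simp add: Suc of_nat_env env_const_mult scaleC_scaleC scaleC_one del: of_nat_Suc)
    finally show ?thesis .
  qed (simp add: one)
qed

section \<open>Commutation relations in the loop algebra of sl_2\<close>

locale sl2_loop =
  fixes e f h :: "int \<Rightarrow> 'a::complex_lie_algebra env"
  assumes ee: "e a * e b = e b * e a" and ff: "f a * f b = f b * f a" and hh: "h a * h b = h b * h a"
    and ef: "e a * f b = f b * e a + h (a + b)"
    and hf: "h a * f b = f b * h a - 2 * f (a + b)"
    and he: "h a * e b = e b * h a + 2 * e (a + b)"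
begin

text \<open>One step of Garland's identity. In degree n the last bracket is \<open>n - r\<close>
  times the coefficient of \<open>X ^ r * L\<close>, so \<open>E\<close> lowers the power of
  \<open>X\<close> by one up to a scalar and a term in which \<open>E\<close> meets \<open>L\<close>
  directly.\<close>

lemma garland_commutator:
  fixes \<epsilon> b
  defines "X \<equiv> shift_ser \<epsilon> b f" and "L \<equiv> exp_ser \<epsilon> h" and "E \<equiv> fps_const (e (\<epsilon> - b))"
  shows "E * (X ^ Suc r * L)
    = X ^ Suc r * (E * L) - of_nat (Suc r) * (euler_deriv (X ^ r * L) - of_nat r * (X ^ r * L))"
proof -
  define H where "H = pos_ser \<epsilon> h"
  define Y where "Y = euler_deriv X - X"
  \<comment> \<open>The index \<open>\<epsilon> - b\<close> is the one for which the bracket with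
    \<open>f (b + \<epsilon> * (k - 1))\<close> is \<open>h (\<epsilon> * k)\<close>.\<close>
  have EX: "E * X = X * E + H"
    by (rule fps_ext)
      (simp add: E_def X_def H_def pos_ser_def shift_ser_def ef algebra_simps)
  have XX': "X * euler_deriv X = euler_deriv X * X"
  proof (rule fps_mult_commute_coeffs)
    fix m n
    have "X $ m * X $ n = X $ n * X $ m" by (simp add: X_def shift_ser_def ff)
    then show "X $ m * euler_deriv X $ n = euler_deriv X $ n * X $ m"
      by (simp add: of_nat_env env_scaleC_mult)
  qed
  then have XY: "X * Y = Y * X" by (simp add: Y_def algebra_simps)
  \<comment> \<open>In degree n each of the \<open>n - 1\<close> pairs of positive degrees
    contributes the same bracket \<open>- 2 * F\<close>, and \<open>n - 1\<close> is the eigenvalue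
    of u d/du - 1, hence the definition of \<open>Y\<close>.\<close>
  have HX: "H * X = X * H - 2 * Y"
  proof (rule fps_ext)
    fix n
    define F where "F = f (b + \<epsilon> * (int n - 1))"
    have HX1: "H $ k * X $ (n - k) = X $ (n - k) * H $ k - (if k \<in> {1..<n} then 2 * F else 0)" if "k \<in> {0..n}" for k
    proof (cases "k \<in> {1..<n}")
      case True
      then have *: "\<epsilon> * int k + (b + \<epsilon> * (int (n - k) - 1)) = b + \<epsilon> * (int n - 1)"
        by (simp add: of_nat_diff algebra_simps)
      have "H $ k = h (\<epsilon> * int k)" "X $ (n - k) = f (b + \<epsilon> * (int (n - k) - 1))"
        using True by (simp_all add: H_def X_def pos_ser_def shift_ser_def)
      then show ?thesis using True by (simp only: hf F_def * if_True)
    next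
      case False
      then have "k = 0 \<or> k = n" using that by auto
      then show ?thesis using False by (auto simp: H_def X_def pos_ser_def shift_ser_def)
    qed
    have "(H * X) $ n = (\<Sum>k=0..n. X $ (n - k) * H $ k) - (\<Sum>k=0..n. if k \<in> {1..<n} then 2 * F else 0)"
      unfolding fps_mult_nth sum_subtractf[symmetric] by (rule sum.cong[OF refl HX1])
    also have "(\<Sum>k=0..n. X $ (n - k) * H $ k) = (X * H) $ n"
      unfolding fps_mult_nth by (rule sum.reindex_bij_witness[of _ "\<lambda>i. n - i" "\<lambda>i. n - i"]) auto
    also have "(\<Sum>k=0..n. if k \<in> {1..<n} then 2 * F else 0) = of_nat (n - 1) * (2 * F)"
    proof -
      have "{0..n} \<inter> {k. k \<in> {1..<n}} = {1..<n}" by auto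
      then show ?thesis by (simp only: sum.If_cases[OF finite_atLeastAtMost] sum_constant card_atLeastLessThan mult_zero_right add_0_right)
    qed
    also have "\<dots> = (2 * Y) $ n"
    proof -
      have "(2 * Y) $ n = 2 * Y $ n" by (simp only: mult_2 fps_add_nth)
      moreover have "of_nat (n - 1) * (2 * F) = 2 * (of_nat (n - 1) * F)"
        by (simp only: mult.assoc[symmetric] mult_of_nat_commute[of "n - 1" 2])
      moreover have "of_nat (n - 1) * F = Y $ n"
        by (cases n) (simp_all add: Y_def X_def shift_ser_def F_def distrib_right)
      ultimately show ?thesis by simp
    qed
    finally show "(H * X) $ n = (X * H - 2 * Y) $ n" by simp
  qed
  have HL: "H * L = - euler_deriv L"
    using euler_deriv_exp_ser[of h \<epsilon>, OF hh] by (simp add: L_def H_def)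
  \<comment> \<open>Up to multiples of \<open>X ^ r\<close>, this term and \<open>H * L\<close> are
    u d/du of \<open>X ^ r\<close> and of \<open>L\<close>; the product rule then collects them into
    the derivative of \<open>X ^ r * L\<close>.\<close>
  have eXr: "of_nat r * (X ^ (r - 1) * Y) = euler_deriv (X ^ r) - of_nat r * X ^ r"
  proof (cases r)
    case 0
    have "euler_deriv (1 :: 'a env fps) = 0" by (rule fps_ext) simp
    then show ?thesis by (simp add: 0)
  next
    case (Suc m)
    show ?thesis unfolding Suc euler_deriv_power[OF XX'] Y_def
      by (simp only: diff_Suc_1 right_diff_distrib power_Suc2)
  qed
  have "E * (X ^ Suc r * L) = (X ^ Suc r * E + of_nat (Suc r) * (X ^ r * H - of_nat r * (X ^ (r - 1) * Y))) * L"
    by (simp only: commutator_power[OF EX HX XY, symmetric] mult.assoc)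
  also have "\<dots> = X ^ Suc r * (E * L) + of_nat (Suc r) * (X ^ r * (H * L) - (euler_deriv (X ^ r) - of_nat r * X ^ r) * L)"
    by (simp only: eXr distrib_right left_diff_distrib mult.assoc)
  also have "X ^ r * (H * L) - (euler_deriv (X ^ r) - of_nat r * X ^ r) * L
      = - (euler_deriv (X ^ r * L) - of_nat r * (X ^ r * L))"
    by (simp add: HL euler_deriv_mult left_diff_distrib mult.assoc)
  finally show ?thesis by (simp only: mult_minus_right diff_conv_add_uminus)
qed

text \<open>The commutator with \<open>h l\<close> is a derivation that shifts one index by
  \<open>l\<close>; the sum runs over the factor that is hit.\<close>

lemma h_f_prod:
  "h l * prod_list (map f ks) = prod_list (map f ks) * h l
    - 2 * (\<Sum>i<length ks. prod_list (map f (ks[i := ks ! i + l])))"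
proof (induction ks)
  case (Cons k ks)
  define P S where "P = prod_list (map f ks)"
    and "S = (\<Sum>i<length ks. prod_list (map f (ks[i := ks ! i + l])))"
  have "h l * (f k * P) = (f k * h l - 2 * f (k + l)) * P"
    by (simp only: mult.assoc[symmetric] hf add.commute)
  also have "\<dots> = f k * (P * h l - 2 * S) - 2 * (f (k + l) * P)"
    unfolding P_def S_def Cons[symmetric] by (simp only: left_diff_distrib mult.assoc)
  also have "\<dots> = f k * P * h l - 2 * (f (k + l) * P + f k * S)"
  proof -
    have "f k * (2 * S) = 2 * (f k * S)" by (simp only: mult_2 distrib_left)
    then show ?thesis by (simp add: right_diff_distrib distrib_left mult.assoc)
  qed
  also have "f (k + l) * P + f k * S
      = (\<Sum>i<length (k # ks). prod_list (map f ((k # ks)[i := (k # ks) ! i + l])))"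
    by (simp add: P_def S_def sum.lessThan_Suc_shift sum_distrib_left del: sum.lessThan_Suc)
  finally show ?case by (simp add: P_def)
qed simp

text \<open>The case \<open>H = - (2 * f l)\<close>, \<open>Y = 0\<close> of
  \<open>commutator_power\<close>, as \<open>f l\<close> commutes with \<open>f 0\<close>.\<close>

lemma h_f_power: "h l * f 0 ^ Suc j = f 0 ^ Suc j * h l - 2 * of_nat (Suc j) * (f l * f 0 ^ j)"
proof -
  have "h l * f 0 ^ Suc j = f 0 ^ Suc j * h l + of_nat (Suc j) * (f 0 ^ j * - (2 * f l) - of_nat j * (f 0 ^ (j - 1) * 0))"
  proof (rule commutator_power)
    show "h l * f 0 = f 0 * h l + - (2 * f l)" by (simp add: hf)
    show "- (2 * f l) * f 0 = f 0 * - (2 * f l) - 2 * 0"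
      by (simp only: mult_2 minus_mult_left[symmetric] minus_mult_right[symmetric] distrib_left distrib_right ff[of l 0] mult_zero_right diff_0_right)
  qed simp
  also have "f 0 ^ j * - (2 * f l) - of_nat j * (f 0 ^ (j - 1) * 0) = - (2 * (f l * f 0 ^ j))"
    by (simp only: power_commuting_commutes[OF ff[of 0 l]] mult_2 minus_mult_right[symmetric] distrib_left mult_zero_right diff_0_right)
  finally show ?thesis
    by (simp add: mult.assoc[symmetric] mult_of_nat_commute[of _ 2] del: of_nat_Suc power_Suc)
qed

end

text \<open>A whole space \<open>V\<close> of highest weight vectors replaces a single one, because
  the arguments pass from \<open>v\<close> to \<open>h l v\<close> and to the coefficients of
  \<open>exp_ser\<close> applied to \<open>v\<close>.\<close>

locale sl2_loop_module = sl2_loop e f h + env_module act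
  for e f h :: "int \<Rightarrow> 'a::complex_lie_algebra env" and act :: "'a env \<Rightarrow> 'v::ab_group_add \<Rightarrow> 'v" +
  fixes V :: "'v set" and N :: nat
  assumes V_subspace: "vs.subspace V" and h_V: "v \<in> V \<Longrightarrow> act (h m) v \<in> V"
    and e_V: "v \<in> V \<Longrightarrow> act (e m) v = 0" and h0_V: "v \<in> V \<Longrightarrow> act (h 0) v = scal act (of_nat N) v"
    and f0_V: "v \<in> V \<Longrightarrow> act (f 0 ^ Suc N) v = 0"
begin

section \<open>Relations on highest weight vectors of the loop algebra of sl_2\<close>

lemma exp_ser_V: "v \<in> V \<Longrightarrow> \<epsilon> \<noteq> 0 \<Longrightarrow> act (exp_ser \<epsilon> h $ n) v \<in> V"
proof -
  have "\<forall>v\<in>V. act (exp_ser \<epsilon> h $ n) v \<in> V" if "\<epsilon> \<noteq> 0"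
  proof (rule exp_ser_induct[OF hh])
    show "\<forall>v\<in>V. act (h a * u) v \<in> V" if "\<forall>v\<in>V. act u v \<in> V" for a u
      using that by (auto simp: act_act[symmetric] h_V)
  qed (use that in \<open>auto simp: act_one act_add_left act_scaleC vs.subspace_add[OF V_subspace]
      vs.subspace_scale[OF V_subspace] vs.subspace_0[OF V_subspace]\<close>)
  then show "v \<in> V \<Longrightarrow> \<epsilon> \<noteq> 0 \<Longrightarrow> act (exp_ser \<epsilon> h $ n) v \<in> V" by auto
qed

lemma exp_ser_commute:
  assumes "\<epsilon> \<noteq> 0" "\<epsilon>' \<noteq> 0"
  shows "exp_ser \<epsilon> h $ m * exp_ser \<epsilon>' h $ n = exp_ser \<epsilon>' h $ n * exp_ser \<epsilon> h $ m"
proof -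
  have c: "u * exp_ser \<epsilon> h $ n = exp_ser \<epsilon> h $ n * u"
    if u: "\<And>a. u * h a = h a * u" and "\<epsilon> \<noteq> 0" for u n \<epsilon>
  proof (rule exp_ser_induct[OF hh])
    fix a w assume "u * w = w * u"
    then show "u * (h a * w) = h a * w * u" by (metis mult.assoc u)
  qed (use that in \<open>simp_all add: distrib_left distrib_right env_scaleC_mult\<close>)
  show ?thesis by (rule c, rule c[symmetric]) (simp_all add: hh assms)
qed

text \<open>Applying \<open>h l\<close> to a vanishing product of \<open>f\<close>'s trades one factor \<open>f 0\<close> for \<open>f l\<close>.\<close>

lemma f_prod_kills:
  assumes "v \<in> V" and "length ks = Suc N"
  shows "act (prod_list (map f ks)) v = 0"
proof -
  \<comment> \<open>Here \<open>n\<close> counts the arbitrary factors, all others being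
    \<open>f 0\<close>: \<open>n = 0\<close> is the assumption \<open>f0_V\<close>, and
    \<open>n = Suc N\<close> is the claim.\<close>
  have "\<forall>ks v. v \<in> V \<longrightarrow> length ks = n \<longrightarrow> act (prod_list (map f ks) * f 0 ^ (Suc N - n)) v = 0"
    if "n \<le> Suc N" for n
    using that
  proof (induction n)
    case 0
    then show ?case using f0_V by simp
  next
    case (Suc n)
    define j where "j = N - n"
    have j: "Suc N - n = Suc j" "Suc N - Suc n = j" using Suc.prems by (simp_all add: j_def)
    have IH: "act (prod_list (map f ks) * f 0 ^ Suc j) v = 0" if "v \<in> V" "length ks = n" for ks v
      using Suc that j by auto
    show ?case
    proof (intro allI impI)
      fix ks' :: "int list" and v assume v: "v \<in> V" and len: "length ks' = Suc n"
      then obtain ks l where ks': "ks' = ks @ [l]" and ks: "length ks = n"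
        by (metis length_Suc_conv_rev)
      define P F where "P = prod_list (map f ks)" and "F = f 0 ^ Suc j"
      define S where "S = (\<Sum>i<length ks. prod_list (map f (ks[i := ks ! i + l])))"
      \<comment> \<open>Every term except \<open>P * (f l * f 0 ^ j)\<close> still has
        \<open>n\<close> arbitrary factors and \<open>Suc j\<close> factors \<open>f 0\<close>. The
        induction hypothesis kills these on \<open>v\<close> and on \<open>h l v\<close>, which
        leaves a nonzero multiple of the product sought.\<close>
      have "h l * P * F = P * (h l * F) - 2 * (S * F)"
        unfolding P_def S_def h_f_prod by (simp only: left_diff_distrib mult.assoc)
      also have "P * (h l * F) = P * F * h l - 2 * of_nat (Suc j) * (P * (f l * f 0 ^ j))"
      proof -
        have "P * (of_nat m * u) = of_nat m * (P * u)" for m u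
          by (metis mult.assoc mult_of_nat_commute)
        from this[of "2 * Suc j"] show ?thesis
          unfolding F_def h_f_power by (simp only: right_diff_distrib mult.assoc of_nat_mult of_nat_numeral)
      qed
      finally have eq: "h l * (P * F) = P * F * h l - of_nat (2 * Suc j) * (P * (f l * f 0 ^ j)) - of_nat 2 * (S * F)"
        by (simp only: mult.assoc of_nat_mult of_nat_numeral)
      have "act (S * F) v = 0"
        unfolding S_def F_def sum_distrib_right act_sum_left
        by (intro sum.neutral ballI IH) (simp_all add: v ks)
      moreover have "act (P * F) v = 0" "act (P * F) (act (h l) v) = 0"
        unfolding P_def F_def using v ks h_V by (auto intro!: IH simp del: power_Suc)
      ultimately have "scal act (of_nat (2 * Suc j)) (act (P * (f l * f 0 ^ j)) v) = 0"
        using arg_cong[OF eq, of "\<lambda>u. act u v"]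
        by (simp only: act_diff_left act_of_nat_mult act_act[symmetric, of "h l"] act_act[symmetric, of _ "h l"])
          simp
      then have "act (P * (f l * f 0 ^ j)) v = 0"
        by (simp only: vs.scale_eq_0_iff of_nat_eq_0_iff) simp
      then show "act (prod_list (map f ks') * f 0 ^ (Suc N - Suc n)) v = 0"
        by (simp add: ks' P_def mult.assoc j_def)
    qed
  qed
  from this[of "Suc N"] assms show ?thesis by simp
qed

lemma f_power_kills:
  assumes "v \<in> V" and "N < n"
  shows "act (f b ^ n) v = 0"
proof -
  have "f b ^ n = f b ^ (n - Suc N) * prod_list (map f (replicate (Suc N) b))"
    unfolding map_replicate prod_list_replicate power_add[symmetric] using assms by simp
  then show ?thesis
    using f_prod_kills[OF assms(1), of "replicate (Suc N) b"] by (simp only: act_act[symmetric] length_replicate act_zero_right)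
qed

lemma f_lowest_weight: "v \<in> V \<Longrightarrow> act (f k) (act (f 0 ^ N) v) = 0"
  using f_prod_kills[of v "k # replicate N 0"] by (simp add: prod_list_replicate act_act)

text \<open>Since \<open>f b ^ n\<close> acts as the coefficient of degree n in
  \<open>X ^ n * L\<close>, this is \<open>garland_commutator\<close> applied \<open>s\<close>
  times. The step from \<open>Suc r\<close> to \<open>r\<close> contributes the scalar
  \<open>- (r + 1) (n - r)\<close>.\<close>

lemma garland:
  fixes \<epsilon> b
  defines "X \<equiv> shift_ser \<epsilon> b f" and "L \<equiv> exp_ser \<epsilon> h"
  assumes "v \<in> V" and "\<epsilon> \<noteq> 0" and "s \<le> n"
  shows "act (e (\<epsilon> - b) ^ s * f b ^ n) v
    = scal act ((- 1) ^ s * (fact s * fact n / fact (n - s))) (act ((X ^ (n - s) * L) $ n) v)"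
  using \<open>s \<le> n\<close>
proof (induction s)
  case 0
  \<comment> \<open>\<open>X\<close> starts with \<open>f b\<close> in degree 1 and \<open>L\<close>
    with 1, so only the lowest term of \<open>X ^ n\<close> reaches degree n.\<close>
  have "(X ^ n * L) $ n = (\<Sum>i\<in>{0..n}. if i = n then f b ^ n else 0)"
    unfolding fps_mult_nth
  proof (rule sum.cong[OF refl])
    fix i assume "i \<in> {0..n}"
    then show "X ^ n $ i * L $ (n - i) = (if i = n then f b ^ n else 0)"
      using startsby_zero_power_prefix[of X n] startsby_zero_power_nth_same[of X n]
      by (auto simp: X_def L_def) (simp add: shift_ser_def)
  qed
  then show ?case by (simp add: act_one)
next
  case (Suc s)
  define r where "r = n - Suc s"
  have ns: "n - s = Suc r" "n - r = Suc s" "r \<le> n" using Suc.prems by (simp_all add: r_def)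
  define Z where "Z = act ((X ^ r * L) $ n) v"
  \<comment> \<open>The coefficients of \<open>L\<close> map \<open>v\<close> into \<open>V\<close>,
    where \<open>e (\<epsilon> - b)\<close> is zero.\<close>
  have EL: "act ((X ^ Suc r * (fps_const (e (\<epsilon> - b)) * L)) $ n) v = 0"
    unfolding fps_mult_nth[of "X ^ Suc r"] act_sum_left
    by (intro sum.neutral ballI)
      (simp add: act_act[symmetric] L_def e_V exp_ser_V assms del: power_Suc)
  have nth: "(of_nat k * B) $ n = of_nat k * B $ n" for k and B :: "'a env fps"
    unfolding fps_of_nat[symmetric] fps_mult_left_const_nth ..
  have "e (\<epsilon> - b) * (X ^ Suc r * L) $ n
      = (X ^ Suc r * (fps_const (e (\<epsilon> - b)) * L)) $ n
        - of_nat (Suc r) * (of_nat n * (X ^ r * L) $ n - of_nat r * (X ^ r * L) $ n)"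
    using arg_cong[OF garland_commutator[of \<epsilon> b r], of "\<lambda>B. B $ n"]
    by (simp only: X_def L_def fps_mult_left_const_nth fps_sub_nth nth euler_deriv_nth)
  then have "act (e (\<epsilon> - b)) (act ((X ^ Suc r * L) $ n) v)
      = - scal act (of_nat (Suc r) * of_nat (Suc s)) Z"
    unfolding act_act using ns(3)
    by (simp only: act_diff_left EL act_of_nat_mult Z_def[symmetric] vs.scale_left_diff_distrib[symmetric]
        of_nat_diff[symmetric] ns(2) vs.scale_scale diff_0)
  then have "act (e (\<epsilon> - b) ^ Suc s * f b ^ n) v
      = scal act (((- 1) ^ s * (fact s * fact n / fact (Suc r))) * - (of_nat (Suc r) * of_nat (Suc s))) Z"
    using Suc by (simp only: power_Suc mult.assoc act_act[symmetric] Suc_leD ns act_scal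
        vs.scale_scale vs.scale_minus_left vs.scale_minus_right mult_minus_right)
  also have "((- 1) ^ s * (fact s * fact n / fact (Suc r))) * - (of_nat (Suc r) * of_nat (Suc s))
      = ((- 1) ^ Suc s * (fact (Suc s) * fact n / fact r) :: complex)"
    unfolding fact_Suc by (simp del: of_nat_Suc)
  finally show ?case by (simp only: Z_def r_def)
qed

text \<open>Garland's identity with \<open>s = n - r\<close>: as \<open>n > N\<close>, its left side
  already vanishes because \<open>f b ^ n\<close> kills \<open>v\<close>. For \<open>r > n\<close>
  the coefficient is zero by degree.\<close>

lemma shift_power_exp_ser_kills:
  assumes "v \<in> V" and "\<epsilon> \<noteq> 0" and "N < n"
  shows "act ((shift_ser \<epsilon> b f ^ r * exp_ser \<epsilon> h) $ n) v = 0"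
proof (cases "r \<le> n")
  case True
  define c :: complex where "c = (- 1) ^ (n - r) * (fact (n - r) * fact n / fact r)"
  have "scal act c (act ((shift_ser \<epsilon> b f ^ r * exp_ser \<epsilon> h) $ n) v) = act (e (\<epsilon> - b) ^ (n - r) * f b ^ n) v"
    using garland[OF assms(1,2), of "n - r" n b] True by (simp add: c_def)
  also have "\<dots> = 0" using f_power_kills[OF assms(1,3)] by (simp add: act_act[symmetric])
  finally show ?thesis by (simp add: c_def)
next
  case False
  then have "shift_ser \<epsilon> b f ^ r $ i = 0" if "i \<le> n" for i
    using startsby_zero_power_prefix[of "shift_ser \<epsilon> b f" r] that by simp
  then show ?thesis by (simp add: fps_mult_nth)
qed

lemma exp_ser_kills: "v \<in> V \<Longrightarrow> \<epsilon> \<noteq> 0 \<Longrightarrow> N < n \<Longrightarrow> act (exp_ser \<epsilon> h $ n) v = 0"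
  using shift_power_exp_ser_kills[of v \<epsilon> n 0 0] by simp

lemma f_exp_ser_kills:
  assumes "v \<in> V"
  shows "act (\<Sum>k\<le>N. f (m - 1 - int k) * exp_ser 1 h $ k) v = 0"
proof -
  \<comment> \<open>With this start the coefficient of degree \<open>Suc N\<close> in
    \<open>X * \<Lambda>\<close> pairs \<open>f (b + (N - k)) = f (m - 1 - k)\<close> with the
    coefficient \<open>k\<close> of \<open>\<Lambda>\<close>.\<close>
  define b where "b = m - 1 - int N"
  have "(shift_ser 1 b f * exp_ser 1 h) $ Suc N = (\<Sum>i\<le>Suc N. shift_ser 1 b f $ i * exp_ser 1 h $ (Suc N - i))"
    by (simp only: fps_mult_nth atLeast0AtMost)
  also have "\<dots> = (\<Sum>i\<le>N. f (b + int i) * exp_ser 1 h $ (N - i))"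
    by (subst sum.atMost_Suc_shift) (simp add: shift_ser_def)
  also have "\<dots> = (\<Sum>k\<le>N. f (m - 1 - int k) * exp_ser 1 h $ k)"
    by (rule sum.reindex_bij_witness[of _ "\<lambda>i. N - i" "\<lambda>i. N - i"]) (auto simp: b_def of_nat_diff algebra_simps)
  finally show ?thesis
    using shift_power_exp_ser_kills[OF assms, of 1 "Suc N" b 1] by simp
qed

text \<open>For every \<open>b\<close>, the elements \<open>e (- b)\<close>, \<open>h 0\<close>,
  \<open>f b\<close> form an sl_2-triple for which \<open>v\<close> is a highest weight vector of
  weight \<open>N\<close>.\<close>

lemma e_power_f_power:
  assumes "v \<in> V" and "m \<le> N"
  shows "act (e (- b) ^ m) (act (f b ^ N) v) = scal act (fact N * fact m / fact (N - m)) (act (f b ^ (N - m)) v)"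
proof -
  have "act (e (- b) ^ m * f b ^ N) v = scal act (fact N * fact m / fact (N - m)) (act (f b ^ (N - m)) v)"
  proof (rule sl2_string_power)
    show "h 0 * f b = f b * h 0 - 2 * f b" by (simp add: hf)
  qed (use assms in \<open>simp_all add: ef e_V h0_V\<close>)
  then show ?thesis by (simp add: act_act)
qed

text \<open>Both sides arise by applying \<open>e 0 ^ m * e 1 ^ (N - m)\<close>, in either order, to the lowest weight
  vector \<open>f 0 ^ N v\<close>, which also equals \<open>f (- 1) ^ N\<close> applied to a multiple of \<open>exp_ser 1 h $ N v\<close>.\<close>

lemma exp_ser_reflect:
  assumes v: "v \<in> V" and "m \<le> N"
  shows "act (exp_ser 1 h $ N * exp_ser (- 1) h $ m) v = act (exp_ser 1 h $ (N - m)) v"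
proof -
  define w where "w = act (f 0 ^ N) v"
  define v' where "v' = act (exp_ser 1 h $ N) v"
  have v': "v' \<in> V" using v by (simp add: v'_def exp_ser_V)
  \<comment> \<open>Garland's identity with \<open>s = n\<close>, where no factor \<open>X\<close>
    is left.\<close>
  have gar: "act (e (\<epsilon> - b) ^ n) (act (f b ^ n) u) = scal act ((- 1) ^ n * (fact n * fact n)) (act (exp_ser \<epsilon> h $ n) u)"
    if "u \<in> V" "\<epsilon> \<noteq> 0" for \<epsilon> b n u
    using garland[OF that, of n n b] by (simp add: act_act)
  have e1w: "act (e 1 ^ N) w = scal act ((- 1) ^ N * (fact N * fact N)) v'"
    using gar[OF v, of 1 0 N] by (simp add: w_def v'_def)
  \<comment> \<open>In the opposite triple \<open>f (- 1)\<close>, \<open>- h 0\<close>,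
    \<open>e 1\<close> the raising operator is \<open>f (- 1)\<close>, and \<open>w\<close> is a
    highest weight vector of weight \<open>N\<close>; going down and up again returns a multiple of
    \<open>w\<close>.\<close>
  have "act (f (- 1) ^ N * e 1 ^ N) w = scal act (fact N * fact N) w"
  proof -
    have "act (f (- 1) ^ N * e 1 ^ N) w = scal act (fact N * fact N / fact (N - N)) (act (e 1 ^ (N - N)) w)"
    proof (rule sl2_string_power)
      show "f (- 1) * e 1 = e 1 * f (- 1) + - h 0" by (simp add: ef)
      show "- h 0 * e 1 = e 1 * - h 0 - 2 * e 1" by (simp add: he)
      show "act (f (- 1)) w = 0" unfolding w_def by (rule f_lowest_weight[OF v])
      have "act (h 0 * f 0 ^ N) v = scal act (of_nat N - 2 * of_nat N) (act (f 0 ^ N) v)"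
        by (rule sl2_weight) (simp_all add: hf h0_V v)
      then show "act (- h 0) w = scal act (of_nat N) w"
        by (simp add: w_def act_act act_minus_left vs.scale_minus_left[symmetric] del: vs.scale_minus_left)
    qed simp
    then show ?thesis by (simp add: act_one)
  qed
  then have "scal act (fact N * fact N) w = act (f (- 1) ^ N) (act (e 1 ^ N) w)" by (simp add: act_act)
  also have "\<dots> = scal act (fact N * fact N) (scal act ((- 1) ^ N) (act (f (- 1) ^ N) v'))"
    by (simp add: e1w act_scal mult.commute)
  finally have w: "w = scal act ((- 1) ^ N) (act (f (- 1) ^ N) v')"
    by (simp only: vs.scale_cancel_left) simp
  \<comment> \<open>With \<open>w\<close> built from \<open>v'\<close> by \<open>f (- 1)\<close>:
    first the triple with \<open>b = -1\<close>, then Garland with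
    \<open>\<epsilon> = b = -1\<close>, for which \<open>\<epsilon> - b = 0\<close>.\<close>
  have "act (e 0 ^ m) (act (e 1 ^ (N - m)) w)
      = scal act ((- 1) ^ N * (fact N * fact (N - m) / fact m) * ((- 1) ^ m * (fact m * fact m)))
          (act (exp_ser (- 1) h $ m) v')"
    using e_power_f_power[OF v', of "N - m" "- 1"] gar[OF v', of "- 1" "- 1" m] \<open>m \<le> N\<close>
    unfolding w by (simp add: act_scal)
  \<comment> \<open>With \<open>w\<close> built from \<open>v\<close> by \<open>f 0\<close>: first
    the triple with \<open>b = 0\<close>, then Garland with \<open>\<epsilon> = 1\<close>,
    \<open>b = 0\<close>.\<close>
  moreover have "act (e 1 ^ (N - m)) (act (e 0 ^ m) w)
      = scal act (fact N * fact m / fact (N - m) * ((- 1) ^ (N - m) * (fact (N - m) * fact (N - m))))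
          (act (exp_ser 1 h $ (N - m)) v)"
    using e_power_f_power[OF v, of m 0] gar[OF v, of 1 0 "N - m"] \<open>m \<le> N\<close>
    unfolding w_def by (simp add: act_scal)
  moreover have "act (e 0 ^ m) (act (e 1 ^ (N - m)) w) = act (e 1 ^ (N - m)) (act (e 0 ^ m) w)"
    unfolding act_act by (simp only: power_commuting_commutes[OF power_commuting_commutes[OF ee[of 0 1], symmetric], symmetric])
  \<comment> \<open>Both constants equal N! m! (N - m)! up to the common sign (-1)^(N - m), hence
    can be cancelled.\<close>
  moreover have "(- 1) ^ N * (fact N * fact (N - m) / fact m) * ((- 1) ^ m * (fact m * fact m))
      = (fact N * fact m / fact (N - m) * ((- 1) ^ (N - m) * (fact (N - m) * fact (N - m))) :: complex)"
  proof -
    have "(- 1 :: complex) ^ N = (- 1) ^ m * (- 1) ^ (N - m)"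
      using \<open>m \<le> N\<close> by (simp flip: power_add)
    moreover have "(- 1 :: complex) ^ m * (- 1) ^ m = 1" by (simp flip: power_mult_distrib)
    ultimately show ?thesis by simp
  qed
  ultimately have "scal act (fact N * fact m / fact (N - m) * ((- 1) ^ (N - m) * (fact (N - m) * fact (N - m))))
        (act (exp_ser (- 1) h $ m) v')
      = scal act (fact N * fact m / fact (N - m) * ((- 1) ^ (N - m) * (fact (N - m) * fact (N - m))))
        (act (exp_ser 1 h $ (N - m)) v)"
    by (simp only:)
  then have "act (exp_ser (- 1) h $ m) v' = act (exp_ser 1 h $ (N - m)) v"
    by (simp only: vs.scale_cancel_left) simp
  then show ?thesis
    by (simp add: v'_def act_act exp_ser_commute[of 1 "- 1" N m])
qed

end

section \<open>The defining relations of \<open>W(\<lambda>)\<close> on highest weight vectors\<close>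

lemma two_env: "(2 :: 'a::complex_lie_algebra env) = env_const 2"
  using of_nat_env[of 2] by simp

lemma lie_datumD:
  assumes "lie_datum D"
  shows "complex_vector.subspace (cartan D)"
    and "h \<in> cartan D \<Longrightarrow> h' \<in> cartan D \<Longrightarrow> lie_bracket h h' = 0"
    and "\<beta> \<in> pos_roots D \<Longrightarrow> h \<in> cartan D \<Longrightarrow> lie_bracket h (xp D \<beta>) = \<beta> h *\<^sub>C xp D \<beta>"
    and "\<beta> \<in> pos_roots D \<Longrightarrow> hc D \<beta> \<in> cartan D"
    and "\<beta> \<in> pos_roots D \<Longrightarrow> lie_bracket (xp D \<beta>) (xm D \<beta>) = hc D \<beta>"
    and "\<beta> \<in> pos_roots D \<Longrightarrow> lie_bracket (hc D \<beta>) (xp D \<beta>) = 2 *\<^sub>C xp D \<beta>"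
    and "\<beta> \<in> pos_roots D \<Longrightarrow> lie_bracket (hc D \<beta>) (xm D \<beta>) = (- 2) *\<^sub>C xm D \<beta>"
proof -
  have c: "cartan_subalgebra (cartan D)"
    using assms unfolding lie_datum_def by (elim conjE)
  show "complex_vector.subspace (cartan D)"
    and "h \<in> cartan D \<Longrightarrow> h' \<in> cartan D \<Longrightarrow> lie_bracket h h' = 0"
    using c by (simp_all add: cartan_subalgebra_def)
  have r: "\<forall>\<beta>\<in>pos_roots D.
          xp D \<beta> \<in> root_space (cartan D) \<beta> - {0}
        \<and> xm D \<beta> \<in> root_space (cartan D) (\<lambda>x. - \<beta> x) - {0}
        \<and> hc D \<beta> \<in> cartan D
        \<and> lie_bracket (xp D \<beta>) (xm D \<beta>) = hc D \<beta>
        \<and> lie_bracket (hc D \<beta>) (xp D \<beta>) = 2 *\<^sub>C xp D \<beta>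
        \<and> lie_bracket (hc D \<beta>) (xm D \<beta>) = (- 2) *\<^sub>C xm D \<beta>"
    using assms unfolding lie_datum_def by (elim conjE)
  assume "\<beta> \<in> pos_roots D"
  note r[rule_format, OF this]
  then show "h \<in> cartan D \<Longrightarrow> lie_bracket h (xp D \<beta>) = \<beta> h *\<^sub>C xp D \<beta>"
    and "hc D \<beta> \<in> cartan D"
    and "lie_bracket (xp D \<beta>) (xm D \<beta>) = hc D \<beta>"
    and "lie_bracket (hc D \<beta>) (xp D \<beta>) = 2 *\<^sub>C xp D \<beta>"
    and "lie_bracket (hc D \<beta>) (xm D \<beta>) = (- 2) *\<^sub>C xm D \<beta>"
    unfolding root_space_def by auto
qed

lemma sroot_pos_roots:
  assumes "lie_datum D" "i \<in> idx D"
  shows "sroot D i \<in> pos_roots D"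
proof -
  have "sroot D i = (\<lambda>x. \<Sum>l\<in>idx D. of_nat (if l = i then 1 else 0) * sroot D l x)"
  proof
    fix x
    have "(\<Sum>l\<in>idx D. of_nat (if l = i then 1 else 0) * sroot D l x) = (\<Sum>l\<in>idx D. if l = i then sroot D l x else 0)"
      by (rule sum.cong) auto
    then show "sroot D i x = (\<Sum>l\<in>idx D. of_nat (if l = i then 1 else 0) * sroot D l x)"
      using assms(2) by simp
  qed
  moreover have "sroot D ` idx D \<subseteq> lie_roots (cartan D)"
    using assms(1) unfolding lie_datum_def by (elim conjE)
  then have "sroot D i \<in> lie_roots (cartan D)"
    using assms(2) by blast
  ultimately show ?thesis
    unfolding pos_roots_def by (intro CollectI conjI exI[of _ "\<lambda>l. if l = i then 1 else 0"])
qed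

text \<open>\<open>j\<close> stands for the canonical map of the loop algebra into either enveloping
  algebra, so that the relations are checked once for both.\<close>

locale loop_hom =
  fixes j :: "'g::complex_lie_algebra loop \<Rightarrow> 'a::complex_lie_algebra env"
  assumes j_scaleC: "j (c *\<^sub>C x) = c *\<^sub>C j x"
    and j_lie: "j (lie_bracket x y) = j x * j y - j y * j x"
begin

lemma j_zero: "j 0 = 0"
  using j_scaleC[of 0 0] by simp

lemma j_swap: "j (x \<otimes>t a) * j (y \<otimes>t b) = j (y \<otimes>t b) * j (x \<otimes>t a) + j (lie_bracket x y \<otimes>t (a + b))"
  using j_lie[of "x \<otimes>t a" "y \<otimes>t b"] by (simp add: lie_single_single)

lemma j_commute:
  "lie_bracket x y = 0 \<Longrightarrow> j (x \<otimes>t a) * j (y \<otimes>t b) = j (y \<otimes>t b) * j (x \<otimes>t a)"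
  using j_swap[where x = x and y = y and a = a and b = b] by (simp add: j_zero)

lemma sl2_loop:
  assumes "lie_datum D" and \<beta>: "\<beta> \<in> pos_roots D"
  shows "sl2_loop (\<lambda>m. j (xp D \<beta> \<otimes>t m)) (\<lambda>m. j (xm D \<beta> \<otimes>t m)) (\<lambda>m. j (hc D \<beta> \<otimes>t m))"
proof
  note D = lie_datumD[OF assms(1)]
  fix a b
  show "j (hc D \<beta> \<otimes>t a) * j (xm D \<beta> \<otimes>t b) = j (xm D \<beta> \<otimes>t b) * j (hc D \<beta> \<otimes>t a) - 2 * j (xm D \<beta> \<otimes>t (a + b))"
    unfolding j_swap[where x = "hc D \<beta>"] D(7)[OF \<beta>] single_scaleC j_scaleC
    by (simp only: two_env env_const_mult complex_vector.scale_minus_left diff_conv_add_uminus)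
  show "j (hc D \<beta> \<otimes>t a) * j (xp D \<beta> \<otimes>t b) = j (xp D \<beta> \<otimes>t b) * j (hc D \<beta> \<otimes>t a) + 2 * j (xp D \<beta> \<otimes>t (a + b))"
    unfolding j_swap[where x = "hc D \<beta>"] D(6)[OF \<beta>]
    by (simp only: single_scaleC j_scaleC two_env env_const_mult)
  show "j (xp D \<beta> \<otimes>t a) * j (xm D \<beta> \<otimes>t b) = j (xm D \<beta> \<otimes>t b) * j (xp D \<beta> \<otimes>t a) + j (hc D \<beta> \<otimes>t (a + b))"
    unfolding j_swap[where x = "xp D \<beta>"] D(5)[OF \<beta>] ..
qed (rule j_commute, simp add: lie_self)+

lemma subspace_U0: "complex_vector.subspace (U0 D j)"
  and one_U0: "1 \<in> U0 D j"
  and mult_U0: "x \<in> U0 D j \<Longrightarrow> y \<in> U0 D j \<Longrightarrow> x * y \<in> U0 D j"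
  and gen_U0: "\<beta> \<in> pos_roots D \<Longrightarrow> m \<noteq> 0 \<Longrightarrow> j (hc D \<beta> \<otimes>t m) \<in> U0 D j"
proof -
  define P where "P S \<longleftrightarrow> complex_vector.subspace S \<and> 1 \<in> S \<and> (\<forall>x\<in>S. \<forall>y\<in>S. x * y \<in> S)" for S :: "'a env set"
  have U0: "U0 D j = P hull {j (hc D \<beta> \<otimes>t m) | \<beta> m. \<beta> \<in> pos_roots D \<and> m \<noteq> 0}"
    unfolding U0_def P_def ..
  have "P (U0 D j)"
    unfolding U0
    by (rule hull_in) (simp add: P_def complex_vector.subspace_def)
  then show "complex_vector.subspace (U0 D j)" "1 \<in> U0 D j" "x \<in> U0 D j \<Longrightarrow> y \<in> U0 D j \<Longrightarrow> x * y \<in> U0 D j"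
    by (auto simp: P_def)
  show "\<beta> \<in> pos_roots D \<Longrightarrow> m \<noteq> 0 \<Longrightarrow> j (hc D \<beta> \<otimes>t m) \<in> U0 D j"
    unfolding U0 by (rule hull_inc) blast
qed

lemma U0_induct:
  assumes "u \<in> U0 D j" and "complex_vector.subspace T" and "1 \<in> T"
    and "\<And>x y. x \<in> T \<Longrightarrow> y \<in> T \<Longrightarrow> x * y \<in> T"
    and "\<And>\<beta> m. \<beta> \<in> pos_roots D \<Longrightarrow> j (hc D \<beta> \<otimes>t m) \<in> T"
  shows "u \<in> T"
proof -
  have "U0 D j \<subseteq> T"
    unfolding U0_def
  proof (rule hull_minimal)
    show "{j (hc D \<beta> \<otimes>t m) | \<beta> m. \<beta> \<in> pos_roots D \<and> m \<noteq> 0} \<subseteq> T"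
      using assms(5) by blast
    show "complex_vector.subspace T \<and> 1 \<in> T \<and> (\<forall>x\<in>T. \<forall>y\<in>T. x * y \<in> T)"
      using assms(2-4) by blast
  qed
  then show ?thesis using assms(1) by auto
qed

lemma Lambda_ser_U0:
  assumes "lie_datum D" "i \<in> idx D" "\<epsilon> \<noteq> 0"
  shows "Lambda_ser D j \<epsilon> i $ n \<in> U0 D j"
proof -
  interpret sl2_loop "\<lambda>m. j (xpi D i \<otimes>t m)" "\<lambda>m. j (xmi D i \<otimes>t m)" "\<lambda>m. j (hci D i \<otimes>t m)"
    by (rule sl2_loop[OF assms(1) sroot_pos_roots[OF assms(1,2)]])
  note p = sroot_pos_roots[OF assms(1,2)]
  have "exp_ser \<epsilon> (\<lambda>m. j (hci D i \<otimes>t m)) $ n \<in> U0 D j"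
  proof (rule exp_ser_induct[where P = "\<lambda>u. u \<in> U0 D j", OF hh])
    show "j (hci D i \<otimes>t a) * u \<in> U0 D j" if "a \<noteq> 0" "u \<in> U0 D j" for a u
      by (rule mult_U0[OF gen_U0[OF p that(1)] that(2)])
  qed (use assms(3) in \<open>simp_all add: one_U0 subspace_U0 complex_vector.subspace_0
      complex_vector.subspace_add complex_vector.subspace_scale\<close>)
  then show ?thesis by (simp add: Lambda_ser_def exp_ser_def)
qed

end

text \<open>No condition on \<open>d\<close> is imposed, even over the extended algebra:
  \<open>hc D \<beta> \<otimes>t m\<close> shifts the eigenvalue of \<open>d\<close> by
  \<open>m\<close>, and the space has to be stable under these elements.\<close>

definition loop_hw_space ::
  "'g::complex_lie_algebra lie_data \<Rightarrow> ('g loop \<Rightarrow> 'a::complex_lie_algebra env)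
    \<Rightarrow> ('a env \<Rightarrow> 'v::ab_group_add \<Rightarrow> 'v) \<Rightarrow> ('g \<Rightarrow> complex) \<Rightarrow> 'v set"
  where "loop_hw_space D j act \<mu> = {v. (\<forall>h\<in>cartan D. act (j (h \<otimes>t 0)) v = scal act (\<mu> h) v)
    \<and> (\<forall>\<beta>\<in>pos_roots D. \<forall>m. act (j (xp D \<beta> \<otimes>t m)) v = 0)}"

locale loop_module = loop_hom j + env_module act
  for j :: "'g::complex_lie_algebra loop \<Rightarrow> 'a::complex_lie_algebra env"
    and act :: "'a env \<Rightarrow> 'v::ab_group_add \<Rightarrow> 'v" +
  fixes D :: "'g lie_data" and \<mu> :: "'g \<Rightarrow> complex"
  assumes D: "lie_datum D"
begin

abbreviation V where "V \<equiv> loop_hw_space D j act \<mu>"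

lemma V_subspace: "vs.subspace V"
  by (rule vs.subspaceI)
    (simp_all add: loop_hw_space_def act_add_right vs.scale_right_distrib act_scal mult.commute)

text \<open>Bracketing with \<open>hc D \<beta> \<otimes>t m\<close> fixes \<open>\<hh>\<close> and
  sends each \<open>xp D \<gamma> \<otimes>t k\<close> to a multiple of
  \<open>xp D \<gamma> \<otimes>t (m + k)\<close>, which kills \<open>v\<close> as well.\<close>

lemma h_V:
  assumes v: "v \<in> V" and \<beta>: "\<beta> \<in> pos_roots D"
  shows "act (j (hc D \<beta> \<otimes>t m)) v \<in> V"
  unfolding loop_hw_space_def
proof (intro CollectI conjI ballI allI)
  note L = lie_datumD[OF D]
  fix h assume h: "h \<in> cartan D"
  have "act (j (h \<otimes>t 0)) (act (j (hc D \<beta> \<otimes>t m)) v) = act (j (hc D \<beta> \<otimes>t m)) (act (j (h \<otimes>t 0)) v)"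
    unfolding act_act j_commute[OF L(2)[OF h L(4)[OF \<beta>]]] ..
  also have "act (j (h \<otimes>t 0)) v = scal act (\<mu> h) v" using v h by (simp add: loop_hw_space_def)
  finally show "act (j (h \<otimes>t 0)) (act (j (hc D \<beta> \<otimes>t m)) v) = scal act (\<mu> h) (act (j (hc D \<beta> \<otimes>t m)) v)"
    by (simp add: act_scal)
next
  note L = lie_datumD[OF D]
  fix \<gamma> k assume \<gamma>: "\<gamma> \<in> pos_roots D"
  have z: "act (j (xp D \<gamma> \<otimes>t l)) v = 0" for l using v \<gamma> by (simp add: loop_hw_space_def)
  have "j (hc D \<beta> \<otimes>t m) * j (xp D \<gamma> \<otimes>t k)
      = j (xp D \<gamma> \<otimes>t k) * j (hc D \<beta> \<otimes>t m) + \<gamma> (hc D \<beta>) *\<^sub>C j (xp D \<gamma> \<otimes>t (m + k))"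
    unfolding j_swap[where x = "hc D \<beta>"] L(3)[OF \<gamma> L(4)[OF \<beta>]] single_scaleC j_scaleC ..
  from arg_cong[OF this, of "\<lambda>u. act u v"] show "act (j (xp D \<gamma> \<otimes>t k)) (act (j (hc D \<beta> \<otimes>t m)) v) = 0"
    by (simp add: act_add_left act_scaleC act_act[symmetric] z)
qed

lemma U0_V: "u \<in> U0 D j \<Longrightarrow> v \<in> V \<Longrightarrow> act u v \<in> V"
proof -
  assume u: "u \<in> U0 D j" and v: "v \<in> V"
  have "u \<in> {u. \<forall>v\<in>V. act u v \<in> V}"
    by (rule U0_induct[OF u])
      (auto simp: complex_vector.subspace_def act_one h_V act_act[symmetric] act_add_left act_scaleC
        intro: vs.subspace_add[OF V_subspace] vs.subspace_scale[OF V_subspace] vs.subspace_0[OF V_subspace])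
  then show "act u v \<in> V" using v by auto
qed

text \<open>The nilpotency \<open>nil\<close> makes \<open>V\<close> an
  \<open>sl2_loop_module\<close> for every simple root, so each family of relators is covered by a
  result above. A right factor from \<open>U(0)\<close> is absorbed into the vector, which stays in
  \<open>V\<close>.\<close>

lemma weyl_relators_kill:
  assumes nil: "\<And>i. i \<in> idx D \<Longrightarrow> \<exists>N. \<mu> (hci D i) = of_nat N \<and> (\<forall>v\<in>V. act (j (xmi D i \<otimes>t 0) ^ Suc N) v = 0)"
    and x: "x \<in> weyl_relators D j \<mu>" and v: "v \<in> V"
  shows "act x v = 0"
proof -
  note L = lie_datumD[OF D]
  define N where "N = wt_nat D \<mu>"
  have N: "\<mu> (hci D i) = of_nat (N i)" "\<forall>v\<in>V. act (j (xmi D i \<otimes>t 0) ^ Suc (N i)) v = 0" if i: "i \<in> idx D" for i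
  proof -
    obtain M where M: "\<mu> (hci D i) = of_nat M" "\<forall>v\<in>V. act (j (xmi D i \<otimes>t 0) ^ Suc M) v = 0"
      using nil[OF i] by blast
    then have "N i = M" unfolding N_def wt_nat_def by (intro the_equality) auto
    then show "\<mu> (hci D i) = of_nat (N i)" "\<forall>v\<in>V. act (j (xmi D i \<otimes>t 0) ^ Suc (N i)) v = 0"
      using M by auto
  qed
  have mod: "sl2_loop_module (\<lambda>m. j (xpi D i \<otimes>t m)) (\<lambda>m. j (xmi D i \<otimes>t m)) (\<lambda>m. j (hci D i \<otimes>t m)) act V (N i)"
    if i: "i \<in> idx D" for i
  proof -
    have p: "sroot D i \<in> pos_roots D" by (rule sroot_pos_roots[OF D i])
    interpret s: sl2_loop "\<lambda>m. j (xpi D i \<otimes>t m)" "\<lambda>m. j (xmi D i \<otimes>t m)" "\<lambda>m. j (hci D i \<otimes>t m)"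
      by (rule sl2_loop[OF D p])
    show ?thesis
      by unfold_locales
        (use N[OF i] p L(4)[OF p] in \<open>simp_all add: V_subspace h_V del: power_Suc\<close>, simp_all add: loop_hw_space_def)
  qed
  have lam: "Lambda_ser D j \<epsilon> i = exp_ser \<epsilon> (\<lambda>m. j (hci D i \<otimes>t m))" for \<epsilon> i
    by (simp add: Lambda_ser_def exp_ser_def)
  have LN: "Lambda D j i (int k) = exp_ser 1 (\<lambda>m. j (hci D i \<otimes>t m)) $ k" for i k
    by (simp add: Lambda_def lam)
  have Xm: "Xminus0_ser D j i = shift_ser 1 0 (\<lambda>m. j (xmi D i \<otimes>t m))" for i
    by (rule fps_ext) (simp add: Xminus0_ser_def shift_ser_def)
  from x show ?thesis
    unfolding weyl_relators_def N_def[symmetric]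
  proof (elim UnE CollectE exE conjE)
    fix i m assume 1: "i \<in> idx D" "x = j (xpi D i \<otimes>t m)"
    with v show "act x v = 0" using sroot_pos_roots[OF D] by (simp add: loop_hw_space_def)
  next
    fix h assume 2: "h \<in> cartan D" "x = j (h \<otimes>t 0) - env_const (\<mu> h)"
    with v show "act x v = 0" by (simp add: loop_hw_space_def act_diff_left scal_def)
  next
    fix i m assume 3: "i \<in> idx D" "\<bar>m\<bar> > int (N i)" "x = Lambda D j i m"
    interpret s: sl2_loop_module "\<lambda>m. j (xpi D i \<otimes>t m)" "\<lambda>m. j (xmi D i \<otimes>t m)" "\<lambda>m. j (hci D i \<otimes>t m)" act V "N i"
      by (rule mod[OF 3(1)])
    show "act x v = 0"
      using s.exp_ser_kills[OF v, of 1 "nat m"] s.exp_ser_kills[OF v, of "-1" "nat (- m)"] 3(2)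
      by (auto simp: 3(3) Lambda_def lam)
  next
    fix i m assume 4: "i \<in> idx D" "1 \<le> m" "m \<le> int (N i)"
      "x = Lambda D j i (int (N i)) * Lambda D j i (- m) - Lambda D j i (int (N i) - m)"
    interpret s: sl2_loop_module "\<lambda>m. j (xpi D i \<otimes>t m)" "\<lambda>m. j (xmi D i \<otimes>t m)" "\<lambda>m. j (hci D i \<otimes>t m)" act V "N i"
      by (rule mod[OF 4(1)])
    obtain n where m: "m = int n" using 4(2) zero_le_imp_eq_int[of m] by auto
    have n: "1 \<le> n" "n \<le> N i" using 4(2,3) by (simp_all add: m)
    have Nm: "int (N i) - m = int (N i - n)" using n by (simp add: m of_nat_diff)
    have "Lambda D j i (- m) = exp_ser (- 1) (\<lambda>m. j (hci D i \<otimes>t m)) $ n"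
      using n(1) by (simp add: Lambda_def lam m)
    then show "act x v = 0"
      using s.exp_ser_reflect[OF v n(2)] by (simp only: 4(4) Nm LN act_diff_left diff_self)
  next
    fix i m f assume 5: "i \<in> idx D" "f \<in> U0 D j"
      "x = (\<Sum>k\<le>N i. j (xmi D i \<otimes>t (m - 1 - int k)) * Lambda D j i (int k)) * f"
    interpret s: sl2_loop_module "\<lambda>m. j (xpi D i \<otimes>t m)" "\<lambda>m. j (xmi D i \<otimes>t m)" "\<lambda>m. j (hci D i \<otimes>t m)" act V "N i"
      by (rule mod[OF 5(1)])
    show "act x v = 0"
      using s.f_exp_ser_kills[OF U0_V[OF 5(2) v], of m]
      by (simp add: 5(3) act_act[symmetric] Lambda_def lam)
  next
    fix i r m f assume 6: "i \<in> idx D" "m > N i" "f \<in> U0 D j"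
      "x = (Xminus0_ser D j i ^ r * Lambda_ser D j 1 i) $ m * f"
    interpret s: sl2_loop_module "\<lambda>m. j (xpi D i \<otimes>t m)" "\<lambda>m. j (xmi D i \<otimes>t m)" "\<lambda>m. j (hci D i \<otimes>t m)" act V "N i"
      by (rule mod[OF 6(1)])
    show "act x v = 0"
      using s.shift_power_exp_ser_kills[OF U0_V[OF 6(3) v], of 1 m 0 r] 6(2)
      by (simp add: 6(4) act_act[symmetric] lam Xm)
  qed
qed

end

section \<open>Quotients of cyclic modules and of tensor products\<close>

lemma left_ideal_hull: "left_ideal (left_ideal hull S)"
  by (rule hull_in) (auto simp: left_ideal_def)

lemma additive_subgroup_hull: "additive_subgroup (additive_subgroup hull S)"
  by (rule hull_in) (auto simp: additive_subgroup_def)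

context left_module
begin

lemma hull_left_ideal_kills:
  assumes "\<And>x. x \<in> S \<Longrightarrow> act x v = 0" and "x \<in> left_ideal hull S"
  shows "act x v = 0"
proof -
  have "left_ideal hull S \<subseteq> {x. act x v = 0}"
    by (rule hull_minimal) (use assms(1) in \<open>auto simp: left_ideal_def act_add_left act_act[symmetric]\<close>)
  then show ?thesis using assms(2) by auto
qed

lemma quotient_of_cyclic_moduleI:
  assumes kill: "\<And>x. x \<in> J \<Longrightarrow> act x v = 0" and J: "left_ideal J" and gen: "module_generated_by act v"
  shows "is_quotient_of act (cyclic_module J)"
proof -
  define \<phi> where "\<phi> A = act (SOME a. a \<in> A) v" for A
  \<comment> \<open>All elements of \<open>A\<close> give the same value, so the choice is
    immaterial. The form for arbitrary nonempty sets covers sums and multiples before they are known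
    to be cosets.\<close>
  have \<phi>: "\<phi> A = w" if "A \<noteq> {}" "\<And>a. a \<in> A \<Longrightarrow> act a v = w" for A w
    unfolding \<phi>_def by (rule that(2)) (use that(1) in \<open>simp add: some_in_eq\<close>)
  have 0: "0 \<in> J" using J by (simp add: left_ideal_def)
  have coset: "\<phi> (a +o J) = act a v" for a
    by (rule \<phi>) (use 0 in \<open>auto simp: elt_set_plus_def act_add_left kill\<close>)
  show ?thesis
    unfolding is_quotient_of_def
  proof (intro exI conjI ballI allI)
    fix x y assume "x \<in> mcarrier (cyclic_module J)" "y \<in> mcarrier (cyclic_module J)"
    then obtain a b where x: "x = a +o J" and y: "y = b +o J" by (auto simp: cyclic_module_def)
    have "\<phi> (x + y) = act a v + act b v"
      by (rule \<phi>) (use 0 in \<open>auto simp: x y elt_set_plus_def set_plus_def act_add_left kill\<close>)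
    then show "\<phi> (madd (cyclic_module J) x y) = \<phi> x + \<phi> y"
      by (simp add: cyclic_module_def x y coset)
  next
    fix r x assume "x \<in> mcarrier (cyclic_module J)"
    then obtain a where x: "x = a +o J" by (auto simp: cyclic_module_def)
    have "\<phi> (r *o x + J) = act r (act a v)"
      by (rule \<phi>) (use 0 in \<open>auto simp: x elt_set_plus_def set_plus_def elt_set_times_def act_add_left
          act_act[symmetric] act_add_right kill\<close>)
    then show "\<phi> (mact (cyclic_module J) r x) = act r (\<phi> x)"
      by (simp add: cyclic_module_def x coset)
  next
    show "\<phi> ` mcarrier (cyclic_module J) = UNIV"
    proof (intro equalityI subset_UNIV subsetI)
      fix w
      obtain u where "w = act u v" using gen by (auto simp: module_generated_by_def)
      then have "w = \<phi> (u +o J)" by (simp add: coset)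
      then show "w \<in> \<phi> ` mcarrier (cyclic_module J)" by (auto simp: cyclic_module_def)
    qed
  qed
qed

lemma quotient_of_cyclic_moduleE:
  assumes "is_quotient_of act (cyclic_module J)" and J: "left_ideal J"
  obtains v where "module_generated_by act v" and "\<And>x. x \<in> J \<Longrightarrow> act x v = 0"
proof -
  from assms(1) obtain \<phi> where
    add: "\<And>x y. x \<in> mcarrier (cyclic_module J) \<Longrightarrow> y \<in> mcarrier (cyclic_module J)
      \<Longrightarrow> \<phi> (madd (cyclic_module J) x y) = \<phi> x + \<phi> y"
    and mact: "\<And>r x. x \<in> mcarrier (cyclic_module J) \<Longrightarrow> \<phi> (mact (cyclic_module J) r x) = act r (\<phi> x)"
    and surj: "\<phi> ` mcarrier (cyclic_module J) = UNIV"
    unfolding is_quotient_of_def by blast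
  note [simp] = elt_set_plus_def set_plus_def elt_set_times_def
  have J0: "0 \<in> J" and Jadd: "\<And>x y. x \<in> J \<Longrightarrow> y \<in> J \<Longrightarrow> x + y \<in> J" and Jmul: "\<And>r x. x \<in> J \<Longrightarrow> r * x \<in> J"
    using J by (auto simp: left_ideal_def)
  have Jminus: "- x \<in> J" if "x \<in> J" for x using Jmul[OF that, of "- 1"] by simp
  \<comment> \<open>The image of the canonical generator of the cyclic module.\<close>
  define v where "v = \<phi> (1 +o J)"
  have one: "1 +o J \<in> mcarrier (cyclic_module J)" by (auto simp: cyclic_module_def)
  have \<phi>: "\<phi> (r +o J) = act r v" for r
  proof -
    have "r *o (1 +o J) + J = r +o J"
    proof (intro equalityI subsetI)
      fix x assume "x \<in> r *o (1 +o J) + J"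
      then obtain p q where "p \<in> J" "q \<in> J" "x = r * (1 + p) + q" by auto
      then have "x = r + (r * p + q)" "r * p + q \<in> J" by (simp_all add: distrib_left add.assoc Jadd Jmul)
      then show "x \<in> r +o J" unfolding elt_set_plus_def by blast
    next
      fix x assume "x \<in> r +o J"
      then obtain q where "q \<in> J" "x = r * (1 + 0) + q" by auto
      then show "x \<in> r *o (1 +o J) + J"
        using J0 unfolding elt_set_plus_def set_plus_def elt_set_times_def by blast
    qed
    then show ?thesis using mact[OF one, of r] by (simp add: cyclic_module_def v_def del: elt_set_plus_def set_plus_def elt_set_times_def)
  qed
  have "module_generated_by act v"
    unfolding module_generated_by_def
  proof
    fix w
    obtain x where "x \<in> mcarrier (cyclic_module J)" "w = \<phi> x" using surj by auto
    then show "\<exists>u. w = act u v" using \<phi> by (auto simp: cyclic_module_def simp del: elt_set_plus_def)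
  qed
  moreover have "act x v = 0" if x: "x \<in> J" for x
  proof -
    have "x +o J = 0 +o J"
    proof (intro equalityI subsetI)
      fix y assume "y \<in> x +o J"
      then obtain q where "q \<in> J" "y = x + q" by auto
      then show "y \<in> 0 +o J" using Jadd[OF x] by auto
    next
      fix y assume "y \<in> 0 +o J"
      then have "- x + y \<in> J" by (intro Jadd Jminus x) simp
      moreover have "y = x + (- x + y)" by simp
      ultimately show "y \<in> x +o J" unfolding elt_set_plus_def by blast
    qed
    then show ?thesis using \<phi>[of x] \<phi>[of 0] by simp
  qed
  ultimately show ?thesis using that by blast
qed

end

section \<open>Module homomorphisms out of tensor products\<close>

definition quotient_module :: "'r::ring_1 set \<Rightarrow> 'r set \<Rightarrow> ('r, 'r set) mod_struct"
  where "quotient_module S M = \<lparr> mcarrier = {s +o M | s. s \<in> S},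
    madd = (\<lambda>A B. A + B), mact = (\<lambda>s A. s *o A + M) \<rparr>"

context left_module
begin

text \<open>The additive extension of \<open>g\<close> to the free abelian group; integer multiples
  are expressed by the action of the integers of the ring.\<close>

definition int_sum :: "('b \<Rightarrow> 'v) \<Rightarrow> ('b \<Rightarrow>\<^sub>0 int) \<Rightarrow> 'v"
  where "int_sum g p = (\<Sum>k\<in>Poly_Mapping.keys p. act (of_int (Poly_Mapping.lookup p k)) (g k))"

lemma int_sum_superset:
  assumes "finite A" "Poly_Mapping.keys p \<subseteq> A"
  shows "int_sum g p = (\<Sum>k\<in>A. act (of_int (Poly_Mapping.lookup p k)) (g k))"
  unfolding int_sum_def by (rule sum.mono_neutral_left) (use assms in \<open>auto simp: in_keys_iff\<close>)

lemma int_sum_diff: "int_sum g (p - q) = int_sum g p - int_sum g q"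
proof -
  let ?A = "Poly_Mapping.keys p \<union> Poly_Mapping.keys q \<union> Poly_Mapping.keys (p - q)"
  have "int_sum g x = (\<Sum>k\<in>?A. act (of_int (Poly_Mapping.lookup x k)) (g k))" if "x \<in> {p, q, p - q}" for x
    by (rule int_sum_superset) (use that in auto)
  then show ?thesis by (simp add: lookup_minus act_diff_left sum_subtractf)
qed

lemma int_sum_zero [simp]: "int_sum g 0 = 0"
  by (simp add: int_sum_def)

lemma int_sum_add: "int_sum g (p + q) = int_sum g p + int_sum g q"
  using int_sum_diff[of g "p + q" q] by simp

lemma int_sum_frag_of [simp]: "int_sum g (frag_of k) = g k"
  by (simp add: int_sum_def act_one)

end

text \<open>Conditions under which \<open>(a + J) \<otimes> (s + M)\<close> can be sent to
  \<open>a s v\<close>: \<open>M\<close> must kill \<open>v\<close>, and \<open>J\<close> must kill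
  each \<open>s v\<close> with \<open>s\<close> in \<open>S\<close>.\<close>

locale tensor_quotient = left_module act
  for act :: "'r::ring_1 \<Rightarrow> 'v::ab_group_add \<Rightarrow> 'v" +
  fixes S J M :: "'r set" and v :: 'v
  assumes S_one: "1 \<in> S" and S_mult: "s \<in> S \<Longrightarrow> t \<in> S \<Longrightarrow> s * t \<in> S"
    and S_add: "s \<in> S \<Longrightarrow> t \<in> S \<Longrightarrow> s + t \<in> S"
    and J_zero: "0 \<in> J" and M_zero: "0 \<in> M"
    and J_kills: "x \<in> J \<Longrightarrow> s \<in> S \<Longrightarrow> act x (act s v) = 0"
    and M_kills: "x \<in> M \<Longrightarrow> act x v = 0"
    and gen: "module_generated_by act v"
begin

text \<open>The sets \<open>A\<close>, \<open>B\<close> need not be cosets: \<open>(a + J) t\<close>, which occurs in the balancing relations of the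
  tensor product, is not known to be a coset of \<open>J\<close> here.\<close>

definition eval_is :: "'r set \<Rightarrow> 'r set \<Rightarrow> 'v \<Rightarrow> bool"
  where "eval_is A B x \<longleftrightarrow> A \<noteq> {} \<and> B \<noteq> {} \<and> (\<forall>a\<in>A. \<forall>b\<in>B. act a (act b v) = x)"

definition eval_pair :: "'r set \<times> 'r set \<Rightarrow> 'v"
  where "eval_pair p = (THE x. eval_is (fst p) (snd p) x)"

lemma eval_pair_eq: "eval_is A B x \<Longrightarrow> eval_pair (A, B) = x"
  unfolding eval_pair_def by (rule the_equality) (auto simp: eval_is_def)

lemma eval_is_coset: "s \<in> S \<Longrightarrow> eval_is (a +o J) (s +o M) (act a (act s v))"
  using J_zero M_zero
  by (auto simp: eval_is_def elt_set_plus_def act_add_left M_kills J_kills)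

lemma eval_is_add_left: "eval_is A B x \<Longrightarrow> eval_is A' B x' \<Longrightarrow> eval_is (A + A') B (x + x')"
  by (fastforce simp: eval_is_def set_plus_def act_add_left)

lemma eval_is_add_right: "eval_is A B x \<Longrightarrow> eval_is A B' x' \<Longrightarrow> eval_is A (B + B') (x + x')"
  by (fastforce simp: eval_is_def set_plus_def act_add_left act_add_right)

lemma J_kills_coset: "y \<in> J \<Longrightarrow> s \<in> S \<Longrightarrow> b \<in> s +o M \<Longrightarrow> act y (act b v) = 0"
  by (auto simp: elt_set_plus_def act_add_left M_kills J_kills)

lemma set_plus_eq_empty_iff [simp]: "A + B = {} \<longleftrightarrow> A = {} \<or> B = {}" for A B :: "'r set"
  unfolding set_plus_def by blast

text \<open>The summand \<open>J\<close> contributes zero because \<open>B\<close> is a coset of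
  \<open>M\<close> represented in \<open>S\<close>.\<close>

lemma eval_is_mact:
  assumes "eval_is A B x" and "B = s +o M" and "s \<in> S"
  shows "eval_is (r *o A + J) B (act r x)"
  unfolding eval_is_def
proof (intro conjI ballI)
  show "r *o A + J \<noteq> {}" "B \<noteq> {}"
    using assms(1) J_zero by (auto simp: eval_is_def elt_set_times_def)
  fix a b assume "a \<in> r *o A + J" and b: "b \<in> B"
  then obtain a' y where "a' \<in> A" "y \<in> J" "a = r * a' + y" by (auto simp: elt_set_times_def set_plus_def)
  then show "act a (act b v) = act r x"
    using assms b J_kills_coset[of y s b] by (simp add: act_add_left act_act[symmetric] eval_is_def)
qed

text \<open>The balancing condition: \<open>(a t) b\<close> and \<open>a (t b)\<close> act equally,
  and \<open>t * b\<close> is itself an element of \<open>t *o B + M\<close>.\<close>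

lemma eval_is_mract:
  assumes "eval_is A (t *o B + M) x" and "B = s +o M" and "s \<in> S"
  shows "eval_is (A * {t} + J) B x"
  unfolding eval_is_def
proof (intro conjI ballI)
  show "A * {t} + J \<noteq> {}" "B \<noteq> {}"
    using assms J_zero M_zero by (auto simp: eval_is_def set_times_def elt_set_plus_def)
  fix a b assume "a \<in> A * {t} + J" and b: "b \<in> B"
  then obtain a' y where a: "a' \<in> A" "y \<in> J" "a = a' * t + y" by (auto simp: set_times_def set_plus_def)
  have "t * b + 0 \<in> t *o B + M" using b M_zero unfolding elt_set_times_def set_plus_def by blast
  then have "act a' (act (t * b) v) = x" using assms(1) a(1) by (simp add: eval_is_def)
  then show "act a (act b v) = x"
    using assms b a J_kills_coset[of y s b] by (simp add: act_add_left act_act[symmetric])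
qed

lemma eval_is_mact_right:
  assumes "t \<in> S" and "s \<in> S"
  shows "eval_is (a +o J) (t *o (s +o M) + M) (act a (act (t * s) v))"
  unfolding eval_is_def
proof (intro conjI ballI)
  show "a +o J \<noteq> {}" "t *o (s +o M) + M \<noteq> {}"
    using J_zero M_zero by (auto simp: elt_set_times_def set_plus_def elt_set_plus_def)
  fix a' b assume "a' \<in> a +o J" "b \<in> t *o (s +o M) + M"
  then obtain y m m' where *: "y \<in> J" "m \<in> M" "m' \<in> M" "a' = a + y" "b = t * (s + m) + m'"
    by (auto simp: elt_set_times_def set_plus_def elt_set_plus_def)
  have "act b v = act (t * s) v"
    using * by (simp add: distrib_left act_add_left act_act[symmetric] M_kills)
  then show "act a' (act b v) = act a (act (t * s) v)"
    using * J_kills[of y "t * s"] S_mult[OF assms] by (simp add: act_add_left)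
qed

abbreviation "relators \<equiv> tensor_relators S (cyclic_module J) (quotient_module S M)"

definition ext :: "'r \<Rightarrow> ('r set \<times> 'r set \<Rightarrow>\<^sub>0 int) \<Rightarrow> ('r set \<times> 'r set \<Rightarrow>\<^sub>0 int)"
  where "ext r = frag_extend (\<lambda>(x, y). frag_of (mact (cyclic_module J) r x, y))"

lemma ext_frag_of [simp]: "ext r (frag_of (A, B)) = frag_of (r *o A + J, B)"
  by (simp add: ext_def cyclic_module_def)

lemma ext_0 [simp]: "ext r 0 = 0"
  by (simp add: ext_def)

lemma ext_diff: "ext r (p - q) = ext r p - ext r q"
  by (simp add: ext_def frag_extend_diff)

lemma ext_add: "ext r (p + q) = ext r p + ext r q"
  by (simp add: ext_def frag_extend_add)

text \<open>The second part is needed because \<open>mact\<close> of the tensor module applies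
  \<open>ext r\<close> to all representatives of a coset, so the relations must evaluate to zero
  after \<open>ext r\<close> too.\<close>

lemma relators_kill:
  assumes "p \<in> relators"
  shows "int_sum eval_pair p = 0" and "int_sum eval_pair (ext r p) = 0"
proof -
  have carr: "mcarrier (cyclic_module J) = {a +o J | a. True}"
    "mcarrier (quotient_module S M) = {s +o M | s. s \<in> S}"
    by (simp_all add: cyclic_module_def quotient_module_def)
  have ops: "madd (cyclic_module J) A A' = A + A'" "mract (cyclic_module J) A t = A * {t} + J"
    "madd (quotient_module S M) B B' = B + B'" "mact (quotient_module S M) t B = t *o B + M" for A A' B B' t
    by (simp_all add: cyclic_module_def quotient_module_def)
  \<comment> \<open>The common shape of the two families of biadditivity relators; the balancing
    relators have only two terms and are treated separately.\<close>
  have key: "int_sum eval_pair p = 0 \<and> int_sum eval_pair (ext r p) = 0"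
    if "p = frag_of (A, B) - frag_of (A', B') - frag_of (A'', B'')"
      "eval_is A B (y + z)" "eval_is A' B' y" "eval_is A'' B'' z"
      "eval_is (r *o A + J) B (act r (y + z))" "eval_is (r *o A' + J) B' (act r y)" "eval_is (r *o A'' + J) B'' (act r z)"
    for A B A' B' A'' B'' y z
    using that by (simp add: int_sum_diff ext_diff eval_pair_eq act_add_right)
  note assms[unfolded tensor_relators_def carr ops]
  then consider
      (1) a a' s where "s \<in> S" "p = frag_of ((a +o J) + (a' +o J), s +o M) - frag_of (a +o J, s +o M) - frag_of (a' +o J, s +o M)"
    | (2) a s s' where "s \<in> S" "s' \<in> S" "p = frag_of (a +o J, (s +o M) + (s' +o M)) - frag_of (a +o J, s +o M) - frag_of (a +o J, s' +o M)"
    | (3) a t s where "t \<in> S" "s \<in> S" "p = frag_of ((a +o J) * {t} + J, s +o M) - frag_of (a +o J, t *o (s +o M) + M)"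
    by blast
  then have "int_sum eval_pair p = 0 \<and> int_sum eval_pair (ext r p) = 0"
  proof cases
    case 1
    show ?thesis
    proof (rule key[OF 1(2)])
      note c = eval_is_coset[OF 1(1)] and m = eval_is_mact[OF _ refl 1(1)]
      show "eval_is (r *o ((a +o J) + (a' +o J)) + J) (s +o M) (act r (act a (act s v) + act a' (act s v)))"
        by (rule m, rule eval_is_add_left; rule c)
      show "eval_is (r *o (a +o J) + J) (s +o M) (act r (act a (act s v)))"
        "eval_is (r *o (a' +o J) + J) (s +o M) (act r (act a' (act s v)))"
        by (rule m, rule c)+
    qed (rule eval_is_add_left eval_is_coset 1(1))+
  next
    case 2
    have c: "eval_is (r *o (a +o J) + J) (s +o M) (act r (act a (act s v)))" if "s \<in> S" for s
      by (rule eval_is_mact[OF eval_is_coset[OF that] refl that])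
    show ?thesis
    proof (rule key[OF 2(3)])
      show "eval_is (r *o (a +o J) + J) ((s +o M) + (s' +o M)) (act r (act a (act s v) + act a (act s' v)))"
        unfolding act_add_right by (rule eval_is_add_right[OF c[OF 2(1)] c[OF 2(2)]])
    qed (rule c 2(1,2) | rule eval_is_add_right eval_is_coset 2(1,2))+
  next
    case 3
    have e: "eval_is (a +o J) (t *o (s +o M) + M) (act a (act (t * s) v))"
      by (rule eval_is_mact_right[OF 3(1,2)])
    have e1: "eval_is ((a +o J) * {t} + J) (s +o M) (act a (act (t * s) v))"
      by (rule eval_is_mract[OF e refl 3(2)])
    have e2: "eval_is (r *o ((a +o J) * {t} + J) + J) (s +o M) (act r (act a (act (t * s) v)))"
      by (rule eval_is_mact[OF e1 refl 3(2)])
    \<comment> \<open>The second component is not known to be a coset of \<open>M\<close> here, so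
      \<open>eval_is_mact\<close> does not apply and representatives are compared directly.\<close>
    have e3: "eval_is (r *o (a +o J) + J) (t *o (s +o M) + M) (act r (act a (act (t * s) v)))"
      unfolding eval_is_def
    proof (intro conjI ballI)
      show "r *o (a +o J) + J \<noteq> {}" "t *o (s +o M) + M \<noteq> {}"
        using J_zero M_zero by (auto simp: elt_set_times_def set_plus_def elt_set_plus_def)
      fix a' b assume a': "a' \<in> r *o (a +o J) + J" and b: "b \<in> t *o (s +o M) + M"
      from a' obtain y y' where y: "y \<in> J" "y' \<in> J" "a' = r * (a + y) + y'"
        by (auto simp: elt_set_times_def set_plus_def elt_set_plus_def)
      from b obtain m m' where m: "m \<in> M" "m' \<in> M" "b = t * (s + m) + m'"
        by (auto simp: elt_set_times_def set_plus_def elt_set_plus_def)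
      have "act b v = act (t * s) v"
        using m by (simp add: distrib_left act_add_left act_act[symmetric] M_kills)
      then show "act a' (act b v) = act r (act a (act (t * s) v))"
        using y J_kills[of _ "t * s"] S_mult[OF 3(1,2)]
        by (simp add: act_add_left distrib_left act_act[symmetric, of r])
    qed
    show ?thesis
      using e e1 e2 e3 by (simp add: 3(3) int_sum_diff ext_diff eval_pair_eq)
  qed
  then show "int_sum eval_pair p = 0" "int_sum eval_pair (ext r p) = 0" by auto
qed

lemma hull_relators_kill:
  assumes "p \<in> additive_subgroup hull relators"
  shows "int_sum eval_pair p = 0" and "int_sum eval_pair (ext r p) = 0"
proof -
  have "additive_subgroup hull relators \<subseteq> {p. int_sum eval_pair p = 0 \<and> int_sum eval_pair (ext r p) = 0}"
  proof (rule hull_minimal)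
    show "additive_subgroup {p. int_sum eval_pair p = 0 \<and> int_sum eval_pair (ext r p) = 0}"
      by (simp add: additive_subgroup_def int_sum_diff ext_diff)
  qed (use relators_kill in auto)
  then show "int_sum eval_pair p = 0" "int_sum eval_pair (ext r p) = 0" using assms by auto
qed

lemma is_quotient_of_tensor:
  "is_quotient_of act (tensor_module S (cyclic_module J) (quotient_module S M))"
proof -
  define K where "K = additive_subgroup hull relators"
  define T where "T = tensor_module S (cyclic_module J) (quotient_module S M)"
  define C where "C = mcarrier (cyclic_module J) \<times> mcarrier (quotient_module S M)"
  have T: "mcarrier T = {p +o K | p. Poly_Mapping.keys p \<subseteq> C}" "madd T A B = A + B"
    "mact T r A = ext r ` A + K" for A B r
    by (simp_all add: T_def tensor_module_def Let_def K_def C_def ext_def)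
  define \<phi> where "\<phi> A = int_sum eval_pair (SOME p. p \<in> A)" for A
  have \<phi>: "\<phi> A = w" if "A \<noteq> {}" "\<And>p. p \<in> A \<Longrightarrow> int_sum eval_pair p = w" for A w
    unfolding \<phi>_def by (rule that(2)) (use that(1) in \<open>simp add: some_in_eq\<close>)
  have K0: "0 \<in> K" using additive_subgroup_hull by (auto simp: K_def additive_subgroup_def)
  note kill = hull_relators_kill[folded K_def]
  have coset: "\<phi> (p +o K) = int_sum eval_pair p" for p
    by (rule \<phi>) (use K0 in \<open>auto simp: elt_set_plus_def int_sum_add kill\<close>)
  \<comment> \<open>Restricted to combinations of pairs of cosets, on which \<open>eval_pair\<close>
    has a meaningful value.\<close>
  have ext: "int_sum eval_pair (ext r p) = act r (int_sum eval_pair p)" if "Poly_Mapping.keys p \<subseteq> C" for r p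
    using that
  proof (induction p rule: frag_induction)
    case (one k)
    then obtain a s where k: "k = (a +o J, s +o M)" and s: "s \<in> S"
      by (auto simp: C_def cyclic_module_def quotient_module_def)
    have "eval_is (a +o J) (s +o M) (act a (act s v))" by (rule eval_is_coset[OF s])
    from eval_pair_eq[OF this] eval_pair_eq[OF eval_is_mact[OF this refl s, of r]]
    show ?case by (simp add: k)
  next
    case (diff p q)
    then show ?case by (simp add: int_sum_diff ext_diff act_diff_right)
  qed simp
  have "is_quotient_of act T"
    unfolding is_quotient_of_def
  proof (intro exI conjI ballI allI)
    fix x y assume "x \<in> mcarrier T" "y \<in> mcarrier T"
    then obtain p q where x: "x = p +o K" and y: "y = q +o K" by (auto simp: T)
    have "\<phi> (x + y) = int_sum eval_pair p + int_sum eval_pair q"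
      by (rule \<phi>) (use K0 in \<open>auto simp: x y elt_set_plus_def set_plus_def int_sum_add kill\<close>)
    then show "\<phi> (madd T x y) = \<phi> x + \<phi> y" by (simp add: T x y coset)
  next
    fix r x assume "x \<in> mcarrier T"
    then obtain p where x: "x = p +o K" and p: "Poly_Mapping.keys p \<subseteq> C" by (auto simp: T)
    have "\<phi> (ext r ` x + K) = int_sum eval_pair (ext r p)"
      by (rule \<phi>) (use K0 in \<open>auto simp: x elt_set_plus_def set_plus_def ext_add int_sum_add kill\<close>)
    then show "\<phi> (mact T r x) = act r (\<phi> x)" by (simp add: T x coset ext p)
  next
    show "\<phi> ` mcarrier T = UNIV"
    proof (intro equalityI subset_UNIV subsetI)
      fix w
      obtain u where w: "w = act u v" using gen by (auto simp: module_generated_by_def)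
      \<comment> \<open>Surjectivity: \<open>u v\<close> is the image of
        \<open>(u + J) \<otimes> (1 + M)\<close>.\<close>
      have "frag_of (u +o J, 1 +o M) +o K \<in> mcarrier T"
        using S_one by (fastforce simp: T C_def cyclic_module_def quotient_module_def)
      moreover have "\<phi> (frag_of (u +o J, 1 +o M) +o K) = w"
        using eval_pair_eq[OF eval_is_coset[OF S_one, of u]] by (simp add: coset w act_one)
      ultimately show "w \<in> \<phi> ` mcarrier T" by (metis image_eqI)
    qed
  qed
  then show ?thesis by (simp add: T_def)
qed

end

section \<open>Universal properties of \<open>W(\<lambda>)\<close> and \<open>W(\<pi>)\<close>\<close>

context loop_module
begin

lemma sl2_relations:
  assumes "i \<in> idx D"
  defines "e \<equiv> j (xpi D i \<otimes>t 0)" and "f \<equiv> j (xmi D i \<otimes>t 0)" and "h \<equiv> j (hci D i \<otimes>t 0)"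
  shows "e * f = f * e + h" and "h * f = f * h - 2 * f"
    and "v \<in> V \<Longrightarrow> act e v = 0" and "v \<in> V \<Longrightarrow> act h v = scal act (\<mu> (hci D i)) v"
proof -
  have p: "sroot D i \<in> pos_roots D" by (rule sroot_pos_roots[OF D assms(1)])
  interpret s: sl2_loop "\<lambda>m. j (xpi D i \<otimes>t m)" "\<lambda>m. j (xmi D i \<otimes>t m)" "\<lambda>m. j (hci D i \<otimes>t m)"
    by (rule sl2_loop[OF D p])
  show "e * f = f * e + h" "h * f = f * h - 2 * f"
    using s.ef[of 0 0] s.hf[of 0 0] by (simp_all add: e_def f_def h_def)
  show "v \<in> V \<Longrightarrow> act e v = 0" "v \<in> V \<Longrightarrow> act h v = scal act (\<mu> (hci D i)) v"
    using p lie_datumD(4)[OF D p] by (simp_all add: loop_hw_space_def e_def h_def)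
qed

lemma nilpotent_highest_weight:
  assumes i: "i \<in> idx D" and v: "v \<in> V" "v \<noteq> 0" and nil: "act (j (xmi D i \<otimes>t 0) ^ K) v = 0"
  obtains N where "\<mu> (hci D i) = of_nat N" and "act (j (xmi D i \<otimes>t 0) ^ Suc N) v = 0"
  using sl2_nilpotent_highest_weight[OF sl2_relations(1,2)[OF i] sl2_relations(3,4)[OF i v(1)] nil v(2)]
  by blast

end

section \<open>Integrable modules as quotients of \<open>W(\<lambda>)\<close>\<close>

lemma quotient_of_weyl_module_e:
  fixes D :: "'g::complex_lie_algebra lie_data" and act :: "'g eloop env \<Rightarrow> 'v::ab_group_add \<Rightarrow> 'v"
  assumes D: "lie_datum D" and lam: "lam \<in> P_plus_e D" and act: "left_module act"
    and int: "integrable_module D act" and v: "v \<in> hw_space_e D act lam"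
    and gen: "module_generated_by act v"
  shows "is_quotient_of act (weyl_module_e D lam)"
proof -
  let ?j = "\<lambda>f :: 'g loop. env_of (loop_incl f)"
  interpret loop_module ?j act D "restrict_wt lam"
  proof -
    interpret left_module act by fact
    have incl: "loop_incl (c *\<^sub>C x) = c *\<^sub>C loop_incl x" "loop_incl (lie_bracket x y) = lie_bracket (loop_incl x) (loop_incl y)"
      for c and x y :: "'g loop"
      by (simp_all add: scaleC_eloop_def lie_bracket_eloop_def)
    show "loop_module ?j act D"
      by unfold_locales (simp_all only: incl env_of_relators D)
  qed
  have cart: "loop_incl (h \<otimes>t 0) \<in> cartan_e D" if "h \<in> cartan D" for h
    using that by (auto simp: cartan_e_def)
  have vV: "v \<in> V"
    using v cart by (auto simp: hw_space_e_def weight_space_e_def loop_hw_space_def restrict_wt_def scal_def)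
  have "ELoop (0 \<otimes>t 0) 1 \<in> cartan_e D"
    using complex_vector.subspace_0[OF lie_datumD(1)[OF D]] unfolding cartan_e_def by blast
  then have "d_elt \<in> cartan_e D" by simp
  then have d: "act (env_of d_elt) v = act (env_const (lam d_elt)) v"
    using v by (simp add: hw_space_e_def weight_space_e_def)
  have nil: "\<exists>N. restrict_wt lam (hci D i) = of_nat N \<and> (\<forall>w\<in>V. act (?j (xmi D i \<otimes>t 0) ^ Suc N) w = 0)"
    if i: "i \<in> idx D" for i
  proof -
    have "restrict_wt lam (hci D i) \<in> \<nat>" using lam i by (simp add: P_plus_e_def)
    then obtain N where N: "restrict_wt lam (hci D i) = of_nat N" by (rule Nats_cases)
    \<comment> \<open>Local nilpotency gives an exponent that depends on \<open>w\<close>; the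
      common weight of the vectors in \<open>V\<close> makes \<open>Suc N\<close> work for all of
      them.\<close>
    have "act (?j (xmi D i \<otimes>t 0) ^ Suc N) w = 0" if w: "w \<in> V" for w
    proof (cases "w = 0")
      case False
      obtain K where "act (?j (xmi D i \<otimes>t 0) ^ K) w = 0"
        using int i unfolding integrable_module_def locally_nilpotent_def by blast
      from nilpotent_highest_weight[OF i w False this] obtain M
        where "restrict_wt lam (hci D i) = of_nat M" "act (?j (xmi D i \<otimes>t 0) ^ Suc M) w = 0" by blast
      then show ?thesis using N by simp
    qed simp
    then show ?thesis using N by blast
  qed
  have "act x v = 0" if "x \<in> weyl_ideal_e D lam" for x
    using that unfolding weyl_ideal_e_def
    by (rule hull_left_ideal_kills[rotated]) (use weyl_relators_kill[OF nil _ vV] d in \<open>auto simp: act_diff_left\<close>)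
  then show ?thesis
    unfolding weyl_module_e_def
    by (rule quotient_of_cyclic_moduleI) (simp_all add: weyl_ideal_e_def left_ideal_hull gen)
qed

section \<open>Eigenvalues of \<open>U(0)\<close> and the modules \<open>W(\<pi>)\<close>\<close>

lemma minus_poly_coeff:
  assumes "\<And>m. m \<le> N \<Longrightarrow> coeff p N * c m = coeff p (N - m)" and "\<And>m. m > N \<Longrightarrow> c m = 0"
    and "degree p = N" "coeff p N \<noteq> 0"
  shows "coeff (minus_poly p) m = c m"
  \<comment> \<open>The reflected polynomial has coefficient \<open>coeff p (N - m)\<close> in
    degree m and constant term \<open>coeff p N\<close>, so the hypothesis says that
    \<open>c\<close> is its normalisation.\<close>
  using assms(1)[of m] assms(2)[of m] assms(3,4)
  by (cases "m \<le> N") (auto simp: minus_poly_def coeff_reflect_poly field_simps)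

text \<open>Common to both statements about finite-dimensional modules. \<open>U(0)\<close>
  preserves the weight line through \<open>v\<close>, so \<open>v\<close> is a common eigenvector;
  the relations of \<open>W(\<lambda>)\<close> make the eigenvalues the coefficients of polynomials
  \<open>\<pi> i\<close> and of their reflections.\<close>

lemma quotient_of_weyl_module_pi:
  fixes D :: "'g::complex_lie_algebra lie_data" and act :: "'g loop env \<Rightarrow> 'w::ab_group_add \<Rightarrow> 'w"
  assumes D: "lie_datum D" and act: "left_module act" and lam: "lam \<in> P_plus_e D"
    and kill: "\<And>x. x \<in> weyl_ideal D lam \<Longrightarrow> act x v = 0" and gen: "module_generated_by act v"
    and dim: "vector_space.dim (scal act) (weight_space D act (restrict_wt lam)) = 1"
  shows "\<exists>\<pi> lam'. (\<forall>i\<in>idx D. coeff (\<pi> i) 0 = 1) \<and> is_lambda_pi D \<pi> lam'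
    \<and> is_quotient_of act (weyl_module_pi D lam' \<pi>)"
proof -
  let ?\<mu> = "restrict_wt lam"
  interpret left_module act by fact
  interpret loop_module "env_of :: 'g loop \<Rightarrow> _" act D ?\<mu>
    by unfold_locales (simp_all only: env_of_relators D)
  define W where "W = weight_space D act ?\<mu>"
  have W: "w \<in> W \<longleftrightarrow> (\<forall>h\<in>cartan D. act (env_of (h \<otimes>t 0)) w = scal act (?\<mu> h) w)" for w
    by (simp add: W_def weight_space_def scal_def)
  have rel: "act x v = 0" if "x \<in> weyl_relators D env_of ?\<mu>" for x
    by (rule kill) (use that in \<open>auto simp: weyl_ideal_def intro: hull_inc\<close>)
  have "v \<noteq> 0" using dim gen by (rule dim_1_generator_nonzero)
  have "act (env_of (h \<otimes>t 0) - env_const (?\<mu> h)) v = 0" if "h \<in> cartan D" for h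
    by (rule rel) (use that in \<open>unfold weyl_relators_def, blast\<close>)
  then have vW: "v \<in> W" by (simp add: W act_diff_left scal_def)
  have U0_W: "act u v \<in> W" if "u \<in> U0 D env_of" for u
  proof -
    have "u \<in> {u. \<forall>w\<in>W. act u w \<in> W}"
    proof (rule U0_induct[OF that])
      have "act (env_of (hc D \<beta> \<otimes>t m)) w \<in> W" if \<beta>: "\<beta> \<in> pos_roots D" and w: "w \<in> W" for \<beta> m w
        unfolding W
      proof
        fix h assume h: "h \<in> cartan D"
        have "act (env_of (h \<otimes>t 0)) (act (env_of (hc D \<beta> \<otimes>t m)) w)
            = act (env_of (hc D \<beta> \<otimes>t m)) (act (env_of (h \<otimes>t 0)) w)"
          unfolding act_act j_commute[OF lie_datumD(2)[OF D h lie_datumD(4)[OF D \<beta>]]] ..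
        also have "\<dots> = scal act (?\<mu> h) (act (env_of (hc D \<beta> \<otimes>t m)) w)"
          using w h by (simp add: W act_scal)
        finally show "act (env_of (h \<otimes>t 0)) (act (env_of (hc D \<beta> \<otimes>t m)) w)
            = scal act (?\<mu> h) (act (env_of (hc D \<beta> \<otimes>t m)) w)" .
      qed
      then show "env_of (hc D \<beta> \<otimes>t m) \<in> {u. \<forall>w\<in>W. act u w \<in> W}" if "\<beta> \<in> pos_roots D" for \<beta> m
        using that by blast
      have "vs.subspace W"
        by (rule vs.subspaceI) (simp_all add: W act_add_right vs.scale_right_distrib act_scal mult.commute)
      then show "complex_vector.subspace {u. \<forall>w\<in>W. act u w \<in> W}"
        by (simp add: complex_vector.subspace_def act_add_left act_scaleC vs.subspace_0 vs.subspace_add vs.subspace_scale)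
      show "1 \<in> {u. \<forall>w\<in>W. act u w \<in> W}" by (simp add: act_one)
      show "x * y \<in> {u. \<forall>w\<in>W. act u w \<in> W}"
        if "x \<in> {u. \<forall>w\<in>W. act u w \<in> W}" "y \<in> {u. \<forall>w\<in>W. act u w \<in> W}" for x y
        using that by (simp add: act_act[symmetric])
    qed
    then show ?thesis using vW by blast
  qed
  have U0_scal: "\<exists>c. act u v = scal act c v" if "u \<in> U0 D env_of" for u
    by (rule dim_1_multiple[OF dim[folded W_def] vW \<open>v \<noteq> 0\<close> U0_W[OF that]])
  define c where "c \<epsilon> i m = (SOME c. act (Lambda_ser D env_of \<epsilon> i $ m) v = scal act c v)" for \<epsilon> i m
  have c: "act (Lambda_ser D env_of \<epsilon> i $ m) v = scal act (c \<epsilon> i m) v" if "i \<in> idx D" "\<epsilon> \<noteq> 0" for \<epsilon> i m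
    unfolding c_def by (rule someI_ex[OF U0_scal[OF Lambda_ser_U0[OF D that]]])
  have c_eq: "c \<epsilon> i m = x" if "i \<in> idx D" "\<epsilon> \<noteq> 0" "act (Lambda_ser D env_of \<epsilon> i $ m) v = scal act x v" for \<epsilon> i m x
    using c[OF that(1,2), of m] that(3) \<open>v \<noteq> 0\<close> by simp
  define N where "N = wt_nat D ?\<mu>"
  have N: "?\<mu> (hci D i) = of_nat (N i)" if i: "i \<in> idx D" for i
  proof -
    have "?\<mu> (hci D i) \<in> \<nat>" using lam i by (simp add: P_plus_e_def)
    then obtain M where M: "?\<mu> (hci D i) = of_nat M" by (rule Nats_cases)
    then have "N i = M" unfolding N_def wt_nat_def by (intro the_equality) auto
    then show ?thesis using M by simp
  qed
  have lam0: "Lambda_ser D env_of \<epsilon> i $ 0 = (1 :: 'g loop env)" for \<epsilon> i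
    using exp_ser_0[of \<epsilon> "\<lambda>m. env_of (hci D i \<otimes>t m)"] by (simp add: Lambda_ser_def exp_ser_def)
  have c0: "c \<epsilon> i 0 = 1" if "i \<in> idx D" "\<epsilon> \<noteq> 0" for \<epsilon> i
    by (rule c_eq[OF that]) (simp add: lam0 act_one)
  have Lp: "Lambda D env_of i (int m) = Lambda_ser D env_of 1 i $ m" for i m
    by (simp add: Lambda_def)
  have Ln: "Lambda D env_of i (- int m) = Lambda_ser D env_of (- 1) i $ m" if "m > 0" for i m
    using that by (simp add: Lambda_def)
  have big: "act (Lambda D env_of i m) v = 0" if "i \<in> idx D" "\<bar>m\<bar> > int (N i)" for i m
    by (rule rel) (use that in \<open>unfold weyl_relators_def N_def, blast\<close>)
  have c_big: "c 1 i m = 0" "c (- 1) i m = 0" if "i \<in> idx D" "N i < m" for i m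
    using big[OF that(1), of "int m"] big[OF that(1), of "- int m"] that
    by (intro c_eq; simp add: Lp Ln)+
  have c_refl: "c 1 i (N i) * c (- 1) i m = c 1 i (N i - m)" if i: "i \<in> idx D" and m: "m \<le> N i" for i m
  \<comment> \<open>The relators start at \<open>m = 1\<close>; for \<open>m = 0\<close> the
    equation holds since the constant term of \<open>\<Lambda>\<close> is 1.\<close>
  proof (cases "m = 0")
    case False
    have "act (Lambda D env_of i (int (N i)) * Lambda D env_of i (- int m) - Lambda D env_of i (int (N i) - int m)) v = 0"
    proof (rule rel)
      have "1 \<le> int m" "int m \<le> int (N i)" using False m by auto
      then show "Lambda D env_of i (int (N i)) * Lambda D env_of i (- int m) - Lambda D env_of i (int (N i) - int m)
          \<in> weyl_relators D env_of ?\<mu>"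
        using i unfolding weyl_relators_def N_def by blast
    qed
    moreover have "int (N i) - int m = int (N i - m)" using m by (simp add: of_nat_diff)
    ultimately have "act (Lambda_ser D env_of 1 i $ N i) (act (Lambda_ser D env_of (- 1) i $ m) v)
        = act (Lambda_ser D env_of 1 i $ (N i - m)) v"
      by (simp only: Lp Ln[OF False[unfolded neq0_conv]] act_diff_left act_act right_minus_eq)
    then have "scal act (c (- 1) i m * c 1 i (N i)) v = scal act (c 1 i (N i - m)) v"
      using i by (simp add: c act_scal)
    then show ?thesis using \<open>v \<noteq> 0\<close> by (simp add: mult.commute)
  qed (simp add: c0[OF i])
  \<comment> \<open>The case \<open>m = N i\<close>: the product with \<open>c (- 1) i (N i)\<close>
    is \<open>c 1 i 0 = 1\<close>. So \<open>\<pi> i\<close> has degree exactly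
    \<open>N i\<close>.\<close>
  have c_top: "c 1 i (N i) \<noteq> 0" if "i \<in> idx D" for i
    using c_refl[OF that order_refl] c0[OF that, of 1] by auto
  define \<pi> where "\<pi> i = (\<Sum>m\<le>N i. monom (c 1 i m) m)" for i
  have coeff: "coeff (\<pi> i) m = c 1 i m" if "i \<in> idx D" for i m
    using c_big(1)[OF that, of m] by (cases "m \<le> N i") (auto simp: \<pi>_def coeff_sum coeff_monom if_distrib cong: if_cong)
  have deg: "degree (\<pi> i) = N i" if i: "i \<in> idx D" for i
  proof (rule antisym)
    show "degree (\<pi> i) \<le> N i" by (rule degree_le) (simp add: coeff[OF i] c_big[OF i])
    show "N i \<le> degree (\<pi> i)" by (rule le_degree) (simp add: coeff[OF i] c_top[OF i])
  qed
  have minus: "coeff (minus_poly (\<pi> i)) m = c (- 1) i m" if i: "i \<in> idx D" for i m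
    by (rule minus_poly_coeff[of "N i"]) (use i in \<open>simp_all add: coeff deg c_refl c_big c_top\<close>)
  have M_kill: "act x v = 0" if "x \<in> max_ideal_pi D \<pi>" for x
  proof -
    \<comment> \<open>The annihilator of \<open>v\<close> is closed under left multiplication and
      contains the generators, by the choice of the coefficients of \<open>\<pi>\<close>.\<close>
    have "max_ideal_pi D \<pi> \<subseteq> {x. act x v = 0}"
      unfolding max_ideal_pi_def
      by (rule hull_minimal)
        (auto simp: additive_subgroup_def act_diff_left act_act[symmetric] c coeff minus simp flip: scal_def)
    then show ?thesis using that by auto
  qed
  have J: "left_ideal (weyl_ideal D lam)" by (simp add: weyl_ideal_def left_ideal_hull)
  interpret tensor_quotient act "U0 D env_of" "weyl_ideal D lam" "max_ideal_pi D \<pi>" v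
  proof
    show "1 \<in> U0 D (env_of :: 'g loop \<Rightarrow> _)" by (rule one_U0)
    show "s * t \<in> U0 D env_of" if "s \<in> U0 D env_of" "t \<in> U0 D env_of" for s t :: "'g loop env"
      using that by (rule mult_U0)
    show "s + t \<in> U0 D env_of" if "s \<in> U0 D env_of" "t \<in> U0 D env_of" for s t :: "'g loop env"
      using that by (rule complex_vector.subspace_add[OF subspace_U0])
    show "0 \<in> weyl_ideal D lam" using J by (simp add: left_ideal_def)
    have "additive_subgroup (max_ideal_pi D \<pi>)"
      unfolding max_ideal_pi_def
      by (rule conjunct1, rule hull_in) (auto simp: additive_subgroup_def)
    then show "0 \<in> max_ideal_pi D \<pi>" by (simp add: additive_subgroup_def)
    \<comment> \<open>An element of \<open>U(0)\<close> only rescales \<open>v\<close>, so it is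
      enough that the left ideal kills \<open>v\<close>.\<close>
    show "act x (act s v) = 0" if x: "x \<in> weyl_ideal D lam" and s: "s \<in> U0 D env_of" for x s
    proof -
      obtain a where "act s v = scal act a v" using U0_scal[OF s] by blast
      then show ?thesis by (simp add: act_scal kill[OF x])
    qed
  qed (fact M_kill gen)+
  have "is_quotient_of act (weyl_module_pi D lam \<pi>)"
    using is_quotient_of_tensor by (simp add: weyl_module_pi_def weyl_module_def C_pi_def quotient_module_def)
  moreover have "is_lambda_pi D \<pi> lam" using lam by (simp add: is_lambda_pi_def N deg)
  moreover have "\<forall>i\<in>idx D. coeff (\<pi> i) 0 = 1" by (simp add: coeff c0)
  ultimately show ?thesis by blast
qed

text \<open>Finite dimension yields nilpotency of each \<open>f 0\<close> on \<open>v\<close>; this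
  makes the weight dominant and, through the sl_2 results, forces the relations of
  \<open>W(\<lambda>)\<close>.\<close>

lemma finite_dim_killed_by_weyl_ideal:
  fixes D :: "'g::complex_lie_algebra lie_data" and act :: "'g loop env \<Rightarrow> 'w::ab_group_add \<Rightarrow> 'w"
  assumes D: "lie_datum D" and act: "left_module act" and lam: "lam \<in> dual (cartan D)"
    and fin: "finite_dim_module act" and v: "v \<in> hw_space D act lam" and gen: "module_generated_by act v"
    and dim: "vector_space.dim (scal act) (weight_space D act lam) = 1"
  obtains lam' where "lam' \<in> P_plus_e D" and "restrict_wt lam' = lam"
    and "\<And>x. x \<in> weyl_ideal D lam' \<Longrightarrow> act x v = 0"
proof -
  interpret left_module act by fact
  interpret loop_module "env_of :: 'g loop \<Rightarrow> _" act D lam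
    by unfold_locales (simp_all only: env_of_relators D)
  have V: "V = hw_space D act lam"
    by (auto simp: hw_space_def weight_space_def loop_hw_space_def scal_def)
  have sub: "V \<subseteq> weight_space D act lam" by (auto simp: V hw_space_def)
  have "v \<noteq> 0" using dim gen by (rule dim_1_generator_nonzero)
  \<comment> \<open>All highest weight vectors lie on the line through \<open>v\<close>, so
    nilpotency has to be established for \<open>v\<close> only.\<close>
  have mult: "\<exists>c. w = scal act c v" if "w \<in> V" for w
    by (rule dim_1_multiple[OF dim _ \<open>v \<noteq> 0\<close>]) (use v that sub V in auto)
  obtain B where B: "finite B" "vs.span B = UNIV" using fin by (auto simp: finite_dim_module_def)
  have nil: "\<exists>N. lam (hci D i) = of_nat N \<and> (\<forall>w\<in>V. act (env_of (xmi D i \<otimes>t 0) ^ Suc N) w = 0)"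
    if i: "i \<in> idx D" for i
  proof -
    have vV: "v \<in> V" using v V by simp
    obtain K where K: "act (env_of (xmi D i \<otimes>t 0) ^ K) v = 0"
      using sl2_nilpotent_finite_dim[OF sl2_relations(2)[OF i] sl2_relations(4)[OF i vV] B] by blast
    from nilpotent_highest_weight[OF i vV \<open>v \<noteq> 0\<close> K] obtain N
      where N: "lam (hci D i) = of_nat N" "act (env_of (xmi D i \<otimes>t 0) ^ Suc N) v = 0" by blast
    have "act (env_of (xmi D i \<otimes>t 0) ^ Suc N) w = 0" if w: "w \<in> V" for w
    proof -
      obtain a where "w = scal act a v" using mult[OF w] by blast
      then show ?thesis by (simp only: act_scal N(2) vs.scale_zero_right)
    qed
    then show ?thesis using N(1) by blast
  qed
  \<comment> \<open>The extension of \<open>lam\<close> to the extended Cartan subalgebra with value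
    0 at \<open>d\<close>; the coefficient of degree 0 recovers the part in the Cartan
    subalgebra.\<close>
  define lam' where "lam' x = (if x \<in> cartan_e D then lam (Poly_Mapping.lookup (loop_part x) 0) else 0)" for x
  have cart: "ELoop (h \<otimes>t 0) a \<in> cartan_e D \<longleftrightarrow> h \<in> cartan D" for h a
  proof
    assume "ELoop (h \<otimes>t 0) a \<in> cartan_e D"
    then obtain h' where "h' \<in> cartan D" "h \<otimes>t 0 = (h' \<otimes>t 0 :: 'g loop)" by (auto simp: cartan_e_def)
    then show "h \<in> cartan D" by (metis lookup_single_eq)
  qed (auto simp: cartan_e_def)
  have lam'_eq: "lam' (ELoop (h \<otimes>t 0) a) = lam h" for h a
    using lam by (auto simp: lam'_def cart dual_def)
  have restrict: "restrict_wt lam' = lam"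
    by (rule ext) (simp add: restrict_wt_def lam'_eq)
  note sp = lie_datumD(1)[OF D]
  have "lam' \<in> dual (cartan_e D)"
    unfolding dual_def
  proof (intro CollectI conjI ballI allI impI)
    fix x y assume "x \<in> cartan_e D" "y \<in> cartan_e D"
    then obtain h a k b where *: "h \<in> cartan D" "k \<in> cartan D" "x = ELoop (h \<otimes>t 0) a" "y = ELoop (k \<otimes>t 0) b"
      by (auto simp: cartan_e_def)
    have "x + y = ELoop ((h + k) \<otimes>t 0) (a + b)" by (simp add: * plus_eloop_def single_add)
    then show "lam' (x + y) = lam' x + lam' y" using * lam by (simp add: lam'_eq dual_def)
  next
    fix s x assume "x \<in> cartan_e D"
    then obtain h a where *: "h \<in> cartan D" "x = ELoop (h \<otimes>t 0) a" by (auto simp: cartan_e_def)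
    have "s *\<^sub>C x = ELoop ((s *\<^sub>C h) \<otimes>t 0) (s * a)" by (simp add: * scaleC_eloop_def single_scaleC)
    then show "lam' (s *\<^sub>C x) = s * lam' x" using * lam by (simp add: lam'_eq dual_def)
  qed (simp add: lam'_def)
  moreover have "lam' d_elt \<in> \<int>"
  proof -
    have "lam (0 *\<^sub>C 0) = 0 * lam 0"
      using lam complex_vector.subspace_0[OF sp] unfolding dual_def by blast
    then show ?thesis using lam'_eq[of 0 1] by simp
  qed
  moreover have "lam (hci D i) \<in> \<nat>" if "i \<in> idx D" for i using nil[OF that] by auto
  ultimately have "lam' \<in> P_plus_e D" by (simp add: P_plus_e_def restrict)
  moreover have "act x v = 0" if "x \<in> weyl_ideal D lam'" for x
    using that unfolding weyl_ideal_def restrict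
    by (rule hull_left_ideal_kills[rotated]) (use weyl_relators_kill[OF nil] v V in auto)
  ultimately show ?thesis using that restrict by blast
qed

theorem proposition3p1:
  fixes D :: "'g::complex_lie_algebra lie_data"
  assumes "lie_datum D"
  shows
    "(\<forall>lam\<in>P_plus_e D. \<forall>(act :: 'g eloop env \<Rightarrow> 'v::ab_group_add \<Rightarrow> 'v) v.
        left_module act \<and> integrable_module D act
        \<and> v \<in> hw_space_e D act lam \<and> v \<noteq> 0 \<and> module_generated_by act v
        \<longrightarrow> is_quotient_of act (weyl_module_e D lam))
   \<and> (\<forall>lam\<in>P_plus_e D. \<forall>act :: 'g loop env \<Rightarrow> 'w::ab_group_add \<Rightarrow> 'w.
        left_module act \<and> is_quotient_of act (weyl_module D lam) \<and> finite_dim_module act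
        \<and> vector_space.dim (scal act) (weight_space D act (restrict_wt lam)) = 1
        \<longrightarrow> (\<exists>\<pi> lam'. (\<forall>i\<in>idx D. coeff (\<pi> i) 0 = 1) \<and> is_lambda_pi D \<pi> lam'
              \<and> is_quotient_of act (weyl_module_pi D lam' \<pi>)))
   \<and> (\<forall>lam\<in>dual (cartan D). \<forall>(act :: 'g loop env \<Rightarrow> 'w \<Rightarrow> 'w) v.
        left_module act \<and> finite_dim_module act
        \<and> v \<in> hw_space D act lam \<and> module_generated_by act v
        \<and> vector_space.dim (scal act) (weight_space D act lam) = 1
        \<longrightarrow> (\<exists>\<pi> lam'. (\<forall>i\<in>idx D. coeff (\<pi> i) 0 = 1) \<and> is_lambda_pi D \<pi> lam'
              \<and> is_quotient_of act (weyl_module_pi D lam' \<pi>)))"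
proof (intro conjI ballI allI impI; elim conjE)
  fix lam and act :: "'g eloop env \<Rightarrow> 'v \<Rightarrow> 'v" and v
  assume "lam \<in> P_plus_e D" "left_module act" "integrable_module D act"
    "v \<in> hw_space_e D act lam" "module_generated_by act v"
  then show "is_quotient_of act (weyl_module_e D lam)"
    by (rule quotient_of_weyl_module_e[OF assms])
next
  fix lam and act :: "'g loop env \<Rightarrow> 'w \<Rightarrow> 'w"
  assume lam: "lam \<in> P_plus_e D" and act: "left_module act" and q: "is_quotient_of act (weyl_module D lam)"
    and dim: "vector_space.dim (scal act) (weight_space D act (restrict_wt lam)) = 1"
  obtain v where "module_generated_by act v" "\<And>x. x \<in> weyl_ideal D lam \<Longrightarrow> act x v = 0"
    using left_module.quotient_of_cyclic_moduleE[OF act q[unfolded weyl_module_def]]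
    by (metis left_ideal_hull weyl_ideal_def)
  then show "\<exists>\<pi> lam'. (\<forall>i\<in>idx D. coeff (\<pi> i) 0 = 1) \<and> is_lambda_pi D \<pi> lam'
      \<and> is_quotient_of act (weyl_module_pi D lam' \<pi>)"
    using quotient_of_weyl_module_pi[OF assms act lam] dim by blast
next
  fix lam and act :: "'g loop env \<Rightarrow> 'w \<Rightarrow> 'w" and v
  assume lam: "lam \<in> dual (cartan D)" and act: "left_module act" and fin: "finite_dim_module act"
    and v: "v \<in> hw_space D act lam" and gen: "module_generated_by act v"
    and dim: "vector_space.dim (scal act) (weight_space D act lam) = 1"
  \<comment> \<open>With the extended weight \<open>lam'\<close> the vector \<open>v\<close>
    satisfies the relations of \<open>W(lam')\<close>, which brings the situation to that of the
    previous case.\<close>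
  obtain lam' where lam': "lam' \<in> P_plus_e D" "restrict_wt lam' = lam" "\<And>x. x \<in> weyl_ideal D lam' \<Longrightarrow> act x v = 0"
    using finite_dim_killed_by_weyl_ideal[OF assms act lam fin v gen dim] by blast
  show "\<exists>\<pi> lam'. (\<forall>i\<in>idx D. coeff (\<pi> i) 0 = 1) \<and> is_lambda_pi D \<pi> lam'
      \<and> is_quotient_of act (weyl_module_pi D lam' \<pi>)"
    by (rule quotient_of_weyl_module_pi[OF assms act lam'(1,3) gen]) (simp_all add: lam'(2) dim)
qed

end
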